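(* Let $G$ be a minimal ample groupoid with compact unit space. Then the following are equivalent: (1) The $C^*$-algebra $C_r^*(G)$ admits a faithful tracial state. (2) The $C^*$-algebra $C_r^*(G)$ is stably finite. (3) Every clopen subset of $G^{(0)}$ is completely $G^a$-non-paradoxical.
   Context: Groupoids are locally compact Hausdorff with continuous product and inversion; $G^{(0)}$ is the unit space, $r(g)=gg^{-1}$, $d(g)=g^{-1}g$. $G$ is étale if $r,d$ are local homeomorphisms. A bisection is a subset $S\subseteq G$ such that $r|_S$ and $d|_S$ are homeomorphisms onto open subsets of $G$. An étale groupoid is ample if it has a basis of compact open bisections; $G^a$ is the set of compact open bisections. $D\subseteq G^{(0)}$ is invariant if $d(g)\in D$ implies $r(g)\in D$. $G$ is minimal if $G^{(0)}$ has no proper non-trivial closed invariant subsets. $C_r^*(G)$ is the reduced groupoid $C^*$-algebra; it is unital here. A unital $C^*$-algebra $A$ is stably finite if for every $n$ the unit of $M_n(A)$ is not Murray–von Neumann equivalent to a proper subprojection. For integers $k>l>0$, a non-empty subset $A\subseteq G^{(0)}$ is $(G^a,k,l)$-paradoxical if for each $1\le i\le k$ there are $n_i\in\mathbb{N}$, bisections $V_{i,1},\dots,V_{i,n_i}\in G^a$ and $m_{i,1},\dots,m_{i,n_i}\in\{1,\dots,l\}$ such that $\bigcup_{j=1}^{n_i}d(V_{i,j})=A$ for all $i$, and the sets $r(V_{i,j})\times\{m_{i,j}\}\subseteq A\times\{1,\dots,l\}$ are pairwise disjoint. $A$ is completely $G^a$-non-paradoxical if it fails to be $(G^a,k,l)$-paradoxical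 for all integers $k>l>0$. *)

theory Defs
  imports "HOL-Analysis.Analysis"
begin

section \<open>Topological groupoids\<close>

text \<open>The groupoid is the whole (automatically non-empty) type; \<^term>\<open>mul\<close> is only meaningful on
  composable pairs. The algebraic axioms are those of Renault.\<close>

record 'g groupoid =
  composable :: "('g \<times> 'g) set"
  mul :: "'g \<Rightarrow> 'g \<Rightarrow> 'g"
  ginv :: "'g \<Rightarrow> 'g"

definition rmap :: "'g groupoid \<Rightarrow> 'g \<Rightarrow> 'g" where
  "rmap G g = mul G g (ginv G g)"

definition dmap :: "'g groupoid \<Rightarrow> 'g \<Rightarrow> 'g" where
  "dmap G g = mul G (ginv G g) g"

definition units :: "'g groupoid \<Rightarrow> 'g set" where
  "units G = range (rmap G)"

locale groupoid =
  fixes G :: "'g groupoid"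
  assumes ginv_ginv: "ginv G (ginv G g) = g"
    and composable_mul:
      "(g, h) \<in> composable G \<Longrightarrow> (h, k) \<in> composable G \<Longrightarrow>
        (mul G g h, k) \<in> composable G \<and> (g, mul G h k) \<in> composable G"
    and mul_assoc:
      "(g, h) \<in> composable G \<Longrightarrow> (h, k) \<in> composable G \<Longrightarrow>
        mul G (mul G g h) k = mul G g (mul G h k)"
    and composable_ginv: "(ginv G g, g) \<in> composable G"
    and ginv_mul_cancel: "(g, h) \<in> composable G \<Longrightarrow> mul G (ginv G g) (mul G g h) = h"
    and mul_ginv_cancel: "(g, h) \<in> composable G \<Longrightarrow> mul G (mul G g h) (ginv G h) = g"

locale topological_groupoid = groupoid G for G :: "'g::t2_space groupoid" +
  assumes locally_compact: "locally compact (UNIV :: 'g set)"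
    and continuous_mul: "continuous_on (composable G) (\<lambda>(g, h). mul G g h)"
    and continuous_ginv: "continuous_on UNIV (ginv G)"

definition local_homeo_onto_units ::
    "'g::topological_space groupoid \<Rightarrow> ('g \<Rightarrow> 'g) \<Rightarrow> bool" where
  "local_homeo_onto_units G p \<longleftrightarrow>
    (\<forall>g. \<exists>U. open U \<and> g \<in> U \<and> openin (top_of_set (units G)) (p ` U) \<and>
      (\<exists>q. homeomorphism U (p ` U) p q))"

locale etale_groupoid = topological_groupoid G for G :: "'g::t2_space groupoid" +
  assumes local_homeo_rmap: "local_homeo_onto_units G (rmap G)"
    and local_homeo_dmap: "local_homeo_onto_units G (dmap G)"

definition bisection :: "'g::topological_space groupoid \<Rightarrow> 'g set \<Rightarrow> bool" where
  "bisection G S \<longleftrightarrow>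
    open (rmap G ` S) \<and> (\<exists>q. homeomorphism S (rmap G ` S) (rmap G) q) \<and>
    open (dmap G ` S) \<and> (\<exists>q. homeomorphism S (dmap G ` S) (dmap G) q)"

definition compact_open_bisections :: "'g::topological_space groupoid \<Rightarrow> 'g set set" where
  "compact_open_bisections G = {V. compact V \<and> open V \<and> bisection G V}"

locale ample_groupoid = etale_groupoid G for G :: "'g::t2_space groupoid" +
  assumes ample_basis: "topological_basis (compact_open_bisections G)"

definition invariant :: "'g groupoid \<Rightarrow> 'g set \<Rightarrow> bool" where
  "invariant G D \<longleftrightarrow> D \<subseteq> units G \<and> (\<forall>g. dmap G g \<in> D \<longrightarrow> rmap G g \<in> D)"

definition minimal :: "'g::topological_space groupoid \<Rightarrow> bool" where
  "minimal G \<longleftrightarrow>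
    (\<forall>D. closedin (top_of_set (units G)) D \<and> invariant G D \<longrightarrow> D = {} \<or> D = units G)"


section \<open>Paradoxicality\<close>

definition paradoxical ::
    "'g::topological_space groupoid \<Rightarrow> nat \<Rightarrow> nat \<Rightarrow> 'g set \<Rightarrow> bool" where
  "paradoxical G k l A \<longleftrightarrow>
    A \<noteq> {} \<and> A \<subseteq> units G \<and>
    (\<exists>(n :: nat \<Rightarrow> nat) (V :: nat \<Rightarrow> nat \<Rightarrow> 'g set) (m :: nat \<Rightarrow> nat \<Rightarrow> nat).
      (\<forall>i\<in>{1..k}. \<forall>j\<in>{1..n i}. V i j \<in> compact_open_bisections G \<and> m i j \<in> {1..l} \<and>
          (rmap G ` V i j) \<times> {m i j} \<subseteq> A \<times> {1..l}) \<and>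
      (\<forall>i\<in>{1..k}. (\<Union>j\<in>{1..n i}. dmap G ` V i j) = A) \<and>
      disjoint_family_on (\<lambda>(i, j). (rmap G ` V i j) \<times> {m i j}) (SIGMA i:{1..k}. {1..n i}))"

definition completely_nonparadoxical ::
    "'g::topological_space groupoid \<Rightarrow> 'g set \<Rightarrow> bool" where
  "completely_nonparadoxical G A \<longleftrightarrow> (\<forall>k l. l < k \<and> 0 < l \<longrightarrow> \<not> paradoxical G k l A)"


section \<open>The Hilbert space of square-summable functions\<close>

typedef 'a ell2 = "{f :: 'a \<Rightarrow> complex. (\<lambda>x. (cmod (f x))\<^sup>2) summable_on UNIV}"
  morphisms coord Abs_ell2
  by (rule exI[of _ "\<lambda>_. 0"]) simp

setup_lifting type_definition_ell2

lemma square_summable_coord: "(\<lambda>x. (cmod (coord \<xi> x))\<^sup>2) summable_on UNIV"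
  using coord[of \<xi>] by simp

lemma square_summable_add:
  assumes "(\<lambda>x. (cmod (f x))\<^sup>2) summable_on UNIV" "(\<lambda>x. (cmod (g x))\<^sup>2) summable_on UNIV"
  shows "(\<lambda>x. (cmod (f x + g x))\<^sup>2) summable_on UNIV"
proof (rule summable_on_comparison_test)
  show "(\<lambda>x. 2 * ((cmod (f x))\<^sup>2 + (cmod (g x))\<^sup>2)) summable_on UNIV"
    by (intro summable_on_cmult_right summable_on_add assms)
next
  fix x
  have "(cmod (f x + g x))\<^sup>2 \<le> (cmod (f x) + cmod (g x))\<^sup>2"
    by (intro power_mono norm_triangle_ineq) simp
  also have "\<dots> \<le> 2 * ((cmod (f x))\<^sup>2 + (cmod (g x))\<^sup>2)"
    using zero_le_power2[of "cmod (f x) - cmod (g x)"] by (simp add: power2_eq_square algebra_simps)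
  finally show "(cmod (f x + g x))\<^sup>2 \<le> 2 * ((cmod (f x))\<^sup>2 + (cmod (g x))\<^sup>2)" .
qed simp

lemma square_summable_mult:
  assumes "(\<lambda>x. (cmod (f x))\<^sup>2) summable_on UNIV"
  shows "(\<lambda>x. (cmod (c * f x))\<^sup>2) summable_on UNIV"
  using summable_on_cmult_right[OF assms, of "(cmod c)\<^sup>2"] by (simp add: norm_mult power_mult_distrib)

instantiation ell2 :: (type) real_vector
begin

lift_definition zero_ell2 :: "'a ell2" is "\<lambda>_. 0" by simp

lift_definition plus_ell2 :: "'a ell2 \<Rightarrow> 'a ell2 \<Rightarrow> 'a ell2" is "\<lambda>f g x. f x + g x"
  by (rule square_summable_add)

lift_definition uminus_ell2 :: "'a ell2 \<Rightarrow> 'a ell2" is "\<lambda>f x. - f x" by simp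

lift_definition minus_ell2 :: "'a ell2 \<Rightarrow> 'a ell2 \<Rightarrow> 'a ell2" is "\<lambda>f g x. f x - g x"
  subgoal for f g using square_summable_add[of f "\<lambda>x. - g x"] by simp
  done

lift_definition scaleR_ell2 :: "real \<Rightarrow> 'a ell2 \<Rightarrow> 'a ell2" is "\<lambda>c f x. of_real c * f x"
  by (rule square_summable_mult)

instance
  by standard (transfer; simp add: fun_eq_iff algebra_simps)+

end

lift_definition scaleC :: "complex \<Rightarrow> 'a ell2 \<Rightarrow> 'a ell2" is "\<lambda>c f x. c * f x"
  by (rule square_summable_mult)

definition cinner :: "'a ell2 \<Rightarrow> 'a ell2 \<Rightarrow> complex" where
  "cinner \<xi> \<eta> = (\<Sum>\<^sub>\<infinity>x. coord \<xi> x * cnj (coord \<eta> x))"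

lemma cinner_summable: "(\<lambda>x. coord \<xi> x * cnj (coord \<eta> x)) summable_on UNIV"
proof (rule abs_summable_summable, rule summable_on_comparison_test)
  show "(\<lambda>x. (cmod (coord \<xi> x))\<^sup>2 + (cmod (coord \<eta> x))\<^sup>2) summable_on UNIV"
    by (intro summable_on_add square_summable_coord)
next
  fix x
  have "2 * (cmod (coord \<xi> x) * cmod (coord \<eta> x)) \<le> (cmod (coord \<xi> x))\<^sup>2 + (cmod (coord \<eta> x))\<^sup>2"
    using sum_squares_bound[of "cmod (coord \<xi> x)" "cmod (coord \<eta> x)"] by (simp add: algebra_simps)
  moreover have "0 \<le> cmod (coord \<xi> x) * cmod (coord \<eta> x)" by simp
  ultimately have "cmod (coord \<xi> x) * cmod (coord \<eta> x) \<le> (cmod (coord \<xi> x))\<^sup>2 + (cmod (coord \<eta> x))\<^sup>2"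
    by linarith
  then show "norm (coord \<xi> x * cnj (coord \<eta> x)) \<le> (cmod (coord \<xi> x))\<^sup>2 + (cmod (coord \<eta> x))\<^sup>2"
    by (simp add: norm_mult)
qed simp

lemma cinner_commute: "cinner \<xi> \<eta> = cnj (cinner \<eta> \<xi>)"
  unfolding cinner_def by (subst infsum_cnj[symmetric]) (simp add: mult.commute)

lemma cinner_add_left: "cinner (\<xi> + \<zeta>) \<eta> = cinner \<xi> \<eta> + cinner \<zeta> \<eta>"
  unfolding cinner_def
  by (subst infsum_add[symmetric]) (simp_all add: cinner_summable plus_ell2.rep_eq algebra_simps)

lemma cinner_scaleC_left: "cinner (scaleC c \<xi>) \<eta> = c * cinner \<xi> \<eta>"
  unfolding cinner_def
  by (subst infsum_cmult_right[symmetric]) (simp_all add: cinner_summable scaleC.rep_eq algebra_simps)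

lemma scaleR_eq_scaleC: "r *\<^sub>R \<xi> = scaleC (of_real r) \<xi>"
  by transfer simp

lemma cinner_self: "cinner \<xi> \<xi> = of_real (\<Sum>\<^sub>\<infinity>x. (cmod (coord \<xi> x))\<^sup>2)"
proof -
  have "((\<lambda>x. of_real ((cmod (coord \<xi> x))\<^sup>2) :: complex) has_sum
      of_real (\<Sum>\<^sub>\<infinity>x. (cmod (coord \<xi> x))\<^sup>2)) UNIV"
    unfolding has_sum_of_real_iff by (rule has_sum_infsum[OF square_summable_coord])
  then show ?thesis
    unfolding cinner_def by (simp only: complex_norm_square infsumI)
qed

text \<open>The real inner product structure makes the norm, the topology and bounded operators of the
  library available; the complex structure is retained through \<^term>\<open>scaleC\<close> and \<^term>\<open>cinner\<close>.\<close>

instantiation ell2 :: (type) real_inner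
begin

definition inner_ell2 :: "'a ell2 \<Rightarrow> 'a ell2 \<Rightarrow> real" where
  "inner_ell2 \<xi> \<eta> = Re (cinner \<xi> \<eta>)"

definition norm_ell2 :: "'a ell2 \<Rightarrow> real" where
  "norm_ell2 \<xi> = sqrt (inner \<xi> \<xi>)"

definition sgn_ell2 :: "'a ell2 \<Rightarrow> 'a ell2" where
  "sgn_ell2 \<xi> = \<xi> /\<^sub>R norm \<xi>"

definition dist_ell2 :: "'a ell2 \<Rightarrow> 'a ell2 \<Rightarrow> real" where
  "dist_ell2 \<xi> \<eta> = norm (\<xi> - \<eta>)"

definition uniformity_ell2 :: "('a ell2 \<times> 'a ell2) filter" where
  "uniformity_ell2 = (INF e\<in>{0<..}. principal {(\<xi>, \<eta>). dist \<xi> \<eta> < e})"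

definition open_ell2 :: "'a ell2 set \<Rightarrow> bool" where
  "open_ell2 U \<longleftrightarrow> (\<forall>\<xi>\<in>U. \<forall>\<^sub>F (\<xi>', \<eta>) in uniformity. \<xi>' = \<xi> \<longrightarrow> \<eta> \<in> U)"

instance
proof
  fix \<xi> \<eta> \<zeta> :: "'a ell2" and c :: real
  show "inner \<xi> \<eta> = inner \<eta> \<xi>"
    unfolding inner_ell2_def by (subst cinner_commute) simp
  show "inner (\<xi> + \<eta>) \<zeta> = inner \<xi> \<zeta> + inner \<eta> \<zeta>"
    by (simp add: inner_ell2_def cinner_add_left)
  show "inner (c *\<^sub>R \<xi>) \<eta> = c * inner \<xi> \<eta>"
    by (simp add: inner_ell2_def scaleR_eq_scaleC cinner_scaleC_left)
  show "0 \<le> inner \<xi> \<xi>"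
    by (simp add: inner_ell2_def cinner_self infsum_nonneg)
  show "inner \<xi> \<xi> = 0 \<longleftrightarrow> \<xi> = 0"
  proof
    assume "inner \<xi> \<xi> = 0"
    then have "(\<Sum>\<^sub>\<infinity>x. (cmod (coord \<xi> x))\<^sup>2) = 0"
      by (simp add: inner_ell2_def cinner_self)
    then have "(cmod (coord \<xi> x))\<^sup>2 = 0" for x
      by (intro nonneg_infsum_le_0D[where A = UNIV and f = "\<lambda>x. (cmod (coord \<xi> x))\<^sup>2"])
         (simp_all add: square_summable_coord)
    then show "\<xi> = 0"
      by (simp add: coord_inject[symmetric] zero_ell2.rep_eq fun_eq_iff)
  next
    assume "\<xi> = 0"
    then show "inner \<xi> \<xi> = 0"
      by (simp add: inner_ell2_def cinner_def zero_ell2.rep_eq)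
  qed
qed (fact norm_ell2_def sgn_ell2_def dist_ell2_def uniformity_ell2_def open_ell2_def)+

end

lemma norm_scaleC: "norm (scaleC c \<xi>) = cmod c * norm \<xi>"
proof -
  have "(\<Sum>\<^sub>\<infinity>x. (cmod (coord (scaleC c \<xi>) x))\<^sup>2) = (\<Sum>\<^sub>\<infinity>x. (cmod c)\<^sup>2 * (cmod (coord \<xi> x))\<^sup>2)"
    by (simp add: scaleC.rep_eq norm_mult power_mult_distrib)
  also have "\<dots> = (cmod c)\<^sup>2 * (\<Sum>\<^sub>\<infinity>x. (cmod (coord \<xi> x))\<^sup>2)"
    by (rule infsum_cmult_right) (simp add: square_summable_coord)
  finally show ?thesis
    by (simp add: norm_ell2_def inner_ell2_def cinner_self real_sqrt_mult)
qed

lemma bounded_linear_scaleC: "bounded_linear (scaleC c)"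
proof (rule bounded_linear_intro)
  show "scaleC c (\<xi> + \<eta>) = scaleC c \<xi> + scaleC c \<eta>" for \<xi> \<eta> :: "'a ell2"
    by transfer (simp add: fun_eq_iff algebra_simps)
  show "scaleC c (r *\<^sub>R \<xi>) = r *\<^sub>R scaleC c \<xi>" for r and \<xi> :: "'a ell2"
    by transfer (simp add: fun_eq_iff algebra_simps)
  show "norm (scaleC c \<xi>) \<le> norm \<xi> * cmod c" for \<xi> :: "'a ell2"
    by (simp add: norm_scaleC mult.commute)
qed


section \<open>Algebras of operators\<close>

type_synonym 'a operator = "'a ell2 \<Rightarrow>\<^sub>L 'a ell2"

definition cscale :: "complex \<Rightarrow> 'a operator \<Rightarrow> 'a operator" where
  "cscale c T = Blinfun (\<lambda>\<xi>. scaleC c (blinfun_apply T \<xi>))"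

lemma cscale_apply: "blinfun_apply (cscale c T) \<xi> = scaleC c (blinfun_apply T \<xi>)"
  unfolding cscale_def
  by (simp add: bounded_linear_Blinfun_apply bounded_linear_compose[OF bounded_linear_scaleC]
      blinfun.bounded_linear_right)

definition adj :: "'a operator \<Rightarrow> 'a operator" where
  "adj T = (THE S. \<forall>\<xi> \<eta>. cinner (blinfun_apply T \<xi>) \<eta> = cinner \<xi> (blinfun_apply S \<eta>))"

text \<open>In what follows \<open>A\<close> is a *-algebra of complex-linear operators that contains the identity
  operator, which is then the unit of \<open>A\<close>.\<close>

definition tracial_state :: "'a operator set \<Rightarrow> ('a operator \<Rightarrow> complex) \<Rightarrow> bool" where
  "tracial_state A \<tau> \<longleftrightarrow>
    (\<forall>S\<in>A. \<forall>T\<in>A. \<tau> (S + T) = \<tau> S + \<tau> T) \<and>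
    (\<forall>c. \<forall>T\<in>A. \<tau> (cscale c T) = c * \<tau> T) \<and>
    (\<forall>T\<in>A. \<tau> (adj T o\<^sub>L T) \<in> \<real>\<^sub>\<ge>\<^sub>0) \<and>
    \<tau> id_blinfun = 1 \<and>
    (\<forall>S\<in>A. \<forall>T\<in>A. \<tau> (S o\<^sub>L T) = \<tau> (T o\<^sub>L S))"

definition faithful :: "'a operator set \<Rightarrow> ('a operator \<Rightarrow> complex) \<Rightarrow> bool" where
  "faithful A \<tau> \<longleftrightarrow> (\<forall>T\<in>A. \<tau> (adj T o\<^sub>L T) = 0 \<longrightarrow> T = 0)"

text \<open>Square matrices of size \<open>n\<close> are indexed from 0 and vanish outside the index range, so that
  equality of functions is equality of matrices.\<close>

type_synonym 'a op_matrix = "nat \<Rightarrow> nat \<Rightarrow> 'a operator"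

definition matrices :: "nat \<Rightarrow> 'a operator set \<Rightarrow> 'a op_matrix set" where
  "matrices n A =
    {a. \<forall>i j. (i < n \<and> j < n \<longrightarrow> a i j \<in> A) \<and> (\<not> (i < n \<and> j < n) \<longrightarrow> a i j = 0)}"

definition mat_mul :: "nat \<Rightarrow> 'a op_matrix \<Rightarrow> 'a op_matrix \<Rightarrow> 'a op_matrix" where
  "mat_mul n a b = (\<lambda>i j. \<Sum>k<n. a i k o\<^sub>L b k j)"

definition mat_adj :: "'a op_matrix \<Rightarrow> 'a op_matrix" where
  "mat_adj a = (\<lambda>i j. adj (a j i))"

definition mat_one :: "nat \<Rightarrow> 'a op_matrix" where
  "mat_one n = (\<lambda>i j. if i < n \<and> i = j then id_blinfun else 0)"

definition mat_projection :: "nat \<Rightarrow> 'a operator set \<Rightarrow> 'a op_matrix \<Rightarrow> bool" where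
  "mat_projection n A p \<longleftrightarrow> p \<in> matrices n A \<and> mat_mul n p p = p \<and> mat_adj p = p"

definition proper_subprojection ::
    "nat \<Rightarrow> 'a operator set \<Rightarrow> 'a op_matrix \<Rightarrow> 'a op_matrix \<Rightarrow> bool" where
  "proper_subprojection n A q p \<longleftrightarrow>
    mat_projection n A q \<and> mat_projection n A p \<and> mat_mul n p q = q \<and> q \<noteq> p"

definition murray_von_neumann_equiv ::
    "nat \<Rightarrow> 'a operator set \<Rightarrow> 'a op_matrix \<Rightarrow> 'a op_matrix \<Rightarrow> bool" where
  "murray_von_neumann_equiv n A p q \<longleftrightarrow>
    (\<exists>v\<in>matrices n A. mat_mul n (mat_adj v) v = p \<and> mat_mul n v (mat_adj v) = q)"

definition stably_finite :: "'a operator set \<Rightarrow> bool" where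
  "stably_finite A \<longleftrightarrow>
    (\<forall>n\<ge>1. \<not> (\<exists>q. proper_subprojection n A q (mat_one n) \<and>
      murray_von_neumann_equiv n A (mat_one n) q))"


section \<open>The reduced groupoid C*-algebra\<close>

definition Cc :: "('g::topological_space \<Rightarrow> complex) set" where
  "Cc = {f. continuous_on UNIV f \<and> compact (closure {g. f g \<noteq> 0})}"

text \<open>For a unit \<open>x\<close> the regular representation \<open>\<lambda>\<^sub>x\<close> of \<^term>\<open>Cc\<close> acts by left convolution on the
  square-summable functions on \<open>d\<inverse>(x)\<close>. As these fibres partition the groupoid, the direct sum of
  all \<open>\<lambda>\<^sub>x\<close> acts on the square-summable functions on the whole groupoid, and its operator norm is the
  reduced norm. For an etale groupoid the convolution sums are finite and every \<open>f\<close> in \<^term>\<open>Cc\<close> acts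
  as a bounded operator.\<close>

definition regular_rep :: "'g groupoid \<Rightarrow> ('g \<Rightarrow> complex) \<Rightarrow> 'g operator \<Rightarrow> bool" where
  "regular_rep G f T \<longleftrightarrow>
    (\<forall>\<xi> g. coord (blinfun_apply T \<xi>) g =
      (\<Sum>\<^sub>\<infinity>h\<in>{h. dmap G h = dmap G g}. f (mul G g (ginv G h)) * coord \<xi> h))"

text \<open>If the unit space is compact then the indicator function of the unit space lies in \<^term>\<open>Cc\<close>
  and acts as the identity, so the algebra is unital with unit \<^term>\<open>id_blinfun\<close>.\<close>

definition reduced_cstar :: "'g::topological_space groupoid \<Rightarrow> 'g operator set" where
  "reduced_cstar G = closure {T. \<exists>f\<in>Cc. regular_rep G f T}"

end

theory Submission
  imports Defs
begin

text \<open>A faithful trace, stable finiteness and the absence of paradoxical clopen sets are linked through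
  the operators \<open>L\<^sub>V\<close> of left convolution by indicator functions of compact open bisections. They
  satisfy \<open>L\<^sub>V L\<^sub>W = L\<^bsub>VW\<^esub>\<close> and \<open>L\<^sub>V\<^sup>* = L\<^bsub>V\<inverse>\<^esub>\<close>, and their linear span is dense in the reduced algebra
  (\<open>reduced_cstar_eq_closure_steinberg\<close>), so that the algebra can be handled through them.

  A faithful trace implies the other two conditions by counting. Its extension to matrices takes the
  same value on \<open>1 = v\<^sup>*v\<close> and on \<open>vv\<^sup>*\<close>, so it vanishes on the projection \<open>1 - vv\<^sup>*\<close>, which is therefore
  \<open>0\<close> by faithfulness (\<open>stably_finite_if_faithful_trace\<close>). Restricted to the operators of clopen subsets of the unit
  space it is an invariant measure that is positive on non-empty sets, and an invariant measure
  forbids fitting \<open>k\<close> copies of a set of positive measure into \<open>l < k\<close> copies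
  (\<open>nonparadoxical_if_faithful_trace\<close>).

  Conversely, each of the two conditions excludes a paradoxical decomposition of the unit space. For
  stable finiteness, this holds because such a decomposition of \<open>k\<close> copies of the unit space inside
  fewer copies is a matrix of bisections that forms a proper isometry of size \<open>k\<close>
  (\<open>not_stably_finite_if_paradoxical_units\<close>). It remains to find a faithful trace when the unit space
  has no paradoxical decomposition. This is Tarski's theorem in functional form. An invariant
  state vanishes on all differences \<open>1\<^bsub>r(V)\<^esub> - 1\<^bsub>d(V)\<^esub>\<close>, and by the Hahn-Banach theorem the only
  obstruction to its existence is a combination of such differences with a positive lower bound.
  Rounding its coefficients produces finitely many bisections \<open>V\<^sub>s\<close> with \<open>\<Sum>1\<^bsub>r(V\<^sub>s)\<^esub> \<ge> 1 + \<Sum>1\<^bsub>d(V\<^sub>s)\<^esub>\<close>,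
  which says that \<open>f = \<Sum>1\<^bsub>d(V\<^sub>s)\<^esub>\<close> absorbs a copy of the unit space. Iterating, \<open>f\<close> absorbs \<open>N + 1\<close>
  copies, where \<open>N\<close> is the number of bisections; as \<open>f \<le> N\<close>, the unit space is paradoxical
  (\<open>coboundary_not_bounded_below\<close>). Applied to the diagonal of an operator, an invariant state is a
  trace, and minimality together with continuity of diagonals makes it faithful
  (\<open>faithful_trace_exists\<close>).\<close>

section \<open>Groupoid algebra\<close>

context groupoid
begin

lemma composable_ginv': "(g, ginv G g) \<in> composable G"
  by (metis composable_ginv ginv_ginv)

lemma rmap_mul_self [simp]: "mul G (rmap G g) g = g"
  by (metis composable_ginv' ginv_ginv mul_ginv_cancel rmap_def)

lemma mul_dmap_self [simp]: "mul G g (dmap G g) = g"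
  by (metis composable_ginv dmap_def ginv_ginv ginv_mul_cancel)

lemma composable_iff: "(g, h) \<in> composable G \<longleftrightarrow> dmap G g = rmap G h"
proof
  assume gh: "(g, h) \<in> composable G"
  have c: "(dmap G g, h) \<in> composable G"
    unfolding dmap_def using composable_mul[OF composable_ginv gh] by simp
  have "mul G (dmap G g) h = h"
    unfolding dmap_def using mul_assoc[OF composable_ginv gh] ginv_mul_cancel[OF gh] by simp
  with mul_ginv_cancel[OF c] show "dmap G g = rmap G h"
    by (simp add: rmap_def)
next
  assume eq: "dmap G g = rmap G h"
  have 1: "(g, dmap G g) \<in> composable G"
    unfolding dmap_def using composable_mul[OF composable_ginv' composable_ginv] by simp
  have 2: "(rmap G h, h) \<in> composable G"
    unfolding rmap_def using composable_mul[OF composable_ginv' composable_ginv] by simp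
  show "(g, h) \<in> composable G"
    using composable_mul[OF 1, of h] 2 eq by simp
qed

lemma ginv_mul_left [simp]: "dmap G g = rmap G h \<Longrightarrow> mul G (ginv G g) (mul G g h) = h"
  by (simp add: composable_iff ginv_mul_cancel)

lemma mul_ginv_right [simp]: "dmap G g = rmap G h \<Longrightarrow> mul G (mul G g h) (ginv G h) = g"
  by (simp add: composable_iff mul_ginv_cancel)

lemma rmap_ginv [simp]: "rmap G (ginv G g) = dmap G g"
  by (simp add: rmap_def dmap_def ginv_ginv)

lemma dmap_ginv [simp]: "dmap G (ginv G g) = rmap G g"
  by (simp add: rmap_def dmap_def ginv_ginv)

lemma rmap_mul [simp]: "dmap G g = rmap G h \<Longrightarrow> rmap G (mul G g h) = rmap G g"
  by (metis composable_iff composable_mul dmap_ginv composable_ginv)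

lemma dmap_mul [simp]: "dmap G g = rmap G h \<Longrightarrow> dmap G (mul G g h) = dmap G h"
  by (metis composable_iff composable_mul rmap_ginv composable_ginv')

lemma mul_ginv_left [simp]: "rmap G g = rmap G h \<Longrightarrow> mul G g (mul G (ginv G g) h) = h"
  by (metis dmap_ginv ginv_ginv ginv_mul_left)

lemma mul_ginv_right' [simp]: "dmap G g = dmap G h \<Longrightarrow> mul G (mul G g (ginv G h)) h = g"
  by (metis rmap_ginv ginv_ginv mul_ginv_right)

lemma mul_assoc': "dmap G g = rmap G h \<Longrightarrow> dmap G h = rmap G k \<Longrightarrow>
    mul G (mul G g h) k = mul G g (mul G h k)"
  by (simp add: composable_iff mul_assoc)

lemma ginv_mul: "dmap G g = rmap G h \<Longrightarrow> ginv G (mul G g h) = mul G (ginv G h) (ginv G g)"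
proof -
  assume gh: "dmap G g = rmap G h"
  have "mul G (ginv G (mul G g h)) (mul G (mul G g h) (ginv G h)) = ginv G h"
    by (rule ginv_mul_left) (simp add: gh)
  then have "mul G (ginv G h) (ginv G g) = mul G (mul G (ginv G (mul G g h)) g) (ginv G g)"
    by (simp add: gh)
  also have "\<dots> = ginv G (mul G g h)"
    by (rule mul_ginv_right) (simp add: gh)
  finally show ?thesis by simp
qed

lemma rmap_rmap [simp]: "rmap G (rmap G g) = rmap G g"
  by (metis composable_ginv' composable_iff rmap_def rmap_mul)

lemma dmap_rmap [simp]: "dmap G (rmap G g) = rmap G g"
  by (metis composable_ginv' composable_iff dmap_ginv dmap_mul rmap_def)

lemma rmap_in_units [simp]: "rmap G g \<in> units G"
  by (simp add: units_def)

lemma dmap_in_units [simp]: "dmap G g \<in> units G"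
  by (metis rmap_ginv rmap_in_units)

lemma rmap_unit: "x \<in> units G \<Longrightarrow> rmap G x = x"
  by (auto simp: units_def)

lemma dmap_unit: "x \<in> units G \<Longrightarrow> dmap G x = x"
  by (auto simp: units_def)

lemma mul_ginv_self [simp]: "mul G g (ginv G g) = rmap G g"
  by (simp add: rmap_def)

lemma ginv_mul_self [simp]: "mul G (ginv G g) g = dmap G g"
  by (simp add: dmap_def)

lemma ginv_unit: "x \<in> units G \<Longrightarrow> ginv G x = x"
  by (metis dmap_unit mul_ginv_self rmap_ginv rmap_mul_self rmap_unit)

lemma mul_ginv_unit_iff:
  assumes "dmap G g = dmap G h"
  shows "mul G g (ginv G h) \<in> units G \<longleftrightarrow> g = h"
proof
  assume "mul G g (ginv G h) \<in> units G"
  then have "mul G g (ginv G h) = rmap G h"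
    using dmap_unit[of "mul G g (ginv G h)"] assms by simp
  then show "g = h"
    using mul_ginv_right'[OF assms] by simp
qed simp

lemma mul_in_units_iff:
  assumes "dmap G v = rmap G w"
  shows "mul G v w \<in> units G \<longleftrightarrow> w = ginv G v"
proof
  assume "mul G v w \<in> units G"
  then have "mul G v w = rmap G v"
    using assms rmap_unit by fastforce
  then have "w = mul G (ginv G v) (rmap G v)"
    using assms by (metis ginv_mul_left)
  then show "w = ginv G v"
    by (metis dmap_ginv mul_dmap_self)
qed simp

end

section \<open>Compact open bisections\<close>

lemma (in topological_groupoid) continuous_on_rmap: "continuous_on A (rmap G)"
proof -
  have "continuous_on UNIV (\<lambda>g. (\<lambda>(g, h). mul G g h) (g, ginv G g))"
    by (rule continuous_on_compose2[OF continuous_mul])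
       (auto intro!: continuous_intros continuous_ginv composable_ginv')
  then show ?thesis
    unfolding rmap_def[abs_def] by (auto intro: continuous_on_subset)
qed

lemma (in topological_groupoid) continuous_on_dmap: "continuous_on A (dmap G)"
proof -
  have "continuous_on UNIV (\<lambda>g. (\<lambda>(g, h). mul G g h) (ginv G g, g))"
    by (rule continuous_on_compose2[OF continuous_mul])
       (auto intro!: continuous_intros continuous_ginv composable_ginv)
  then show ?thesis
    unfolding dmap_def[abs_def] by (auto intro: continuous_on_subset)
qed

definition setprod :: "'g groupoid \<Rightarrow> 'g set \<Rightarrow> 'g set \<Rightarrow> 'g set" where
  "setprod G V W = {mul G v w |v w. v \<in> V \<and> w \<in> W \<and> dmap G v = rmap G w}"

context ample_groupoid
begin

abbreviation Ga :: "'g set set" where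
  "Ga \<equiv> compact_open_bisections G"

lemma exists_bisection:
  assumes "open U" "g \<in> U"
  obtains V where "V \<in> Ga" "g \<in> V" "V \<subseteq> U"
  using topological_basisE[OF ample_basis assms] by blast

lemma open_rmap_image:
  assumes "open U" shows "open (rmap G ` U)"
proof -
  have "\<exists>V. V \<in> Ga \<and> g \<in> V \<and> V \<subseteq> U" if "g \<in> U" for g
    using exists_bisection[OF assms that] by metis
  then have "rmap G ` U = (\<Union>V\<in>{V\<in>Ga. V \<subseteq> U}. rmap G ` V)"
    by fast
  also have "open \<dots>"
    by (intro open_UN) (auto simp: compact_open_bisections_def bisection_def)
  finally show ?thesis .
qed

lemma open_dmap_image:
  assumes "open U" shows "open (dmap G ` U)"
proof -
  have "\<exists>V. V \<in> Ga \<and> g \<in> V \<and> V \<subseteq> U" if "g \<in> U" for g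
    using exists_bisection[OF assms that] by metis
  then have "dmap G ` U = (\<Union>V\<in>{V\<in>Ga. V \<subseteq> U}. dmap G ` V)"
    by fast
  also have "open \<dots>"
    by (intro open_UN) (auto simp: compact_open_bisections_def bisection_def)
  finally show ?thesis .
qed

lemma Ga_iff:
  "V \<in> Ga \<longleftrightarrow> compact V \<and> open V \<and> inj_on (rmap G) V \<and> inj_on (dmap G) V"
proof
  assume "V \<in> Ga"
  then show "compact V \<and> open V \<and> inj_on (rmap G) V \<and> inj_on (dmap G) V"
    by (auto simp: compact_open_bisections_def bisection_def homeomorphism_def intro!: inj_onI)
      (metis)+
next
  assume V: "compact V \<and> open V \<and> inj_on (rmap G) V \<and> inj_on (dmap G) V"
  then have "\<exists>q. homeomorphism V (rmap G ` V) (rmap G) q"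
    "\<exists>q. homeomorphism V (dmap G ` V) (dmap G) q"
    by (auto intro!: homeomorphism_compact continuous_on_rmap continuous_on_dmap)
  with V show "V \<in> Ga"
    by (auto simp: compact_open_bisections_def bisection_def open_rmap_image open_dmap_image)
qed

lemma Ga_compact: "V \<in> Ga \<Longrightarrow> compact V"
  and Ga_open: "V \<in> Ga \<Longrightarrow> open V"
  and Ga_closed: "V \<in> Ga \<Longrightarrow> closed V"
  and Ga_inj_rmap: "V \<in> Ga \<Longrightarrow> inj_on (rmap G) V"
  and Ga_inj_dmap: "V \<in> Ga \<Longrightarrow> inj_on (dmap G) V"
  by (auto simp: Ga_iff compact_imp_closed)

lemma Ga_subset:
  assumes "V \<in> Ga" "U \<subseteq> V" "open U" "closed U" shows "U \<in> Ga"
  using assms compact_Int_closed[of V U]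
  by (auto simp: Ga_iff Int_absorb1 intro: inj_on_subset)

lemma Ga_Int_clopen:
  assumes "V \<in> Ga" "open U" "closed U" shows "V \<inter> U \<in> Ga"
  by (rule Ga_subset[OF assms(1)]) (use assms in \<open>auto simp: Ga_open Ga_closed\<close>)

lemma empty_in_Ga: "{} \<in> Ga"
  by (simp add: Ga_iff)

lemma open_units: "open (units G)"
  unfolding units_def by (rule open_rmap_image) simp

lemma units_subset_in_Ga:
  assumes "compact U" "open U" "U \<subseteq> units G" shows "U \<in> Ga"
  using assms by (auto simp: Ga_iff rmap_unit dmap_unit inj_on_def subset_iff)

lemma rmap_image_Ga: "V \<in> Ga \<Longrightarrow> rmap G ` V \<in> Ga"
  by (rule units_subset_in_Ga)
    (auto simp: Ga_iff open_rmap_image intro!: compact_continuous_image continuous_on_rmap)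

lemma dmap_image_Ga: "V \<in> Ga \<Longrightarrow> dmap G ` V \<in> Ga"
  by (rule units_subset_in_Ga)
    (auto simp: Ga_iff open_dmap_image intro!: compact_continuous_image continuous_on_dmap)

lemma ginv_image_eq_vimage: "ginv G ` V = ginv G -` V"
  by (force simp: ginv_ginv image_iff)

lemma ginv_image_Ga:
  assumes "V \<in> Ga" shows "ginv G ` V \<in> Ga"
proof -
  have "open (ginv G ` V)"
    using assms continuous_ginv
    by (auto simp: ginv_image_eq_vimage Ga_iff intro: open_vimage)
  moreover have "compact (ginv G ` V)"
    using assms by (auto simp: Ga_iff intro!: compact_continuous_image
        continuous_on_subset[OF continuous_ginv])
  ultimately show ?thesis
    using assms by (auto simp: Ga_iff inj_on_def)
qed

lemma rmap_ginv_image: "rmap G ` ginv G ` V = dmap G ` V"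
  and dmap_ginv_image: "dmap G ` ginv G ` V = rmap G ` V"
  by (simp_all add: image_image)

lemma restrict_rmap_Ga:
  assumes "V \<in> Ga" "open U" "closed U" shows "{v \<in> V. rmap G v \<in> U} \<in> Ga"
proof -
  have "{v \<in> V. rmap G v \<in> U} = V \<inter> rmap G -` U" by auto
  then show ?thesis
    using assms by (auto intro!: Ga_Int_clopen open_vimage closed_vimage continuous_on_rmap)
qed

lemma restrict_dmap_Ga:
  assumes "V \<in> Ga" "open U" "closed U" shows "{v \<in> V. dmap G v \<in> U} \<in> Ga"
proof -
  have "{v \<in> V. dmap G v \<in> U} = V \<inter> dmap G -` U" by auto
  then show ?thesis
    using assms by (auto intro!: Ga_Int_clopen open_vimage closed_vimage continuous_on_dmap)
qed

text \<open>A product \<open>VW\<close> is open because membership of \<open>g\<close> can be tested continuously: strip off the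
  unique \<open>v \<in> V\<close> over the range of \<open>g\<close>, which depends continuously on \<open>g\<close>, and ask whether the
  remaining factor lies in \<open>W\<close>.\<close>

lemma setprod_Ga:
  assumes V: "V \<in> Ga" and W: "W \<in> Ga"
  shows "setprod G V W \<in> Ga"
proof -
  obtain q where q: "homeomorphism V (rmap G ` V) (rmap G) q"
    using V by (auto simp: compact_open_bisections_def bisection_def)
  have q1: "q (rmap G v) = v" if "v \<in> V" for v
    using q that by (simp add: homeomorphism_def)
  have qc: "continuous_on (rmap G ` V) q"
    using q by (simp add: homeomorphism_def)
  define D where "D = rmap G -` (rmap G ` V)"
  have D: "open D"
    unfolding D_def using V
    by (auto simp: Ga_iff intro!: open_vimage open_rmap_image continuous_on_rmap)
  define \<psi> where "\<psi> g = mul G (ginv G (q (rmap G g))) g" for g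
  have "continuous_on D (\<lambda>g. (\<lambda>(g, h). mul G g h) (ginv G (q (rmap G g)), g))"
  proof (rule continuous_on_compose2[OF continuous_mul])
    show "continuous_on D (\<lambda>g. (ginv G (q (rmap G g)), g))"
      by (intro continuous_on_Pair continuous_on_id continuous_on_compose2[OF continuous_ginv]
          continuous_on_compose2[OF qc] continuous_on_rmap) (auto simp: D_def)
    show "(\<lambda>g. (ginv G (q (rmap G g)), g)) ` D \<subseteq> composable G"
      by (auto simp: D_def composable_iff q1)
  qed
  then have \<psi>c: "continuous_on D \<psi>"
    by (simp add: \<psi>_def[abs_def])
  have "setprod G V W = D \<inter> \<psi> -` W"
  proof (intro set_eqI iffI)
    fix g assume "g \<in> setprod G V W"
    then show "g \<in> D \<inter> \<psi> -` W"
      by (auto simp: setprod_def D_def \<psi>_def q1)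
  next
    fix g assume g: "g \<in> D \<inter> \<psi> -` W"
    then obtain v where v: "v \<in> V" "rmap G g = rmap G v"
      by (auto simp: D_def)
    with g have "mul G (ginv G v) g \<in> W"
      by (auto simp: \<psi>_def q1)
    moreover have "g = mul G v (mul G (ginv G v) g)" "dmap G v = rmap G (mul G (ginv G v) g)"
      using v by simp_all
    ultimately show "g \<in> setprod G V W"
      using v(1) unfolding setprod_def by blast
  qed
  also have "open \<dots>"
    using continuous_on_open_vimage[OF D, of \<psi>] \<psi>c W by (auto simp: Ga_iff Int_commute)
  finally have op: "open (setprod G V W)" .
  have "setprod G V W = (\<lambda>(v, w). mul G v w) ` ((V \<times> W) \<inter> {p. dmap G (fst p) = rmap G (snd p)})"
    by (force simp: setprod_def)
  moreover have "compact ((V \<times> W) \<inter> {p. dmap G (fst p) = rmap G (snd p)})"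
  proof (rule compact_Int_closed)
    show "compact (V \<times> W)"
      using V W by (auto simp: Ga_iff intro: compact_Times)
    show "closed {p. dmap G (fst p) = rmap G (snd p)}"
      by (intro closed_Collect_eq continuous_on_compose2[OF continuous_on_dmap[of UNIV]]
          continuous_on_compose2[OF continuous_on_rmap[of UNIV]] continuous_intros) auto
  qed
  ultimately have comp: "compact (setprod G V W)"
    by (auto intro!: compact_continuous_image continuous_on_subset[OF continuous_mul]
        simp: composable_iff)
  have "inj_on (rmap G) (setprod G V W)"
  proof (rule inj_onI)
    fix x y assume "x \<in> setprod G V W" "y \<in> setprod G V W" and eq: "rmap G x = rmap G y"
    then obtain v w v' w' where *: "x = mul G v w" "v \<in> V" "w \<in> W" "dmap G v = rmap G w"
      "y = mul G v' w'" "v' \<in> V" "w' \<in> W" "dmap G v' = rmap G w'"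
      by (auto simp: setprod_def)
    with eq have "v = v'" using Ga_inj_rmap[OF V] by (auto dest: inj_onD)
    moreover from this * have "w = w'" using Ga_inj_rmap[OF W] by (auto dest: inj_onD)
    ultimately show "x = y" using * by simp
  qed
  moreover have "inj_on (dmap G) (setprod G V W)"
  proof (rule inj_onI)
    fix x y assume "x \<in> setprod G V W" "y \<in> setprod G V W" and eq: "dmap G x = dmap G y"
    then obtain v w v' w' where *: "x = mul G v w" "v \<in> V" "w \<in> W" "dmap G v = rmap G w"
      "y = mul G v' w'" "v' \<in> V" "w' \<in> W" "dmap G v' = rmap G w'"
      by (auto simp: setprod_def)
    with eq have "w = w'" using Ga_inj_dmap[OF W] by (auto dest: inj_onD)
    moreover from this * have "v = v'" using inj_onD[OF Ga_inj_dmap[OF V]] by metis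
    ultimately show "x = y" using * by simp
  qed
  ultimately show ?thesis
    using op comp by (simp add: Ga_iff)
qed

end

section \<open>Bounded complex-linear operators on square-summable functions\<close>

lift_definition ket :: "'a \<Rightarrow> 'a ell2" is "\<lambda>h x. if x = h then 1 else 0"
  subgoal for h by (rule finite_nonzero_values_imp_summable_on) (rule finite_subset[of _ "{h}"], auto)
  done

lemma coord_ket: "coord (ket h) x = (if x = h then 1 else 0)"
  by (simp add: ket.rep_eq)

lemma ell2_eqI: "(\<And>x. coord \<xi> x = coord \<eta> x) \<Longrightarrow> \<xi> = \<eta>"
  by (simp add: coord_inject[symmetric] fun_eq_iff)

lemma coord_add: "coord (\<xi> + \<eta>) x = coord \<xi> x + coord \<eta> x"
  and coord_diff: "coord (\<xi> - \<eta>) x = coord \<xi> x - coord \<eta> x"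
  and coord_scaleC: "coord (scaleC c \<xi>) x = c * coord \<xi> x"
  and coord_scaleR: "coord (r *\<^sub>R \<xi>) x = of_real r * coord \<xi> x"
  and coord_zero: "coord 0 x = 0"
  by (simp_all add: plus_ell2.rep_eq minus_ell2.rep_eq scaleC.rep_eq scaleR_ell2.rep_eq
      zero_ell2.rep_eq)

lemma coord_sum: "coord (\<Sum>i\<in>I. f i) x = (\<Sum>i\<in>I. coord (f i) x)"
  by (induction I rule: infinite_finite_induct) (simp_all add: coord_zero coord_add)

lemma coord_sum_ket:
  "finite F \<Longrightarrow> coord (\<Sum>h\<in>F. scaleC (f h) (ket h)) x = (if x \<in> F then f x else 0)"
  by (simp add: coord_sum coord_scaleC coord_ket if_distrib[of "\<lambda>z. _ * z"] cong: if_cong)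

lemma cinner_ket: "cinner \<xi> (ket h) = coord \<xi> h"
proof -
  have "cinner \<xi> (ket h) = (\<Sum>\<^sub>\<infinity>x\<in>{h}. coord \<xi> x * cnj (coord (ket h) x))"
    unfolding cinner_def by (rule infsum_cong_neutral) (auto simp: coord_ket)
  then show ?thesis
    by (simp add: coord_ket)
qed

lemma cinner_ket_left: "cinner (ket h) \<xi> = cnj (coord \<xi> h)"
  by (subst cinner_commute) (simp add: cinner_ket)

lemma norm_sq: "(norm \<xi>)\<^sup>2 = (\<Sum>\<^sub>\<infinity>x. (cmod (coord \<xi> x))\<^sup>2)" for \<xi> :: "'a ell2"
  by (simp add: norm_ell2_def inner_ell2_def cinner_self infsum_nonneg)

lemma cinner_norm: "cinner \<xi> \<xi> = of_real ((norm \<xi>)\<^sup>2)"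
  by (simp add: cinner_self norm_sq)

lemma cinner_diff_left: "cinner (\<xi> - \<zeta>) \<eta> = cinner \<xi> \<eta> - cinner \<zeta> \<eta>"
  using cinner_add_left[of "\<xi> - \<zeta>" \<zeta> \<eta>] by simp

lemma cinner_add_right: "cinner \<eta> (\<xi> + \<zeta>) = cinner \<eta> \<xi> + cinner \<eta> \<zeta>"
  by (simp add: cinner_commute[of \<eta>] cinner_add_left)

lemma cinner_diff_right: "cinner \<eta> (\<xi> - \<zeta>) = cinner \<eta> \<xi> - cinner \<eta> \<zeta>"
  by (simp add: cinner_commute[of \<eta>] cinner_diff_left)

lemma cinner_scaleC_right: "cinner \<eta> (scaleC c \<xi>) = cnj c * cinner \<eta> \<xi>"
  by (simp add: cinner_commute[of \<eta>] cinner_scaleC_left)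

lemma cinner_zero_left: "cinner 0 \<eta> = 0"
  using cinner_diff_left[of \<eta> \<eta> \<eta>] by simp

lemma cinner_sum_left: "cinner (\<Sum>i\<in>I. f i) \<eta> = (\<Sum>i\<in>I. cinner (f i) \<eta>)"
  by (induction I rule: infinite_finite_induct) (simp_all add: cinner_zero_left cinner_add_left)

lemma cmod_cinner_le: "cmod (cinner \<xi> \<eta>) \<le> norm \<xi> * norm \<eta>"
proof -
  (* Rotating by the conjugate phase reduces to the real Cauchy-Schwarz inequality. *)
  define u where "u = cnj (sgn (cinner \<xi> \<eta>))"
  have u: "cmod u \<le> 1"
    by (simp add: u_def norm_sgn)
  have "cinner (scaleC u \<xi>) \<eta> = of_real (cmod (cinner \<xi> \<eta>))"
  proof (cases "cinner \<xi> \<eta> = 0")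
    case False
    then show ?thesis
      by (simp add: cinner_scaleC_left u_def sgn_eq field_simps complex_norm_square[symmetric]
          power2_eq_square)
  qed (simp add: cinner_scaleC_left)
  then have "cmod (cinner \<xi> \<eta>) = inner (scaleC u \<xi>) \<eta>"
    by (simp add: inner_ell2_def)
  also have "\<dots> \<le> norm (scaleC u \<xi>) * norm \<eta>"
    by (rule norm_cauchy_schwarz)
  also have "\<dots> = cmod u * (norm \<xi> * norm \<eta>)"
    by (simp add: norm_scaleC)
  also have "\<dots> \<le> 1 * (norm \<xi> * norm \<eta>)"
    by (rule mult_right_mono) (use u in auto)
  finally show ?thesis by simp
qed

lemma norm_ket: "norm (ket h) = 1"
proof -
  have "complex_of_real ((norm (ket h))\<^sup>2) = complex_of_real 1"
    by (subst cinner_norm[symmetric]) (simp add: cinner_ket coord_ket)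
  then have "(norm (ket h))\<^sup>2 = 1\<^sup>2"
    unfolding of_real_eq_iff by simp
  then show ?thesis
    by (rule power2_eq_imp_eq) simp_all
qed

lemma cmod_coord_le: "cmod (coord \<xi> h) \<le> norm \<xi>"
  using cmod_cinner_le[of \<xi> "ket h"] by (simp add: cinner_ket norm_ket)

text \<open>A bounded complex-linear operator is determined by its matrix coefficients because every vector
  is the norm limit of its finite truncations.\<close>

lemma ket_expansion: "((\<lambda>h. scaleC (coord \<xi> h) (ket h)) has_sum \<xi>) UNIV"
proof -
  let ?f = "\<lambda>h. (cmod (coord \<xi> h))\<^sup>2"
  let ?p = "\<lambda>F. \<Sum>h\<in>F. scaleC (coord \<xi> h) (ket h)"
  have f: "(?f has_sum (norm \<xi>)\<^sup>2) UNIV"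
    unfolding norm_sq by (rule has_sum_infsum[OF square_summable_coord])
  have p: "(norm (?p F - \<xi>))\<^sup>2 = (norm \<xi>)\<^sup>2 - sum ?f F" if "finite F" for F
  proof -
    have c: "coord (?p F) x = (if x \<in> F then coord \<xi> x else 0)" for x
      using that by (rule coord_sum_ket)
    have "cmod (coord (?p F - \<xi>) x) ^ 2 = (if x \<in> F then 0 else ?f x)" for x
      by (simp add: coord_diff c)
    then have "(norm (?p F - \<xi>))\<^sup>2 = (\<Sum>\<^sub>\<infinity>x. if x \<in> F then 0 else ?f x)"
      by (simp add: norm_sq)
    also have "\<dots> = (\<Sum>\<^sub>\<infinity>x\<in>-F. ?f x)"
      by (rule infsum_cong_neutral) auto
    also have "\<dots> = (\<Sum>\<^sub>\<infinity>x. ?f x) - (\<Sum>\<^sub>\<infinity>x\<in>F. ?f x)"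
      unfolding Compl_eq_Diff_UNIV
      by (rule infsum_Diff) (use that in \<open>auto simp: square_summable_coord\<close>)
    finally show ?thesis
      using that by (simp add: norm_sq)
  qed
  have "((\<lambda>F. (norm \<xi>)\<^sup>2 - sum ?f F) \<longlongrightarrow> (norm \<xi>)\<^sup>2 - (norm \<xi>)\<^sup>2) (finite_subsets_at_top UNIV)"
    by (intro tendsto_intros) (use f in \<open>simp add: has_sum_def\<close>)
  then have "((\<lambda>F. (norm (?p F - \<xi>))\<^sup>2) \<longlongrightarrow> 0) (finite_subsets_at_top UNIV)"
    by (subst tendsto_cong[where g = "\<lambda>F. (norm \<xi>)\<^sup>2 - sum ?f F"])
      (auto simp: p intro!: eventually_finite_subsets_at_top_weakI)
  then have "((\<lambda>F. sqrt ((norm (?p F - \<xi>))\<^sup>2)) \<longlongrightarrow> sqrt 0) (finite_subsets_at_top UNIV)"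
    by (rule tendsto_real_sqrt)
  then have "((\<lambda>F. norm (?p F - \<xi>)) \<longlongrightarrow> 0) (finite_subsets_at_top UNIV)"
    by simp
  then show ?thesis
    unfolding has_sum_def by (simp add: tendsto_norm_zero_iff LIM_zero_iff)
qed

definition complex_linear :: "'a operator \<Rightarrow> bool" where
  "complex_linear T \<longleftrightarrow> (\<forall>c \<xi>. blinfun_apply T (scaleC c \<xi>) = scaleC c (blinfun_apply T \<xi>))"

definition mcoeff :: "'a operator \<Rightarrow> 'a \<Rightarrow> 'a \<Rightarrow> complex" where
  "mcoeff T g h = coord (blinfun_apply T (ket h)) g"

lemma op_expansion:
  assumes "complex_linear T"
  shows "((\<lambda>h. scaleC (coord \<xi> h) (blinfun_apply T (ket h))) has_sum blinfun_apply T \<xi>) UNIV"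
  using has_sum_bounded_linear[OF blinfun.bounded_linear_right[of T] ket_expansion[of \<xi>]] assms
  by (simp add: complex_linear_def o_def)

lemma complex_linear_eqI:
  assumes "complex_linear S" "complex_linear T" "\<And>g h. mcoeff S g h = mcoeff T g h"
  shows "S = T"
proof (rule blinfun_eqI)
  fix \<xi>
  have "blinfun_apply S (ket h) = blinfun_apply T (ket h)" for h
    by (rule ell2_eqI) (use assms(3) in \<open>simp add: mcoeff_def\<close>)
  then show "blinfun_apply S \<xi> = blinfun_apply T \<xi>"
    using has_sum_unique[OF op_expansion[OF assms(1), of \<xi>]] op_expansion[OF assms(2), of \<xi>]
    by simp
qed

lemma scaleC_add: "scaleC c (\<xi> + \<eta>) = scaleC c \<xi> + scaleC c \<eta>"
  and scaleC_diff: "scaleC c (\<xi> - \<eta>) = scaleC c \<xi> - scaleC c \<eta>"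
  and scaleC_scaleC: "scaleC c (scaleC c' \<xi>) = scaleC (c * c') \<xi>"
  and scaleC_zero: "scaleC c 0 = 0"
  and scaleC_one: "scaleC 1 \<xi> = \<xi>"
  and scaleC_add_left: "scaleC (c + c') \<xi> = scaleC c \<xi> + scaleC c' \<xi>"
  by (rule ell2_eqI; simp add: coord_scaleC coord_add coord_diff coord_zero algebra_simps)+

lemma complex_linear_id: "complex_linear id_blinfun"
  and complex_linear_zero: "complex_linear 0"
  and complex_linear_add: "complex_linear S \<Longrightarrow> complex_linear T \<Longrightarrow> complex_linear (S + T)"
  and complex_linear_diff: "complex_linear S \<Longrightarrow> complex_linear T \<Longrightarrow> complex_linear (S - T)"
  and complex_linear_cscale: "complex_linear T \<Longrightarrow> complex_linear (cscale c T)"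
  and complex_linear_compose: "complex_linear S \<Longrightarrow> complex_linear T \<Longrightarrow> complex_linear (S o\<^sub>L T)"
  by (simp_all add: complex_linear_def scaleC_zero blinfun.add_left blinfun.diff_left scaleC_add
      scaleC_diff cscale_apply scaleC_scaleC mult.commute)

lemma mcoeff_add: "mcoeff (S + T) g h = mcoeff S g h + mcoeff T g h"
  and mcoeff_diff: "mcoeff (S - T) g h = mcoeff S g h - mcoeff T g h"
  and mcoeff_cscale: "mcoeff (cscale c T) g h = c * mcoeff T g h"
  and mcoeff_scaleR: "mcoeff (x *\<^sub>R T) g h = of_real x * mcoeff T g h"
  and mcoeff_zero: "mcoeff 0 g h = 0"
  and mcoeff_id: "mcoeff id_blinfun g h = (if g = h then 1 else 0)"
  by (simp_all add: mcoeff_def blinfun.add_left blinfun.diff_left blinfun.scaleR_left coord_add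
      coord_diff coord_scaleC coord_scaleR cscale_apply coord_zero coord_ket)

lemma cmod_mcoeff_le: "cmod (mcoeff T g h) \<le> norm T"
  using order_trans[OF cmod_coord_le[of "blinfun_apply T (ket h)" g] norm_blinfun[of T "ket h"]]
  by (simp add: mcoeff_def norm_ket)

lemma norm_cscale_le: "norm (cscale c T) \<le> cmod c * norm T"
  by (rule norm_blinfun_bound)
    (auto simp: cscale_apply norm_scaleC mult.assoc intro!: mult_left_mono norm_blinfun)

lemma cscale_add: "cscale c (S + T) = cscale c S + cscale c T"
  and cscale_cscale: "cscale c (cscale c' T) = cscale (c * c') T"
  and cscale_one: "cscale 1 T = T"
  and cscale_of_real: "cscale (of_real x) T = x *\<^sub>R T"
  and cscale_add_left: "cscale (c + c') T = cscale c T + cscale c' T"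
  and cscale_compose_left: "cscale c S o\<^sub>L T = cscale c (S o\<^sub>L T)"
  and cscale_zero: "cscale c 0 = 0"
  by (rule blinfun_eqI; simp add: cscale_apply blinfun.add_left blinfun.diff_left
      blinfun.scaleR_left scaleC_add scaleC_diff scaleC_scaleC scaleC_one scaleR_eq_scaleC
      scaleC_add_left scaleC_zero)+

lemma cscale_compose_right: "complex_linear S \<Longrightarrow> S o\<^sub>L cscale c T = cscale c (S o\<^sub>L T)"
  by (rule blinfun_eqI) (simp add: cscale_apply complex_linear_def)

lemma bounded_linear_cscale: "bounded_linear (cscale c)"
proof (rule bounded_linear_intro[where K = "cmod c"])
  show "cscale c (x *\<^sub>R T) = x *\<^sub>R cscale c T" for x and T :: "'a operator"
    by (simp only: cscale_of_real[symmetric] cscale_cscale mult.commute)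
  show "norm (cscale c T) \<le> norm T * cmod c" for T :: "'a operator"
    by (subst mult.commute) (rule norm_cscale_le)
qed (rule cscale_add)

lemmas compose_add_left = bounded_bilinear.add_left[OF bounded_bilinear_blinfun_compose]
  and compose_add_right = bounded_bilinear.add_right[OF bounded_bilinear_blinfun_compose]
  and compose_diff_left = bounded_bilinear.diff_left[OF bounded_bilinear_blinfun_compose]
  and compose_diff_right = bounded_bilinear.diff_right[OF bounded_bilinear_blinfun_compose]
  and compose_sum_left = bounded_bilinear.sum_left[OF bounded_bilinear_blinfun_compose]
  and compose_sum_right = bounded_bilinear.sum_right[OF bounded_bilinear_blinfun_compose]

lemma compose_id_left [simp]: "id_blinfun o\<^sub>L T = T"
  and compose_id_right [simp]: "T o\<^sub>L id_blinfun = T"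
  by (rule blinfun_eqI; simp)+

lemma closed_complex_linear: "closed {T. complex_linear T}"
proof -
  have "{T :: 'a operator. complex_linear T} =
      (\<Inter>c \<xi>. {T. blinfun_apply T (scaleC c \<xi>) = scaleC c (blinfun_apply T \<xi>)})"
    by (auto simp: complex_linear_def)
  also have "closed \<dots>"
    by (intro closed_INT ballI closed_Collect_eq
        bounded_linear.continuous_on[OF bounded_linear_scaleC]
        bounded_linear.continuous_on[OF blinfun.bounded_linear_left] continuous_intros)
  finally show ?thesis .
qed

subsection \<open>Adjoints\<close>

lemma ell2_eq_if_cinner_eq: "(\<And>\<xi>. cinner \<xi> \<eta> = cinner \<xi> \<zeta>) \<Longrightarrow> \<eta> = \<zeta>"
  by (rule ell2_eqI) (metis cinner_ket_left complex_cnj_cnj)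

lemma adj_eqI:
  assumes "\<And>\<xi> \<eta>. cinner (blinfun_apply T \<xi>) \<eta> = cinner \<xi> (blinfun_apply S \<eta>)"
  shows "adj T = S"
  unfolding adj_def
proof (rule the_equality)
  fix S' assume "\<forall>\<xi> \<eta>. cinner (blinfun_apply T \<xi>) \<eta> = cinner \<xi> (blinfun_apply S' \<eta>)"
  with assms show "S' = S"
    by (intro blinfun_eqI ell2_eq_if_cinner_eq) simp
qed (use assms in simp)

text \<open>The coordinates of the adjoint at \<open>\<eta>\<close> must be \<open>\<langle>\<eta>, T e\<^sub>x\<rangle>\<close>. The sum \<open>s\<close> of their squares over a
  finite set is the value of \<open>\<langle>T \<xi>, \<eta>\<rangle>\<close> at a vector \<open>\<xi>\<close> with \<open>\<parallel>\<xi>\<parallel>\<^sup>2 = s\<close>, which bounds \<open>s\<close> by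
  \<open>(\<parallel>T\<parallel> \<parallel>\<eta>\<parallel>)\<^sup>2\<close>.\<close>

lemma adjoint_exists:
  assumes T: "complex_linear T"
  shows "\<exists>S. \<forall>\<xi> \<eta>. cinner (blinfun_apply T \<xi>) \<eta> = cinner \<xi> (blinfun_apply S \<eta>)"
proof -
  define a where "a \<eta> x = cinner \<eta> (blinfun_apply T (ket x))" for \<eta> x
  have fin: "(\<Sum>x\<in>F. (cmod (a \<eta> x))\<^sup>2) \<le> (norm T * norm \<eta>)\<^sup>2" if "finite F" for F \<eta>
  proof -
    define s where "s = (\<Sum>x\<in>F. (cmod (a \<eta> x))\<^sup>2)"
    define \<xi> where "\<xi> = (\<Sum>x\<in>F. scaleC (a \<eta> x) (ket x))"
    have s0: "s \<ge> 0" by (simp add: s_def sum_nonneg)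
    have c: "coord \<xi> x = (if x \<in> F then a \<eta> x else 0)" for x
      unfolding \<xi>_def using that by (rule coord_sum_ket)
    have "(norm \<xi>)\<^sup>2 = (\<Sum>\<^sub>\<infinity>x\<in>F. (cmod (a \<eta> x))\<^sup>2)"
      unfolding norm_sq by (rule infsum_cong_neutral) (auto simp: c)
    then have n: "(norm \<xi>)\<^sup>2 = s"
      using that by (simp add: s_def)
    have "blinfun_apply T \<xi> = (\<Sum>x\<in>F. scaleC (a \<eta> x) (blinfun_apply T (ket x)))"
      using T by (simp add: \<xi>_def blinfun.sum_right complex_linear_def)
    then have "cinner (blinfun_apply T \<xi>) \<eta> = (\<Sum>x\<in>F. a \<eta> x * cnj (a \<eta> x))"
      unfolding a_def
      by (simp add: cinner_sum_left cinner_scaleC_left cinner_commute[of "blinfun_apply T _" \<eta>])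
    also have "\<dots> = of_real s"
      unfolding s_def of_real_sum by (intro sum.cong refl) (simp only: complex_norm_square)
    finally have "s = cmod (cinner (blinfun_apply T \<xi>) \<eta>)"
      using s0 by simp
    also have "\<dots> \<le> norm (blinfun_apply T \<xi>) * norm \<eta>"
      by (rule cmod_cinner_le)
    also have "\<dots> \<le> (norm T * norm \<xi>) * norm \<eta>"
      by (intro mult_right_mono norm_blinfun) simp
    finally have "(norm \<xi>) * norm \<xi> \<le> (norm T * norm \<eta>) * norm \<xi>"
      using n by (simp add: power2_eq_square mult_ac)
    then have "norm \<xi> \<le> norm T * norm \<eta>"
      by (cases "norm \<xi> = 0") (auto simp: mult_le_cancel_right)
    then show ?thesis
      using n by (metis norm_ge_zero power_mono s_def)
  qed
  have sm: "(\<lambda>x. (cmod (a \<eta> x))\<^sup>2) summable_on UNIV" for \<eta>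
    by (rule nonneg_bdd_above_summable_on) (auto intro!: bdd_aboveI2 fin)
  define S where "S \<eta> = Abs_ell2 (a \<eta>)" for \<eta>
  have cS: "coord (S \<eta>) = a \<eta>" for \<eta>
    unfolding S_def by (rule Abs_ell2_inverse) (use sm in simp)
  have "bounded_linear S"
  proof (rule bounded_linear_intro[where K = "norm T"])
    show "S (\<eta> + \<zeta>) = S \<eta> + S \<zeta>" for \<eta> \<zeta>
      by (rule ell2_eqI) (simp add: coord_add cS a_def cinner_add_left)
    show "S (x *\<^sub>R \<eta>) = x *\<^sub>R S \<eta>" for x \<eta>
      by (rule ell2_eqI) (simp add: coord_scaleR cS a_def cinner_scaleC_left scaleR_eq_scaleC coord_scaleC)
    show "norm (S \<eta>) \<le> norm \<eta> * norm T" for \<eta>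
    proof -
      have "(norm (S \<eta>))\<^sup>2 \<le> (norm T * norm \<eta>)\<^sup>2"
        unfolding norm_sq cS by (rule infsum_le_finite_sums[OF sm]) (use fin in auto)
      then show ?thesis
        by (metis mult.commute mult_nonneg_nonneg norm_ge_zero power2_le_imp_le)
    qed
  qed
  then have apply_S: "blinfun_apply (Blinfun S) = S"
    by (rule bounded_linear_Blinfun_apply)
  have "cinner (blinfun_apply T \<xi>) \<eta> = cinner \<xi> (S \<eta>)" for \<xi> \<eta>
  proof -
    have bl: "bounded_linear (\<lambda>\<xi>. cinner \<xi> \<eta>)"
      by (rule bounded_linear_intro[where K = "norm \<eta>"])
        (simp_all add: cinner_add_left scaleR_eq_scaleC cinner_scaleC_left scaleR_conv_of_real
          cmod_cinner_le)
    have "((\<lambda>h. cinner (scaleC (coord \<xi> h) (blinfun_apply T (ket h))) \<eta>) has_sum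
        cinner (blinfun_apply T \<xi>) \<eta>) UNIV"
      using has_sum_bounded_linear[OF bl op_expansion[OF T, of \<xi>]] by (simp add: o_def)
    moreover have "cinner (scaleC (coord \<xi> h) (blinfun_apply T (ket h))) \<eta> =
        coord \<xi> h * cnj (coord (S \<eta>) h)" for h
      by (simp add: cinner_scaleC_left cS a_def cinner_commute[of "blinfun_apply T _" \<eta>])
    ultimately show ?thesis
      by (simp add: cinner_def infsumI)
  qed
  then show ?thesis
    using apply_S by metis
qed

lemma cinner_adj:
  "complex_linear T \<Longrightarrow> cinner (blinfun_apply T \<xi>) \<eta> = cinner \<xi> (blinfun_apply (adj T) \<eta>)"
  using adjoint_exists[of T] adj_eqI[of T] by metis

lemma mcoeff_adj: "complex_linear T \<Longrightarrow> mcoeff (adj T) g h = cnj (mcoeff T h g)"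
  using cinner_adj[of T "ket g" "ket h"] by (simp add: mcoeff_def cinner_ket cinner_ket_left)

lemma complex_linear_adj: "complex_linear T \<Longrightarrow> complex_linear (adj T)"
  unfolding complex_linear_def[of "adj T"]
  by (intro allI ell2_eq_if_cinner_eq)
    (simp add: cinner_adj[symmetric] cinner_scaleC_right)

lemma adj_add: "complex_linear S \<Longrightarrow> complex_linear T \<Longrightarrow> adj (S + T) = adj S + adj T"
  by (rule adj_eqI) (simp add: blinfun.add_left cinner_add_left cinner_add_right cinner_adj)

lemma adj_diff: "complex_linear S \<Longrightarrow> complex_linear T \<Longrightarrow> adj (S - T) = adj S - adj T"
  by (rule adj_eqI) (simp add: blinfun.diff_left cinner_diff_left cinner_diff_right cinner_adj)

lemma adj_cscale: "complex_linear T \<Longrightarrow> adj (cscale c T) = cscale (cnj c) (adj T)"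
  by (rule adj_eqI) (simp add: cscale_apply cinner_scaleC_left cinner_scaleC_right cinner_adj)

lemma adj_zero: "adj 0 = 0"
  by (metis adj_diff complex_linear_zero diff_self)

lemma adj_id: "adj id_blinfun = id_blinfun"
  by (rule adj_eqI) simp

lemma adj_adj: "complex_linear T \<Longrightarrow> adj (adj T) = T"
  by (rule adj_eqI) (metis cinner_adj cinner_commute)

lemma adj_sum: "(\<And>i. i \<in> I \<Longrightarrow> complex_linear (f i)) \<Longrightarrow> adj (\<Sum>i\<in>I. f i) = (\<Sum>i\<in>I. adj (f i))
    \<and> complex_linear (\<Sum>i\<in>I. f i)"
  by (induction I rule: infinite_finite_induct)
    (simp_all add: adj_zero complex_linear_zero adj_add complex_linear_add)

lemma norm_adj_le:
  assumes "complex_linear T" shows "norm (adj T) \<le> norm T"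
proof (rule norm_blinfun_bound)
  fix \<eta>
  let ?\<zeta> = "blinfun_apply (adj T) \<eta>"
  have "norm ?\<zeta> * norm ?\<zeta> = cmod (cinner ?\<zeta> ?\<zeta>)"
    by (simp add: cinner_norm power2_eq_square norm_mult)
  also have "cinner ?\<zeta> ?\<zeta> = cinner (blinfun_apply T ?\<zeta>) \<eta>"
    by (simp add: cinner_adj[OF assms])
  also have "cmod \<dots> \<le> norm (blinfun_apply T ?\<zeta>) * norm \<eta>"
    by (rule cmod_cinner_le)
  also have "\<dots> \<le> (norm T * norm ?\<zeta>) * norm \<eta>"
    by (intro mult_right_mono norm_blinfun) simp
  finally have "norm ?\<zeta> * norm ?\<zeta> \<le> (norm T * norm \<eta>) * norm ?\<zeta>"
    by (simp add: mult_ac)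
  then show "norm ?\<zeta> \<le> norm T * norm \<eta>"
    by (cases "norm ?\<zeta> = 0") (auto simp: mult_le_cancel_right)
qed simp

lemma mcoeff_adj_compose_self:
  "complex_linear T \<Longrightarrow> mcoeff (adj T o\<^sub>L T) h h = of_real ((norm (blinfun_apply T (ket h)))\<^sup>2)"
  by (simp add: mcoeff_def cinner_ket[symmetric])
    (metis cinner_adj cinner_commute cinner_norm complex_cnj_complex_of_real of_real_power)

section \<open>Operators of bisections\<close>

lemma complex_linear_ket_eqI:
  assumes "complex_linear S" "complex_linear T"
    and "\<And>h. blinfun_apply S (ket h) = blinfun_apply T (ket h)"
  shows "S = T"
  by (rule complex_linear_eqI[OF assms(1,2)]) (simp add: mcoeff_def assms(3))

lemma regular_rep_unique: "regular_rep G f S \<Longrightarrow> regular_rep G f T \<Longrightarrow> S = T"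
  by (intro blinfun_eqI ell2_eqI) (simp add: regular_rep_def)

lemma regular_rep_complex_linear:
  assumes "regular_rep G f T" shows "complex_linear T"
  unfolding complex_linear_def
proof (intro allI ell2_eqI)
  fix c \<xi> g
  have "coord (blinfun_apply T (scaleC c \<xi>)) g =
      (\<Sum>\<^sub>\<infinity>h\<in>{h. dmap G h = dmap G g}. c * (f (mul G g (ginv G h)) * coord \<xi> h))"
    using assms by (simp add: regular_rep_def coord_scaleC mult_ac)
  also have "\<dots> = coord (scaleC c (blinfun_apply T \<xi>)) g"
    using assms by (simp add: regular_rep_def coord_scaleC infsum_cmult_right')
  finally show "coord (blinfun_apply T (scaleC c \<xi>)) g = coord (scaleC c (blinfun_apply T \<xi>)) g" .
qed

lemma mcoeff_regular_rep:
  assumes "regular_rep G f T"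
  shows "mcoeff T g h = (if dmap G g = dmap G h then f (mul G g (ginv G h)) else 0)"
proof -
  have "mcoeff T g h =
      (\<Sum>\<^sub>\<infinity>k\<in>{k. dmap G k = dmap G g}. f (mul G g (ginv G k)) * coord (ket h) k)"
    using assms by (simp add: mcoeff_def regular_rep_def)
  also have "\<dots> = (\<Sum>\<^sub>\<infinity>k\<in>{h} \<inter> {k. dmap G k = dmap G g}. f (mul G g (ginv G k)) * coord (ket h) k)"
    by (rule infsum_cong_neutral) (auto simp: coord_ket)
  also have "\<dots> = (if dmap G g = dmap G h then f (mul G g (ginv G h)) else 0)"
    by (cases "dmap G h = dmap G g") (auto simp: coord_ket)
  finally show ?thesis .
qed

text \<open>A convolution sum that fails to converge has the value \<open>0\<close>, so \<^const>\<open>regular_rep\<close> need not be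
  additive in the function. It is additive for functions with finitely many non-zero convolution
  factors at each point.\<close>

definition finite_rep :: "'g groupoid \<Rightarrow> ('g \<Rightarrow> complex) \<Rightarrow> 'g operator \<Rightarrow> bool" where
  "finite_rep G f T \<longleftrightarrow> regular_rep G f T \<and>
    (\<forall>g. finite {h. dmap G h = dmap G g \<and> f (mul G g (ginv G h)) \<noteq> 0})"

lemma finite_rep_regular: "finite_rep G f T \<Longrightarrow> regular_rep G f T"
  by (simp add: finite_rep_def)

lemma finite_rep_summable:
  assumes "finite_rep G f T"
  shows "(\<lambda>h. f (mul G g (ginv G h)) * coord \<xi> h) summable_on {h. dmap G h = dmap G g}"
  by (rule finite_nonzero_values_imp_summable_on)
    (rule finite_subset[of _ "{h. dmap G h = dmap G g \<and> f (mul G g (ginv G h)) \<noteq> 0}"],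
      use assms in \<open>auto simp: finite_rep_def\<close>)

lemma finite_rep_zero: "finite_rep G (\<lambda>_. 0) 0"
  by (simp add: finite_rep_def regular_rep_def coord_zero)

lemma finite_rep_add:
  assumes f: "finite_rep G f S" and g: "finite_rep G f' T"
  shows "finite_rep G (\<lambda>x. f x + f' x) (S + T)"
  unfolding finite_rep_def
proof (intro conjI allI)
  show "regular_rep G (\<lambda>x. f x + f' x) (S + T)"
    using finite_rep_regular[OF f] finite_rep_regular[OF g]
    by (simp add: regular_rep_def blinfun.add_left coord_add distrib_right
        infsum_add[OF finite_rep_summable[OF f] finite_rep_summable[OF g]])
  show "finite {h. dmap G h = dmap G g \<and> f (mul G g (ginv G h)) + f' (mul G g (ginv G h)) \<noteq> 0}" for g
    by (rule finite_subset[of _ "{h. dmap G h = dmap G g \<and> f (mul G g (ginv G h)) \<noteq> 0} \<union>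
        {h. dmap G h = dmap G g \<and> f' (mul G g (ginv G h)) \<noteq> 0}"])
      (use f g in \<open>auto simp: finite_rep_def\<close>)
qed

lemma finite_rep_cscale:
  assumes f: "finite_rep G f S"
  shows "finite_rep G (\<lambda>x. c * f x) (cscale c S)"
  unfolding finite_rep_def
proof (intro conjI allI)
  show "regular_rep G (\<lambda>x. c * f x) (cscale c S)"
    using finite_rep_regular[OF f]
    by (simp add: regular_rep_def cscale_apply coord_scaleC mult.assoc infsum_cmult_right')
  show "finite {h. dmap G h = dmap G g \<and> c * f (mul G g (ginv G h)) \<noteq> 0}" for g
    by (rule finite_subset[of _ "{h. dmap G h = dmap G g \<and> f (mul G g (ginv G h)) \<noteq> 0}"])
      (use f in \<open>auto simp: finite_rep_def\<close>)
qed

lemma finite_rep_diff: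
  assumes "finite_rep G f S" "finite_rep G f' T"
  shows "finite_rep G (\<lambda>x. f x - f' x) (S - T)"
proof -
  have "S + cscale (-1) T = S - T"
    by (rule blinfun_eqI)
      (simp add: blinfun.add_left blinfun.diff_left cscale_apply ell2_eqI coord_diff coord_add
        coord_scaleC)
  with finite_rep_add[OF assms(1) finite_rep_cscale[OF assms(2), of "-1"]] show ?thesis
    by simp
qed

text \<open>Convolution by a function carried by a bisection \<open>V\<close> is a weighted partial permutation of the
  basis, because left division by the element of \<open>V\<close> over the range of \<open>g\<close> is injective in \<open>g\<close>.
  Hence its norm is at most the supremum of the weights.\<close>

lemma (in groupoid) bisection_operator_exists:
  assumes r: "inj_on (rmap G) V" and d: "inj_on (dmap G) V"
    and f0: "\<And>g. g \<notin> V \<Longrightarrow> f g = 0" and fc: "\<And>g. cmod (f g) \<le> c"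
  shows "\<exists>T. finite_rep G f T \<and> norm T \<le> c"
proof -
  have c0: "c \<ge> 0"
    using fc[of undefined] norm_ge_zero order_trans by blast
  define v where "v g = the_inv_into V (rmap G) (rmap G g)" for g
  define D where "D = {g. rmap G g \<in> rmap G ` V}"
  define \<theta> where "\<theta> g = mul G (ginv G (v g)) g" for g
  have v: "v g \<in> V" "rmap G (v g) = rmap G g" if "g \<in> D" for g
    using that r the_inv_into_into[OF r, of "rmap G g" V] f_the_inv_into_f[OF r, of "rmap G g"]
    by (auto simp: D_def v_def)
  have v_eq: "v g = w" if "w \<in> V" "rmap G w = rmap G g" for g w
    unfolding v_def that(2)[symmetric] by (rule the_inv_into_f_f[OF r that(1)])
  have \<theta>: "mul G (v g) (\<theta> g) = g" "dmap G (v g) = rmap G (\<theta> g)" "dmap G (\<theta> g) = dmap G g" if "g \<in> D" for g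
    using v[OF that] by (simp_all add: \<theta>_def)
  have inj: "inj_on \<theta> D"
  proof (rule inj_onI)
    fix g h assume gh: "g \<in> D" "h \<in> D" "\<theta> g = \<theta> h"
    then have "v g = v h"
      using \<theta>(2) v(1) inj_onD[OF d, of "v g" "v h"] by metis
    with gh show "g = h"
      using \<theta>(1) by metis
  qed
  define a where "a \<xi> g = (if g \<in> D then f (v g) * coord \<xi> (\<theta> g) else 0)" for \<xi> g
  have s1: "(\<lambda>g. (cmod (coord \<xi> (\<theta> g)))\<^sup>2) summable_on D" for \<xi>
    using summable_on_reindex[OF inj, of "\<lambda>x. (cmod (coord \<xi> x))\<^sup>2"]
      summable_on_subset_banach[OF square_summable_coord[of \<xi>], of "\<theta> ` D"]
    by (simp add: o_def)
  have le: "(cmod (a \<xi> g))\<^sup>2 \<le> c\<^sup>2 * (cmod (coord \<xi> (\<theta> g)))\<^sup>2" if "g \<in> D" for \<xi> g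
    using that fc by (auto simp: a_def norm_mult power_mult_distrib intro!: mult_right_mono power_mono)
  have "(\<lambda>g. (cmod (a \<xi> g))\<^sup>2) summable_on D" for \<xi>
    by (rule summable_on_comparison_test[OF summable_on_cmult_right[OF s1[of \<xi>], of "c\<^sup>2"]])
      (use le in auto)
  then have sa: "(\<lambda>g. (cmod (a \<xi> g))\<^sup>2) summable_on UNIV" for \<xi>
    by (rule summable_on_cong_neutral[THEN iffD1, rotated -1]) (auto simp: a_def)
  have na: "(\<Sum>\<^sub>\<infinity>g. (cmod (a \<xi> g))\<^sup>2) \<le> c\<^sup>2 * (norm \<xi>)\<^sup>2" for \<xi>
  proof -
    have "(\<Sum>\<^sub>\<infinity>g. (cmod (a \<xi> g))\<^sup>2) = (\<Sum>\<^sub>\<infinity>g\<in>D. (cmod (a \<xi> g))\<^sup>2)"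
      by (rule infsum_cong_neutral) (auto simp: a_def)
    also have "\<dots> \<le> (\<Sum>\<^sub>\<infinity>g\<in>D. c\<^sup>2 * (cmod (coord \<xi> (\<theta> g)))\<^sup>2)"
      by (rule infsum_mono[OF _ summable_on_cmult_right[OF s1[of \<xi>]]])
        (use le summable_on_subset_banach[OF sa] in auto)
    also have "\<dots> = c\<^sup>2 * (\<Sum>\<^sub>\<infinity>g\<in>D. (cmod (coord \<xi> (\<theta> g)))\<^sup>2)"
      by (rule infsum_cmult_right) (rule s1)
    also have "(\<Sum>\<^sub>\<infinity>g\<in>D. (cmod (coord \<xi> (\<theta> g)))\<^sup>2) = (\<Sum>\<^sub>\<infinity>x\<in>\<theta> ` D. (cmod (coord \<xi> x))\<^sup>2)"
      using infsum_reindex[OF inj, of "\<lambda>x. (cmod (coord \<xi> x))\<^sup>2"] by (simp add: o_def)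
    also have "c\<^sup>2 * \<dots> \<le> c\<^sup>2 * (norm \<xi>)\<^sup>2"
      unfolding norm_sq
      by (intro mult_left_mono infsum_mono_neutral summable_on_subset_banach[OF square_summable_coord]
          square_summable_coord) auto
    finally show ?thesis .
  qed
  define A where "A \<xi> = Abs_ell2 (a \<xi>)" for \<xi>
  have cA: "coord (A \<xi>) = a \<xi>" for \<xi>
    unfolding A_def by (rule Abs_ell2_inverse) (use sa in simp)
  have nA: "norm (A \<xi>) \<le> norm \<xi> * c" for \<xi>
  proof (rule power2_le_imp_le)
    show "(norm (A \<xi>))\<^sup>2 \<le> (norm \<xi> * c)\<^sup>2"
      using na[of \<xi>] by (simp add: norm_sq[of "A \<xi>"] cA power_mult_distrib mult.commute)
  qed (use c0 in simp)
  have bl: "bounded_linear A"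
  proof (rule bounded_linear_intro[where K = c])
    show "A (\<xi> + \<eta>) = A \<xi> + A \<eta>" "A (x *\<^sub>R \<xi>) = x *\<^sub>R A \<xi>" for x \<xi> \<eta>
      by (rule ell2_eqI; simp add: coord_add coord_scaleR cA a_def algebra_simps)+
  qed (rule nA)
  have sep: "f (mul G g (ginv G h)) = 0 \<or> (g \<in> D \<and> h = \<theta> g)" if "dmap G h = dmap G g" for g h
  proof (cases "f (mul G g (ginv G h)) = 0")
    case False
    then have V: "mul G g (ginv G h) \<in> V"
      using f0 by blast
    have rg: "rmap G (mul G g (ginv G h)) = rmap G g"
      using that by simp
    then have gD: "g \<in> D"
      using V by (auto simp: D_def intro: rev_image_eqI)
    have "v g = mul G g (ginv G h)"
      by (rule v_eq[OF V rg])
    then have "h = \<theta> g"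
      using that mul_dmap_self[of h] by (simp add: \<theta>_def ginv_mul ginv_ginv mul_assoc')
    with gD show ?thesis by blast
  qed simp
  have "regular_rep G f (Blinfun A)"
    unfolding regular_rep_def bounded_linear_Blinfun_apply[OF bl] cA
  proof (intro allI)
    fix \<xi> g
    let ?F = "{h. dmap G h = dmap G g}"
    have "(\<Sum>\<^sub>\<infinity>h\<in>?F. f (mul G g (ginv G h)) * coord \<xi> h) =
        (\<Sum>\<^sub>\<infinity>h\<in>(if g \<in> D then {\<theta> g} else {}). f (mul G g (ginv G h)) * coord \<xi> h)"
      by (rule infsum_cong_neutral) (use sep \<theta>(3) in \<open>auto split: if_splits\<close>)
    moreover have "mul G g (ginv G (\<theta> g)) = v g" if "g \<in> D"
      using \<theta>[OF that] by (metis mul_ginv_right)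
    ultimately show "a \<xi> g = (\<Sum>\<^sub>\<infinity>h\<in>?F. f (mul G g (ginv G h)) * coord \<xi> h)"
      by (simp add: a_def)
  qed
  moreover have "finite {h. dmap G h = dmap G g \<and> f (mul G g (ginv G h)) \<noteq> 0}" for g
    by (rule finite_subset[of _ "{\<theta> g}"]) (use sep in auto)
  moreover have "norm (Blinfun A) \<le> c"
    by (rule norm_blinfun_bound)
      (use c0 nA in \<open>auto simp: bounded_linear_Blinfun_apply[OF bl] mult.commute\<close>)
  ultimately show ?thesis
    by (auto simp: finite_rep_def)
qed

text \<open>Left convolution by the indicator function of \<open>V\<close>. For a compact open bisection this is a
  partial isometry that maps the basis vector at \<open>h\<close> to the one at \<open>vh\<close>, if \<open>v \<in> V\<close> starts where
  \<open>h\<close> ends, and to \<open>0\<close> if there is no such \<open>v\<close>.\<close>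

definition Lop :: "'g groupoid \<Rightarrow> 'g set \<Rightarrow> 'g operator" where
  "Lop G V = (THE T. regular_rep G (indicator V) T)"

context ample_groupoid
begin

lemma finite_rep_Lop:
  assumes "V \<in> Ga" shows "finite_rep G (indicator V) (Lop G V)"
proof -
  have "cmod (indicator V g) \<le> 1" for g
    by (simp add: indicator_def)
  then obtain T where T: "finite_rep G (indicator V) T"
    using bisection_operator_exists[OF Ga_inj_rmap[OF assms] Ga_inj_dmap[OF assms],
        of "indicator V" 1] by auto
  then have "Lop G V = T"
    unfolding Lop_def by (intro the_equality) (auto simp: finite_rep_def intro: regular_rep_unique)
  with T show ?thesis by simp
qed

lemma complex_linear_Lop: "V \<in> Ga \<Longrightarrow> complex_linear (Lop G V)"
  by (meson finite_rep_Lop finite_rep_regular regular_rep_complex_linear)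

lemma mcoeff_Lop:
  "V \<in> Ga \<Longrightarrow> mcoeff (Lop G V) g h =
    (if dmap G g = dmap G h \<and> mul G g (ginv G h) \<in> V then 1 else 0)"
  by (simp add: mcoeff_regular_rep[OF finite_rep_regular[OF finite_rep_Lop]])

lemma Lop_ket:
  assumes V: "V \<in> Ga" and v: "v \<in> V" "dmap G v = rmap G h"
  shows "blinfun_apply (Lop G V) (ket h) = ket (mul G v h)"
proof (rule ell2_eqI)
  fix g
  have "dmap G g = dmap G h \<and> mul G g (ginv G h) \<in> V \<longleftrightarrow> g = mul G v h"
  proof safe
    assume g: "dmap G g = dmap G h" "mul G g (ginv G h) \<in> V"
    then have "mul G g (ginv G h) = v"
      using inj_onD[OF Ga_inj_dmap[OF V], of "mul G g (ginv G h)" v] v by simp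
    then show "g = mul G v h"
      using mul_ginv_right'[OF g(1)] by simp
  qed (use v in simp_all)
  then show "coord (blinfun_apply (Lop G V) (ket h)) g = coord (ket (mul G v h)) g"
    using mcoeff_Lop[OF V, of g h] by (simp add: mcoeff_def coord_ket)
qed

lemma Lop_ket_0:
  assumes V: "V \<in> Ga" and "rmap G h \<notin> dmap G ` V"
  shows "blinfun_apply (Lop G V) (ket h) = 0"
proof (rule ell2_eqI)
  fix g
  have "\<not> (dmap G g = dmap G h \<and> mul G g (ginv G h) \<in> V)"
    using assms(2) by (metis dmap_ginv dmap_mul image_eqI rmap_ginv)
  then show "coord (blinfun_apply (Lop G V) (ket h)) g = coord 0 g"
    using mcoeff_Lop[OF V, of g h] by (auto simp: mcoeff_def coord_zero)
qed

lemma Lop_compose: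
  assumes V: "V \<in> Ga" and W: "W \<in> Ga"
  shows "Lop G V o\<^sub>L Lop G W = Lop G (setprod G V W)"
proof (rule complex_linear_ket_eqI)
  fix h
  note VW = setprod_Ga[OF V W]
  show "blinfun_apply (Lop G V o\<^sub>L Lop G W) (ket h) = blinfun_apply (Lop G (setprod G V W)) (ket h)"
  proof (cases "rmap G h \<in> dmap G ` W")
    case True
    then obtain w where w: "w \<in> W" "dmap G w = rmap G h" by auto
    show ?thesis
    proof (cases "rmap G w \<in> dmap G ` V")
      case True
      then obtain v where v: "v \<in> V" "dmap G v = rmap G w" by auto
      have "mul G v w \<in> setprod G V W"
        using v w by (auto simp: setprod_def)
      from Lop_ket[OF VW this, of h] show ?thesis
        using v w by (simp add: Lop_ket[OF W w] Lop_ket[OF V v(1)] mul_assoc')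
    next
      case False
      have "rmap G h \<notin> dmap G ` setprod G V W"
      proof
        assume "rmap G h \<in> dmap G ` setprod G V W"
        then obtain v' w' where *: "v' \<in> V" "w' \<in> W" "dmap G v' = rmap G w'" "rmap G h = dmap G w'"
          by (auto simp: setprod_def)
        then have "w' = w"
          using w inj_onD[OF Ga_inj_dmap[OF W]] by metis
        with * False show False
          by (metis image_eqI)
      qed
      then show ?thesis
        using False w by (simp add: Lop_ket[OF W w] Lop_ket_0[OF V] Lop_ket_0[OF VW])
    qed
  next
    case False
    then have "rmap G h \<notin> dmap G ` setprod G V W"
      by (auto simp: setprod_def)
    with False show ?thesis
      by (simp add: Lop_ket_0[OF W] Lop_ket_0[OF VW])
  qed
qed (intro complex_linear_compose complex_linear_Lop setprod_Ga V W)+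

lemma adj_Lop:
  assumes V: "V \<in> Ga" shows "adj (Lop G V) = Lop G (ginv G ` V)"
proof (rule complex_linear_eqI)
  show "complex_linear (adj (Lop G V))" "complex_linear (Lop G (ginv G ` V))"
    using V by (auto intro: complex_linear_adj complex_linear_Lop ginv_image_Ga)
  show "mcoeff (adj (Lop G V)) g h = mcoeff (Lop G (ginv G ` V)) g h" for g h
    unfolding mcoeff_adj[OF complex_linear_Lop[OF V]] mcoeff_Lop[OF V]
      mcoeff_Lop[OF ginv_image_Ga[OF V]]
    by (auto simp: ginv_image_eq_vimage ginv_mul ginv_ginv)
qed

lemma Lop_units:
  assumes "compact (units G)" shows "Lop G (units G) = id_blinfun"
proof (rule complex_linear_eqI)
  have U: "units G \<in> Ga"
    by (rule units_subset_in_Ga[OF assms open_units]) simp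
  show "complex_linear (Lop G (units G))"
    by (rule complex_linear_Lop[OF U])
  show "mcoeff (Lop G (units G)) g h = mcoeff id_blinfun g h" for g h
    by (auto simp: mcoeff_Lop[OF U] mcoeff_id mul_ginv_unit_iff)
qed (rule complex_linear_id)

lemma Lop_Un:
  assumes "V \<in> Ga" "W \<in> Ga" "V \<union> W \<in> Ga" "V \<inter> W = {}"
  shows "Lop G (V \<union> W) = Lop G V + Lop G W"
  by (rule complex_linear_eqI)
    (use assms in \<open>auto simp: mcoeff_add mcoeff_Lop complex_linear_Lop complex_linear_add\<close>)

lemma Lop_empty: "Lop G {} = 0"
  by (rule complex_linear_eqI)
    (simp_all add: complex_linear_Lop complex_linear_zero empty_in_Ga mcoeff_Lop mcoeff_zero)

end

section \<open>The reduced algebra as a closed span\<close>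

lemma Cc_add:
  assumes "f \<in> Cc" "f' \<in> Cc" shows "(\<lambda>x. f x + f' x) \<in> Cc"
proof -
  have "closure {x. f x + f' x \<noteq> 0} \<subseteq> closure {x. f x \<noteq> 0} \<union> closure {x. f' x \<noteq> 0}"
    unfolding closure_Un[symmetric] by (rule closure_mono) auto
  then have "compact (closure {x. f x + f' x \<noteq> 0})"
    using assms compact_Int_closed[OF compact_Un, of "closure {x. f x \<noteq> 0}" "closure {x. f' x \<noteq> 0}"
        "closure {x. f x + f' x \<noteq> 0}"]
    by (simp add: Cc_def Int_absorb1)
  then show ?thesis
    using assms by (auto simp: Cc_def intro!: continuous_intros)
qed

lemma Cc_cmult:
  assumes "f \<in> Cc" shows "(\<lambda>x. c * f x) \<in> Cc"
proof -
  have "closure {x. c * f x \<noteq> 0} \<subseteq> closure {x. f x \<noteq> 0}"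
    by (rule closure_mono) auto
  then have "compact (closure {x. c * f x \<noteq> 0})"
    using assms compact_Int_closed[of "closure {x. f x \<noteq> 0}" "closure {x. c * f x \<noteq> 0}"]
    by (simp add: Cc_def Int_absorb1)
  then show ?thesis
    using assms by (auto simp: Cc_def intro!: continuous_intros)
qed

lemma continuous_indicator_clopen:
  assumes "open U" "closed U"
  shows "continuous_on UNIV (indicator U :: 'a::topological_space \<Rightarrow> 'b::{topological_space, zero_neq_one})"
proof -
  have "continuous_on (U \<union> - U) (\<lambda>x::'a. if x \<in> U then 1 else 0 :: 'b)"
  proof (rule continuous_on_open_Un)
    show "continuous_on U (\<lambda>x::'a. if x \<in> U then 1 else 0 :: 'b)"
      by (rule continuous_on_eq[where f = "\<lambda>_. 1"]) auto
    show "continuous_on (-U) (\<lambda>x::'a. if x \<in> U then 1 else 0 :: 'b)"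
      by (rule continuous_on_eq[where f = "\<lambda>_. 0"]) auto
  qed (use assms in auto)
  then show ?thesis
    by (simp add: indicator_def[abs_def] of_bool_def)
qed

context ample_groupoid
begin

lemma indicator_Cc:
  assumes "V \<in> Ga" shows "(indicator V :: 'g \<Rightarrow> complex) \<in> Cc"
proof -
  have "{g. (indicator V g :: complex) \<noteq> 0} = V"
    by (auto simp: indicator_def)
  then show ?thesis
    using assms by (simp add: Cc_def continuous_indicator_clopen Ga_open Ga_closed Ga_compact closure_closed)
qed

text \<open>The linear span of the operators of compact open bisections: the image of the Steinberg
  algebra under the regular representation.\<close>

inductive_set steinberg :: "'g operator set" where
  zero: "0 \<in> steinberg"
| add: "T \<in> steinberg \<Longrightarrow> V \<in> Ga \<Longrightarrow> T + cscale c (Lop G V) \<in> steinberg"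

lemma steinberg_Lop: "V \<in> Ga \<Longrightarrow> Lop G V \<in> steinberg"
  using steinberg.add[OF steinberg.zero, of V 1] by (simp add: cscale_one)

lemma steinberg_plus:
  assumes "T \<in> steinberg" "S \<in> steinberg" shows "S + T \<in> steinberg"
  using assms(1)
proof induction
  case (add T V c)
  from steinberg.add[OF add.IH add.hyps(2), of c] show ?case by (simp add: add.assoc)
qed (simp add: assms)

lemma steinberg_cscale: "T \<in> steinberg \<Longrightarrow> cscale c T \<in> steinberg"
  by (induction rule: steinberg.induct) (auto simp: cscale_zero cscale_add cscale_cscale intro: steinberg.intros)

lemma steinberg_complex_linear: "T \<in> steinberg \<Longrightarrow> complex_linear T"
  by (induction rule: steinberg.induct)
    (auto intro: complex_linear_zero complex_linear_add complex_linear_cscale complex_linear_Lop)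

lemma steinberg_finite_rep: "T \<in> steinberg \<Longrightarrow> \<exists>f\<in>Cc. finite_rep G f T"
proof (induction rule: steinberg.induct)
  case zero
  have "(\<lambda>_. 0) \<in> Cc" by (simp add: Cc_def)
  with finite_rep_zero[of G] show ?case by blast
next
  case (add T V c)
  then obtain f where "f \<in> Cc" "finite_rep G f T" by blast
  with add(2) show ?case
    by (intro bexI[where x = "\<lambda>x. f x + c * indicator V x"] finite_rep_add finite_rep_cscale
        finite_rep_Lop Cc_add Cc_cmult indicator_Cc)
qed

lemma steinberg_compose:
  assumes S: "S \<in> steinberg" and T: "T \<in> steinberg" shows "S o\<^sub>L T \<in> steinberg"
proof -
  have L: "S o\<^sub>L Lop G W \<in> steinberg" if "W \<in> Ga" for W
    using S
  proof (induction rule: steinberg.induct)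
    case zero
    then show ?case by (simp add: blinfun_compose_zero steinberg.zero)
  next
    case (add T V c)
    then show ?case
      using that by (auto simp: compose_add_left cscale_compose_left Lop_compose
          intro!: steinberg.add setprod_Ga)
  qed
  show ?thesis
    using T
  proof (induction rule: steinberg.induct)
    case zero
    then show ?case by (simp add: blinfun_compose_zero steinberg.zero)
  next
    case (add T V c)
    then show ?case
      using L[of V] by (auto simp: compose_add_right cscale_compose_right
          steinberg_complex_linear[OF S] intro!: steinberg_plus steinberg_cscale)
  qed
qed

lemma steinberg_adj: "T \<in> steinberg \<Longrightarrow> adj T \<in> steinberg"
  by (induction rule: steinberg.induct)
    (auto simp: adj_zero adj_add adj_cscale adj_Lop complex_linear_cscale complex_linear_Lop
      steinberg_complex_linear intro!: steinberg.intros ginv_image_Ga)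

text \<open>The step function is built over the cover one set at a time, its new value being used only on
  the part of the new set that is not yet covered; this keeps the error below \<open>e\<close> everywhere.\<close>

lemma approx_on_cover:
  assumes "finite P" "P \<subseteq> Ga" "\<forall>V\<in>P. \<exists>c. \<forall>g\<in>V. cmod (f g - c) \<le> e"
  shows "\<exists>q S. S \<in> steinberg \<and> finite_rep G q S \<and> (\<forall>g. g \<notin> \<Union>P \<longrightarrow> q g = 0) \<and>
    (\<forall>g\<in>\<Union>P. cmod (f g - q g) \<le> e)"
  using assms
proof (induction P rule: finite_induct)
  case empty
  show ?case
    using finite_rep_zero[of G] steinberg.zero by (auto intro!: exI[of _ "\<lambda>_. 0"] exI[of _ "0 :: 'g operator"])
next
  case (insert V P)
  then have "\<exists>q S. S \<in> steinberg \<and> finite_rep G q S \<and> (\<forall>g. g \<notin> \<Union>P \<longrightarrow> q g = 0) \<and>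
      (\<forall>g\<in>\<Union>P. cmod (f g - q g) \<le> e)"
    by simp
  then obtain q S where qS: "S \<in> steinberg" "finite_rep G q S" "\<And>g. g \<notin> \<Union>P \<Longrightarrow> q g = 0"
    "\<And>g. g \<in> \<Union>P \<Longrightarrow> cmod (f g - q g) \<le> e"
    by blast
  obtain c where c: "\<And>g. g \<in> V \<Longrightarrow> cmod (f g - c) \<le> e"
    using insert.prems(2) by (meson insertI1)
  define W where "W = V \<inter> - \<Union>P"
  have "open (\<Union>P)" "closed (\<Union>P)"
    using insert by (auto intro!: open_Union closed_Union simp: Ga_open Ga_closed)
  then have W: "W \<in> Ga"
    unfolding W_def using insert.prems by (intro Ga_Int_clopen) auto
  have "finite_rep G (\<lambda>g. q g + c * indicator W g) (S + cscale c (Lop G W))"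
    by (intro finite_rep_add finite_rep_cscale finite_rep_Lop qS W)
  moreover have "S + cscale c (Lop G W) \<in> steinberg"
    by (intro steinberg.add qS W)
  moreover have "q g + c * indicator W g = 0" if "g \<notin> \<Union>(insert V P)" for g
    using that qS(3) by (auto simp: W_def)
  moreover have "cmod (f g - (q g + c * indicator W g)) \<le> e" if "g \<in> \<Union>(insert V P)" for g
    using that qS(3)[of g] qS(4)[of g] c[of g] by (cases "g \<in> \<Union>P") (auto simp: W_def indicator_def)
  ultimately show ?case by blast
qed

text \<open>On a single bisection the operator norm is at most the supremum norm of the function, so uniform
  approximation by step functions is approximation in norm.\<close>

lemma bisection_operator_in_closure:
  assumes V: "V \<in> Ga" and f: "continuous_on UNIV f" and f0: "\<And>g. g \<notin> V \<Longrightarrow> f g = 0"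
  shows "\<exists>T\<in>closure steinberg. finite_rep G f T"
proof -
  have ex: "\<exists>T. finite_rep G u T \<and> norm T \<le> c"
    if "\<And>g. g \<notin> V \<Longrightarrow> u g = 0" "\<And>g. cmod (u g) \<le> c" for u c
    using bisection_operator_exists[OF Ga_inj_rmap[OF V] Ga_inj_dmap[OF V] that] .
  have "compact (f ` V)"
    by (rule compact_continuous_image[OF continuous_on_subset[OF f] Ga_compact[OF V]]) simp
  then obtain B where B: "B > 0" "\<forall>y\<in>f ` V. cmod y \<le> B"
    using compact_imp_bounded bounded_pos by metis
  then have "cmod (f g) \<le> B" for g
    using f0[of g] by (cases "g \<in> V") auto
  then obtain T where T: "finite_rep G f T"
    using ex[of f B] f0 by auto
  have "T \<in> closure steinberg"
    unfolding closure_approachable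
  proof (intro allI impI)
    fix e :: real assume e: "e > 0"
    have "\<exists>W. W \<in> Ga \<and> g \<in> W \<and> W \<subseteq> V \<and> (\<forall>h\<in>W. cmod (f h - f g) \<le> e/2)" if g: "g \<in> V" for g
    proof -
      have "open (f -` ball (f g) (e/2))"
        using f by (intro open_vimage) auto
      then have "open (V \<inter> f -` ball (f g) (e/2))"
        by (rule open_Int[OF Ga_open[OF V]])
      from exists_bisection[OF this, of g] obtain W where "W \<in> Ga" "g \<in> W"
        "W \<subseteq> V \<inter> f -` ball (f g) (e/2)"
        using g e by auto
      moreover have "cmod (f h - f g) \<le> e/2" if "h \<in> f -` ball (f g) (e/2)" for h
        using that by (simp add: dist_norm norm_minus_commute)
      ultimately show ?thesis by blast
    qed
    then obtain W where W: "\<And>g. g \<in> V \<Longrightarrow>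
        W g \<in> Ga \<and> g \<in> W g \<and> W g \<subseteq> V \<and> (\<forall>h\<in>W g. cmod (f h - f g) \<le> e/2)"
      by metis
    obtain I where I: "I \<subseteq> V" "finite I" "V \<subseteq> (\<Union>g\<in>I. W g)"
    proof (rule compactE_image[OF Ga_compact[OF V], of V W])
      show "open (W g)" if "g \<in> V" for g
        using W[OF that] Ga_open by blast
      show "V \<subseteq> (\<Union>g\<in>V. W g)"
        using W by blast
    qed
    have "\<exists>q S. S \<in> steinberg \<and> finite_rep G q S \<and> (\<forall>g. g \<notin> \<Union>(W ` I) \<longrightarrow> q g = 0) \<and>
        (\<forall>g\<in>\<Union>(W ` I). cmod (f g - q g) \<le> e/2)"
      by (rule approx_on_cover) (use I W in blast)+
    moreover have "\<Union>(W ` I) = V"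
      using I W by blast
    ultimately obtain q S where qS: "S \<in> steinberg" "finite_rep G q S" "\<And>g. g \<notin> V \<Longrightarrow> q g = 0"
      "\<And>g. g \<in> V \<Longrightarrow> cmod (f g - q g) \<le> e/2"
      by metis
    have "cmod (f g - q g) \<le> e/2" for g
      using f0[of g] qS(3,4)[of g] e by (cases "g \<in> V") auto
    then obtain R where R: "finite_rep G (\<lambda>g. f g - q g) R" "norm R \<le> e/2"
      using ex[of "\<lambda>g. f g - q g" "e/2"] f0 qS(3) by auto
    have "R = T - S"
      using finite_rep_regular[OF R(1)] finite_rep_regular[OF finite_rep_diff[OF T qS(2)]]
      by (rule regular_rep_unique)
    with R e have "dist S T < e"
      by (simp add: dist_norm norm_minus_commute)
    with qS(1) show "\<exists>S\<in>steinberg. dist S T < e" by blast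
  qed
  with T show ?thesis by blast
qed

lemma closure_steinberg_add:
  assumes "S \<in> closure steinberg" "T \<in> closure steinberg" shows "S + T \<in> closure steinberg"
proof -
  have 1: "(\<lambda>T. S + T) ` closure steinberg \<subseteq> closure steinberg" if "S \<in> steinberg" for S
    by (rule image_closure_subset) (auto intro!: continuous_intros steinberg_plus[OF _ that]
        subsetD[OF closure_subset])
  have "(\<lambda>S. S + T) ` closure steinberg \<subseteq> closure steinberg"
    by (rule image_closure_subset) (use 1 assms(2) in \<open>auto intro!: continuous_intros\<close>)
  with assms(1) show ?thesis by blast
qed

lemma closure_steinberg_cscale:
  assumes "T \<in> closure steinberg" shows "cscale c T \<in> closure steinberg"
proof -
  have "cscale c ` closure steinberg \<subseteq> closure steinberg"
    by (rule image_closure_subset) (auto intro!: steinberg_cscale subsetD[OF closure_subset]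
        bounded_linear.continuous_on[OF bounded_linear_cscale] continuous_intros)
  with assms show ?thesis by blast
qed

lemma closure_steinberg_compose:
  assumes "S \<in> closure steinberg" "T \<in> closure steinberg" shows "S o\<^sub>L T \<in> closure steinberg"
proof -
  have 1: "(\<lambda>T. S o\<^sub>L T) ` closure steinberg \<subseteq> closure steinberg" if "S \<in> steinberg" for S
    by (rule image_closure_subset) (auto intro!: continuous_intros steinberg_compose[OF that]
        subsetD[OF closure_subset])
  have "(\<lambda>S. S o\<^sub>L T) ` closure steinberg \<subseteq> closure steinberg"
    by (rule image_closure_subset) (use 1 assms(2) in \<open>auto intro!: continuous_intros\<close>)
  with assms(1) show ?thesis by blast
qed

lemma closure_steinberg_complex_linear: "T \<in> closure steinberg \<Longrightarrow> complex_linear T"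
  using closure_minimal[OF _ closed_complex_linear, of steinberg] steinberg_complex_linear by blast

lemma closure_steinberg_adj:
  assumes T: "T \<in> closure steinberg" shows "adj T \<in> closure steinberg"
  unfolding closure_approachable
proof (intro allI impI)
  fix e :: real assume "e > 0"
  then obtain S where S: "S \<in> steinberg" "dist S T < e"
    using T closure_approachable by metis
  have "adj S - adj T = adj (S - T)" "complex_linear (S - T)"
    using S T by (auto simp: adj_diff steinberg_complex_linear closure_steinberg_complex_linear complex_linear_diff)
  then have "dist (adj S) (adj T) < e"
    using S(2) norm_adj_le[of "S - T"] by (simp add: dist_norm)
  with S(1) show "\<exists>S\<in>steinberg. dist S (adj T) < e"
    using steinberg_adj by blast
qed

lemma compactly_supported_in_closure:
  assumes "finite P" "P \<subseteq> Ga" "continuous_on UNIV f" "\<And>g. g \<notin> \<Union>P \<Longrightarrow> f g = 0"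
  shows "\<exists>T\<in>closure steinberg. finite_rep G f T"
  using assms
proof (induction P arbitrary: f rule: finite_induct)
  case empty
  then have "f = (\<lambda>_. 0)" by auto
  then show ?case
    using finite_rep_zero[of G] steinberg.zero closure_subset[of steinberg] by auto
next
  case (insert V P)
  have V: "V \<in> Ga" using insert by auto
  have 1: "continuous_on UNIV (\<lambda>g. f g * indicator V g)"
    "continuous_on UNIV (\<lambda>g. f g * indicator (-V) g)"
    by (intro continuous_intros insert.prems continuous_indicator_clopen
        Ga_open[OF V] Ga_closed[OF V] open_Compl closed_Compl)+
  obtain T where T: "T \<in> closure steinberg" "finite_rep G (\<lambda>g. f g * indicator V g) T"
    using bisection_operator_in_closure[OF V 1(1)] by auto
  obtain S where S: "S \<in> closure steinberg" "finite_rep G (\<lambda>g. f g * indicator (-V) g) S"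
  proof -
    have "f g * indicator (-V) g = 0" if "g \<notin> \<Union>P" for g
      using that insert.prems(3)[of g] by (auto simp: indicator_def)
    with insert.IH[OF _ 1(2)] insert.prems(1) that show thesis by blast
  qed
  have "(\<lambda>g. f g * indicator V g + f g * indicator (-V) g) = f"
    by (auto simp: indicator_def)
  with finite_rep_add[OF T(2) S(2)] closure_steinberg_add[OF T(1) S(1)] show ?case
    by auto
qed

text \<open>This is the density of the Steinberg algebra: the support of a function in \<^const>\<open>Cc\<close> is covered
  by finitely many compact open bisections, so the function splits into finitely many pieces that
  are each carried by one bisection.\<close>

lemma reduced_cstar_eq_closure_steinberg: "reduced_cstar G = closure steinberg"
proof
  have "{T. \<exists>f\<in>Cc. regular_rep G f T} \<subseteq> closure steinberg"
  proof clarify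
    fix f T assume f: "f \<in> Cc" and T: "regular_rep G f T"
    let ?K = "closure {g. f g \<noteq> 0}"
    have "\<exists>V. V \<in> Ga \<and> g \<in> V" for g
      using exists_bisection[of UNIV g] by auto
    then obtain V where V: "\<And>g. V g \<in> Ga \<and> g \<in> V g" by metis
    obtain I where "I \<subseteq> ?K" "finite I" "?K \<subseteq> (\<Union>g\<in>I. V g)"
    proof (rule compactE_image[of ?K ?K V])
      show "compact ?K" using f by (simp add: Cc_def)
    qed (use V in \<open>auto simp: Ga_open\<close>)
    then have "\<exists>S\<in>closure steinberg. finite_rep G f S"
      using f V closure_subset[of "{g. f g \<noteq> 0}"]
      by (intro compactly_supported_in_closure[of "V ` I"]) (auto simp: Cc_def)
    then show "T \<in> closure steinberg"
      using T regular_rep_unique finite_rep_regular by metis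
  qed
  then show "reduced_cstar G \<subseteq> closure steinberg"
    unfolding reduced_cstar_def by (rule closure_minimal) simp
  show "closure steinberg \<subseteq> reduced_cstar G"
    unfolding reduced_cstar_def
    by (rule closure_mono) (use steinberg_finite_rep finite_rep_regular in blast)
qed

end

section \<open>Comparing multiplicities\<close>

definition count_at :: "'a set list \<Rightarrow> 'a \<Rightarrow> nat" where
  "count_at As x = length (filter (\<lambda>A. x \<in> A) As)"

lemma count_at_Nil [simp]: "count_at [] x = 0"
  and count_at_Cons: "count_at (A # As) x = of_bool (x \<in> A) + count_at As x"
  and count_at_append [simp]: "count_at (As @ Bs) x = count_at As x + count_at Bs x"
  by (simp_all add: count_at_def)

lemma count_at_eq_sum: "count_at As x = (\<Sum>s<length As. of_bool (x \<in> As ! s))"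
proof (induction As)
  case (Cons A As)
  show ?case
    by (simp add: count_at_Cons Cons sum.lessThan_Suc_shift del: sum_of_bool_eq sum.lessThan_Suc)
qed simp

lemma count_at_map_upt: "count_at (map A [0..<m]) x = (\<Sum>t<m. of_bool (x \<in> A t))"
  by (simp add: count_at_eq_sum)

lemma count_at_concat: "count_at (concat Ls) x = (\<Sum>L\<leftarrow>Ls. count_at L x)"
  by (induction Ls) simp_all

lemma count_at_replicate: "count_at (replicate n A) x = n * of_bool (x \<in> A)"
  by (induction n) (simp_all add: count_at_Cons)

lemma count_at_le_length: "count_at As x \<le> length As"
  by (simp add: count_at_def)

lemma count_at_take_mono: "m \<le> n \<Longrightarrow> count_at (take m As) x \<le> count_at (take n As) x"
  by (metis count_at_append le_add1 le_Suc_ex take_add)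

lemma count_at_take_Suc:
  "s < length As \<Longrightarrow> x \<in> As ! s \<Longrightarrow> count_at (take (Suc s) As) x = Suc (count_at (take s As) x)"
  by (simp add: take_Suc_conv_app_nth count_at_Cons)

text \<open>The rank of the index \<open>s\<close> at a point of \<open>As ! s\<close> is the number of earlier sets that contain the
  point. At a fixed point \<open>x\<close>, the ranks enumerate the sets through \<open>x\<close> by \<open>0, \<dots>, count_at As x - 1\<close>.\<close>

lemma rank_less_count:
  assumes "s < length As" "x \<in> As ! s"
  shows "count_at (take s As) x < count_at As x"
  using count_at_take_Suc[OF assms] count_at_take_mono[of "Suc s" "length As" As x] assms(1) by simp

lemma rank_inject:
  assumes "s < length As" "t < length As" "x \<in> As ! s" "x \<in> As ! t"
    and "count_at (take s As) x = count_at (take t As) x"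
  shows "s = t"
  using assms count_at_take_Suc[of s As x] count_at_take_Suc[of t As x]
    count_at_take_mono[of "Suc s" t As x] count_at_take_mono[of "Suc t" s As x]
  by (metis Suc_n_not_le_n not_less_eq_eq le_antisym)

lemma rank_surj:
  "j < count_at As x \<Longrightarrow> \<exists>s<length As. x \<in> As ! s \<and> count_at (take s As) x = j"
proof (induction As arbitrary: j)
  case (Cons A As)
  show ?case
  proof (cases "x \<in> A \<and> j = 0")
    case True
    then show ?thesis by (intro exI[of _ 0]) simp
  next
    case False
    then have "j - of_bool (x \<in> A) < count_at As x"
      using Cons.prems by (auto simp: count_at_Cons)
    then obtain s where "s < length As" "x \<in> As ! s" "count_at (take s As) x = j - of_bool (x \<in> A)"
      using Cons.IH by blast
    with False show ?thesis
      by (intro exI[of _ "Suc s"]) (auto simp: count_at_Cons)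
  qed
qed simp

lemma open_count_at_eq:
  assumes "\<And>A. A \<in> set As \<Longrightarrow> open A \<and> closed A"
  shows "open {x. count_at As x = n}"
  using assms
proof (induction As arbitrary: n)
  case (Cons A As)
  have "{x. count_at (A # As) x = n} =
      (if n = 0 then {} else A \<inter> {x. count_at As x = n - 1}) \<union> (-A \<inter> {x. count_at As x = n})"
    by (auto simp: count_at_Cons)
  moreover have "open {x. count_at As x = m}" for m
    using Cons by simp
  ultimately show ?case
    using Cons.prems by (auto intro!: open_Un open_Int)
qed simp

lemma clopen_count_at_rel:
  assumes "\<And>A. A \<in> set As \<Longrightarrow> open A \<and> closed A" "\<And>B. B \<in> set Bs \<Longrightarrow> open B \<and> closed B"
  shows "open {x. P (count_at As x) (count_at Bs x)}" "closed {x. P (count_at As x) (count_at Bs x)}"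
proof -
  have op: "open {x. Q (count_at As x) (count_at Bs x)}" for Q :: "nat \<Rightarrow> nat \<Rightarrow> bool"
  proof -
    have "{x. Q (count_at As x) (count_at Bs x)} =
        (\<Union>(m, n)\<in>{(m, n). Q m n}. {x. count_at As x = m} \<inter> {x. count_at Bs x = n})"
      by auto
    also have "open \<dots>"
      using assms by (intro open_UN) (auto intro!: open_Int open_count_at_eq)
    finally show ?thesis .
  qed
  show "open {x. P (count_at As x) (count_at Bs x)}"
    by (rule op)
  show "closed {x. P (count_at As x) (count_at Bs x)}"
    using op[of "\<lambda>m n. \<not> P m n"] by (simp add: closed_def Collect_neg_eq)
qed

lemma sum_of_bool_le_1:
  assumes "finite I" "\<And>s t. s \<in> I \<Longrightarrow> t \<in> I \<Longrightarrow> P s \<Longrightarrow> P t \<Longrightarrow> s = t" "\<And>s. s \<in> I \<Longrightarrow> P s \<Longrightarrow> Q"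
  shows "(\<Sum>s\<in>I. of_bool (P s) :: nat) \<le> of_bool Q"
proof (cases "\<exists>s\<in>I. P s")
  case True
  then obtain s where s: "s \<in> I" "P s" by blast
  have "(\<Sum>s\<in>I. of_bool (P s) :: nat) = card {s \<in> I. P s}"
    using assms(1) by (simp add: Int_def)
  also have "{s \<in> I. P s} = {s}"
    using s assms(2) by blast
  finally show ?thesis
    using s assms(3) by simp
next
  case False
  then have "(\<Sum>s\<in>I. of_bool (P s) :: nat) = 0"
    by simp
  then show ?thesis by simp
qed

abbreviation dcount :: "'g groupoid \<Rightarrow> 'g set list \<Rightarrow> 'g \<Rightarrow> nat" where
  "dcount G Vs \<equiv> count_at (map (image (dmap G)) Vs)"

abbreviation rcount :: "'g groupoid \<Rightarrow> 'g set list \<Rightarrow> 'g \<Rightarrow> nat" where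
  "rcount G Vs \<equiv> count_at (map (image (rmap G)) Vs)"

text \<open>The order of the type semigroup, for arbitrary multiplicity functions: \<open>f\<close> copies of the unit
  space, counted with multiplicity at each point, are moved by finitely many bisections into \<open>f'\<close>
  copies. Requiring inequalities instead of equality on both sides makes monotonicity and
  additivity immediate.\<close>

definition dominated :: "'g::topological_space groupoid \<Rightarrow> ('g \<Rightarrow> nat) \<Rightarrow> ('g \<Rightarrow> nat) \<Rightarrow> bool" where
  "dominated G f f' \<longleftrightarrow> (\<exists>Vs. set Vs \<subseteq> compact_open_bisections G \<and>
    (\<forall>x\<in>units G. f x \<le> dcount G Vs x \<and> rcount G Vs x \<le> f' x))"

context ample_groupoid
begin

lemma clopen_in_rmap_images:
  assumes "set Vs \<subseteq> Ga" "A \<in> set (take s (map (image (rmap G)) Vs))"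
  shows "open A \<and> closed A"
proof -
  obtain V where "V \<in> Ga" "A = rmap G ` V"
    using assms in_set_takeD[OF assms(2)] by auto
  then show ?thesis
    using Ga_open Ga_closed rmap_image_Ga by blast
qed

lemma clopen_in_dmap_images:
  assumes "set Vs \<subseteq> Ga" "A \<in> set (take s (map (image (dmap G)) Vs))"
  shows "open A \<and> closed A"
proof -
  obtain V where "V \<in> Ga" "A = dmap G ` V"
    using assms in_set_takeD[OF assms(2)] by auto
  then show ?thesis
    using Ga_open Ga_closed dmap_image_Ga by blast
qed

lemma dominated_add:
  assumes "dominated G f f'" "dominated G k k'"
  shows "dominated G (\<lambda>x. f x + k x) (\<lambda>x. f' x + k' x)"
proof -
  obtain Vs Ws where "set Vs \<subseteq> Ga" "\<forall>x\<in>units G. f x \<le> dcount G Vs x \<and> rcount G Vs x \<le> f' x"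
    "set Ws \<subseteq> Ga" "\<forall>x\<in>units G. k x \<le> dcount G Ws x \<and> rcount G Ws x \<le> k' x"
    using assms unfolding dominated_def by blast
  then show ?thesis
    unfolding dominated_def by (intro exI[of _ "Vs @ Ws"]) (auto intro: add_mono)
qed

lemma dominated_weaken:
  assumes "dominated G f f'" "\<And>x. x \<in> units G \<Longrightarrow> k x \<le> f x" "\<And>x. x \<in> units G \<Longrightarrow> f' x \<le> k' x"
  shows "dominated G k k'"
proof -
  obtain Vs where "set Vs \<subseteq> Ga" "\<forall>x\<in>units G. f x \<le> dcount G Vs x \<and> rcount G Vs x \<le> f' x"
    using assms(1) unfolding dominated_def by blast
  then show ?thesis
    unfolding dominated_def using assms(2,3) by (intro exI[of _ Vs]) (meson order_trans)
qed

lemma dominated_const: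
  assumes "compact (units G)" shows "dominated G (\<lambda>_. n) (\<lambda>_. n)"
proof -
  have "units G \<in> Ga"
    by (rule units_subset_in_Ga[OF assms open_units]) simp
  moreover have "dmap G ` units G = units G" "rmap G ` units G = units G"
    by (force simp: rmap_unit dmap_unit)+
  ultimately show ?thesis
    unfolding dominated_def
    by (intro exI[of _ "replicate n (units G)"]) (auto simp: count_at_replicate)
qed

text \<open>Transitivity: at a point \<open>x\<close> that lies in \<open>r(V\<^sub>s)\<close> as the \<open>j\<close>-th such set, continue with the
  \<open>j\<close>-th of the sets \<open>d(W\<^sub>t)\<close> that contain \<open>x\<close>. The ranks are locally constant, so that the pieces
  on which a given pair \<open>(s, t)\<close> is matched are clopen.\<close>

lemma dominated_trans:
  assumes "dominated G f f'" "dominated G f' f''"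
  shows "dominated G f f''"
proof -
  obtain Vs where Vs: "set Vs \<subseteq> Ga" "\<And>x. x \<in> units G \<Longrightarrow> f x \<le> dcount G Vs x"
    "\<And>x. x \<in> units G \<Longrightarrow> rcount G Vs x \<le> f' x"
    using assms(1) unfolding dominated_def by blast
  obtain Ws where Ws: "set Ws \<subseteq> Ga" "\<And>x. x \<in> units G \<Longrightarrow> f' x \<le> dcount G Ws x"
    "\<And>x. x \<in> units G \<Longrightarrow> rcount G Ws x \<le> f'' x"
    using assms(2) unfolding dominated_def by blast
  define rV where "rV = map (image (rmap G)) Vs"
  define dW where "dW = map (image (dmap G)) Ws"
  define E where "E s t = {x. count_at (take s rV) x = count_at (take t dW) x}" for s t
  have cl: "A \<in> set (take s rV) \<Longrightarrow> open A \<and> closed A" "A \<in> set (take t dW) \<Longrightarrow> open A \<and> closed A" for A s t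
    unfolding rV_def dW_def
    by (fact clopen_in_rmap_images[OF Vs(1)], fact clopen_in_dmap_images[OF Ws(1)])
  have E: "open (E s t)" "closed (E s t)" for s t
    unfolding E_def by (rule clopen_count_at_rel; use cl in blast)+
  let ?n = "length Vs" and ?m = "length Ws"
  define P where "P s t = setprod G (Ws ! t) {v \<in> Vs ! s. rmap G v \<in> E s t}" for s t
  have V: "Vs ! s \<in> Ga" if "s < ?n" for s using Vs(1) that by auto
  have W: "Ws ! t \<in> Ga" if "t < ?m" for t using Ws(1) that by auto
  have P: "P s t \<in> Ga" if "s < ?n" "t < ?m" for s t
    unfolding P_def by (intro setprod_Ga restrict_rmap_Ga V W that E)
  define Ps where "Ps = concat (map (\<lambda>s. map (P s) [0..<?m]) [0..<?n])"
  have count: "count_at (map (image p) Ps) x = (\<Sum>s<?n. \<Sum>t<?m. of_bool (x \<in> p ` P s t))"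
    for p :: "'g \<Rightarrow> 'g" and x
    by (simp add: Ps_def map_concat count_at_concat o_def count_at_map_upt
        interv_sum_list_conv_sum_set_nat atLeast0LessThan del: sum_of_bool_eq)
  have "f x \<le> dcount G Ps x" if x: "x \<in> units G" for x
  proof -
    have "of_bool (x \<in> dmap G ` (Vs ! s)) \<le> (\<Sum>t<?m. of_bool (x \<in> dmap G ` P s t) :: nat)"
      if s: "s < ?n" for s
    proof (cases "x \<in> dmap G ` (Vs ! s)")
      case True
      then obtain v where v: "v \<in> Vs ! s" "x = dmap G v" by auto
      have "count_at (take s rV) (rmap G v) < count_at rV (rmap G v)"
        by (rule rank_less_count) (use s v in \<open>auto simp: rV_def\<close>)
      also have "\<dots> \<le> count_at dW (rmap G v)"
        using Vs(3)[of "rmap G v"] Ws(2)[of "rmap G v"] by (simp add: rV_def dW_def)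
      finally have "\<exists>t<length dW. rmap G v \<in> dW ! t \<and>
          count_at (take t dW) (rmap G v) = count_at (take s rV) (rmap G v)"
        by (rule rank_surj)
      then obtain t where t: "t < ?m" "rmap G v \<in> dW ! t"
        "count_at (take t dW) (rmap G v) = count_at (take s rV) (rmap G v)"
        unfolding dW_def length_map by blast
      then obtain w where w: "w \<in> Ws ! t" "dmap G w = rmap G v"
        by (auto simp: dW_def)
      have "mul G w v \<in> P s t"
        unfolding P_def setprod_def mem_Collect_eq
        by (intro exI[of _ w] exI[of _ v]) (use t(3) v(1) w in \<open>simp add: E_def\<close>)
      then have "x \<in> dmap G ` P s t"
        using v w by (intro image_eqI[of _ _ "mul G w v"]) auto
      then have "1 \<le> (of_bool (x \<in> dmap G ` P s t) :: nat)" by simp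
      also have "\<dots> \<le> (\<Sum>t<?m. of_bool (x \<in> dmap G ` P s t) :: nat)"
        by (rule member_le_sum) (use t in auto)
      finally show ?thesis by simp
    qed simp
    then have "(\<Sum>s<?n. of_bool (x \<in> dmap G ` (Vs ! s))) \<le> dcount G Ps x"
      unfolding count by (intro sum_mono) (simp only: lessThan_iff)
    then have "dcount G Vs x \<le> dcount G Ps x"
      by (simp add: count_at_eq_sum[of "map _ Vs"] del: sum_of_bool_eq)
    then show ?thesis
      using Vs(2)[OF x] by simp
  qed
  moreover have "rcount G Ps y \<le> f'' y" if y: "y \<in> units G" for y
  proof -
    have "(\<Sum>s<?n. of_bool (y \<in> rmap G ` P s t) :: nat) \<le> of_bool (y \<in> rmap G ` (Ws ! t))"
      if t: "t < ?m" for t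
    proof (rule sum_of_bool_le_1)
      have ex: "\<exists>w v. w \<in> Ws ! t \<and> v \<in> Vs ! s \<and> rmap G v \<in> E s t \<and> dmap G w = rmap G v \<and> y = rmap G w"
        if "y \<in> rmap G ` P s t" for s
        using that by (force simp: P_def setprod_def)
      then show "y \<in> rmap G ` (Ws ! t)" if "y \<in> rmap G ` P s t" for s
        using that by blast
      fix s s' assume s: "s \<in> {..<?n}" "s' \<in> {..<?n}"
        and y: "y \<in> rmap G ` P s t" "y \<in> rmap G ` P s' t"
      obtain w v where wv: "w \<in> Ws ! t" "v \<in> Vs ! s" "rmap G v \<in> E s t" "dmap G w = rmap G v" "y = rmap G w"
        using ex[OF y(1)] by blast
      obtain w' v' where wv': "w' \<in> Ws ! t" "v' \<in> Vs ! s'" "rmap G v' \<in> E s' t"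
        "dmap G w' = rmap G v'" "y = rmap G w'"
        using ex[OF y(2)] by blast
      have "w = w'"
        using inj_onD[OF Ga_inj_rmap[OF W[OF t]]] wv wv' by metis
      then have eq: "rmap G v' = rmap G v"
        using wv wv' by simp
      show "s = s'"
      proof (rule rank_inject[of s rV s' "rmap G v"])
        show "rmap G v \<in> rV ! s" "rmap G v \<in> rV ! s'"
          using s wv wv' eq by (auto simp: rV_def intro: rev_image_eqI)
        show "count_at (take s rV) (rmap G v) = count_at (take s' rV) (rmap G v)"
          using wv(3) wv'(3) eq by (simp add: E_def)
      qed (use s in \<open>auto simp: rV_def\<close>)
    qed simp
    then have "rcount G Ps y \<le> (\<Sum>t<?m. of_bool (y \<in> rmap G ` (Ws ! t)))"
      unfolding count by (subst sum.swap, intro sum_mono) (simp only: lessThan_iff)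
    then have "rcount G Ps y \<le> rcount G Ws y"
      by (simp add: count_at_eq_sum[of "map _ Ws"] del: sum_of_bool_eq)
    then show ?thesis
      using Ws(3)[OF y] by simp
  qed
  moreover have "set Ps \<subseteq> Ga"
    using P by (auto simp: Ps_def)
  ultimately show ?thesis
    unfolding dominated_def by blast
qed

text \<open>The inverses of the given bisections move \<open>1 + f\<close> into \<open>f\<close>, where \<open>f\<close> counts their sources. So
  \<open>f\<close> absorbs one more copy of the unit space, hence any number of copies; as \<open>f\<close> is at most the
  number \<open>N\<close> of bisections, \<open>N + 1\<close> copies of the unit space fit into \<open>N\<close> copies.\<close>

lemma dominated_Suc_of_surplus:
  assumes cu: "compact (units G)" and Vs: "set Vs \<subseteq> Ga"
    and surplus: "\<And>x. x \<in> units G \<Longrightarrow> 1 + dcount G Vs x \<le> rcount G Vs x"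
  shows "\<exists>N>0. dominated G (\<lambda>_. Suc N) (\<lambda>_. N)"
proof -
  let ?f = "dcount G Vs"
  let ?Ws = "map (image (ginv G)) Vs"
  have maps: "map (image (dmap G)) ?Ws = map (image (rmap G)) Vs"
    "map (image (rmap G)) ?Ws = map (image (dmap G)) Vs"
    by (simp_all add: o_def rmap_ginv_image dmap_ginv_image)
  have absorb: "dominated G (\<lambda>x. 1 + ?f x) ?f"
    unfolding dominated_def
  proof (intro exI[of _ ?Ws] conjI ballI)
    show "set ?Ws \<subseteq> Ga"
      using Vs ginv_image_Ga by auto
  qed (use surplus in \<open>simp_all only: maps order_refl\<close>)
  have m: "dominated G (\<lambda>x. Suc m + ?f x) ?f" for m
  proof (induction m)
    case 0
    then show ?case using absorb by simp
  next
    case (Suc m)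
    have "dominated G (\<lambda>x. 1 + (Suc m + ?f x)) (\<lambda>x. 1 + ?f x)"
      by (rule dominated_add[OF dominated_const[OF cu] Suc])
    from dominated_trans[OF this absorb] show ?case by simp
  qed
  define N where "N = length Vs"
  have le: "?f x \<le> N" for x
    using count_at_le_length[of "map (image (dmap G)) Vs" x] by (simp add: N_def)
  have "dominated G (\<lambda>_. Suc N) (\<lambda>_. N)"
    by (rule dominated_weaken[OF m[of N]]) (use le in auto)
  moreover have "N > 0"
  proof (rule ccontr)
    assume "\<not> N > 0"
    then show False
      using surplus[OF rmap_in_units[of undefined]] by (simp add: N_def)
  qed
  ultimately show ?thesis by blast
qed

text \<open>A multiplicity is turned into levels by ranks: the \<open>s\<close>-th bisection is cut into the pieces
  \<open>Q s i m\<close> on which the index \<open>s\<close> has rank \<open>i\<close> at the source and rank \<open>m\<close> at the range, and such a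
  piece moves level \<open>i\<close> to level \<open>m\<close>. Distinct indices have distinct ranks at a point, which makes
  the ranges disjoint.\<close>

lemma paradoxical_if_dominated:
  assumes kl: "0 < l" and dom: "dominated G (\<lambda>_. k) (\<lambda>_. l)"
  shows "paradoxical G k l (units G)"
proof -
  obtain Vs where Vs: "set Vs \<subseteq> Ga" "\<And>x. x \<in> units G \<Longrightarrow> k \<le> dcount G Vs x"
    "\<And>x. x \<in> units G \<Longrightarrow> rcount G Vs x \<le> l"
    using dom unfolding dominated_def by blast
  define rV where "rV = map (image (rmap G)) Vs"
  define dV where "dV = map (image (dmap G)) Vs"
  let ?n = "length Vs"
  have V: "Vs ! s \<in> Ga" if "s < ?n" for s using Vs(1) that by auto
  define Q where "Q s i m = {v \<in> {v \<in> Vs ! s. rmap G v \<in> {x. count_at (take s rV) x = m}}.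
      dmap G v \<in> {x. count_at (take s dV) x = i}}" for s i m
  have cl: "A \<in> set (take s rV) \<Longrightarrow> open A \<and> closed A" "A \<in> set (take s dV) \<Longrightarrow> open A \<and> closed A" for A s
    unfolding rV_def dV_def
    by (fact clopen_in_rmap_images[OF Vs(1)], fact clopen_in_dmap_images[OF Vs(1)])
  have "open {x. count_at (take s rV) x = m}" "closed {x. count_at (take s rV) x = m}"
    "open {x. count_at (take s dV) x = m}" "closed {x. count_at (take s dV) x = m}" for s m
    using clopen_count_at_rel[of "take s rV" "take s rV" "\<lambda>a _. a = m"]
      clopen_count_at_rel[of "take s dV" "take s dV" "\<lambda>a _. a = m"] cl by blast+
  then have Q: "Q s i m \<in> Ga" if "s < ?n" for s i m
    unfolding Q_def by (intro restrict_rmap_Ga restrict_dmap_Ga V that)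
  (* The pairs (s, m) with s < n and m < l are enumerated by j - 1 = s * l + m. *)
  define W where "W i j = Q ((j - 1) div l) (i - 1) ((j - 1) mod l)" for i j
  define lev where "lev i j = Suc ((j - 1) mod l)" for i j :: nat
  have sn: "(j - 1) div l < ?n" if "j \<in> {1..?n * l}" for j
    by (rule less_mult_imp_div_less) (use that in auto)
  show ?thesis
    unfolding paradoxical_def
  proof (intro conjI exI[of _ "\<lambda>_. ?n * l"] exI[of _ W] exI[of _ lev] ballI)
    show "units G \<noteq> {}" using rmap_in_units by blast
  next
    fix i j assume "i \<in> {1..k}" and j: "j \<in> {1..?n * l}"
    show "W i j \<in> Ga"
      unfolding W_def using sn[OF j] by (rule Q)
    show "lev i j \<in> {1..l}"
      using kl by (simp add: lev_def Suc_le_eq)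
    then show "rmap G ` W i j \<times> {lev i j} \<subseteq> units G \<times> {1..l}"
      by auto
  next
    fix i assume i: "i \<in> {1..k}"
    show "(\<Union>j\<in>{1..?n * l}. dmap G ` W i j) = units G"
    proof
      show "units G \<subseteq> (\<Union>j\<in>{1..?n * l}. dmap G ` W i j)"
      proof
        fix x assume x: "x \<in> units G"
        have "i - 1 < k"
          using i by auto
        also have "k \<le> count_at dV x"
          using Vs(2)[OF x] by (simp add: dV_def)
        finally have "\<exists>s<length dV. x \<in> dV ! s \<and> count_at (take s dV) x = i - 1"
          by (rule rank_surj)
        then obtain s where s: "s < ?n" "x \<in> dV ! s" "count_at (take s dV) x = i - 1"
          unfolding dV_def length_map by blast
        then obtain v where v: "v \<in> Vs ! s" "x = dmap G v"
          by (auto simp: dV_def)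
        define m where "m = count_at (take s rV) (rmap G v)"
        have "m < count_at rV (rmap G v)"
          unfolding m_def by (rule rank_less_count) (use s v in \<open>auto simp: rV_def\<close>)
        then have m: "m < l"
          using Vs(3)[of "rmap G v"] by (simp add: rV_def)
        have "v \<in> Q s (i - 1) m"
          using v s(3) by (auto simp: Q_def m_def)
        then have "v \<in> W i (Suc (s * l + m))"
          using m by (simp add: W_def)
        moreover have "Suc (s * l + m) \<in> {1..?n * l}"
        proof -
          have "s * l + m < Suc s * l" using m by simp
          also have "\<dots> \<le> ?n * l" using s(1) by (intro mult_le_mono1) simp
          finally show ?thesis by simp
        qed
        ultimately show "x \<in> (\<Union>j\<in>{1..?n * l}. dmap G ` W i j)"
          using v(2) by blast
      qed
    qed auto
  next
    show "disjoint_family_on (\<lambda>(i, j). (rmap G ` W i j) \<times> {lev i j}) (SIGMA i:{1..k}. {1..?n * l})"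
      unfolding disjoint_family_on_def
    proof (clarify, rule ccontr, goal_cases)
      case (1 i j i' j')
      then obtain y where y: "y \<in> rmap G ` W i j" "y \<in> rmap G ` W i' j'" and lev: "lev i j = lev i' j'"
        by auto
      define s s' m where "s = (j - 1) div l" and "s' = (j' - 1) div l" and "m = (j - 1) mod l"
      have m': "(j' - 1) mod l = m"
        using lev by (simp add: lev_def m_def)
      obtain v where v: "v \<in> Q s (i - 1) m" "y = rmap G v"
        using y(1) by (auto simp: W_def s_def m_def)
      obtain v' where v': "v' \<in> Q s' (i' - 1) m" "y = rmap G v'"
        using y(2) unfolding W_def s'_def[symmetric] m' by blast
      have s: "s < ?n" "s' < ?n"
        using 1 sn by (auto simp: s_def s'_def)
      have ss: "s = s'"
      proof (rule rank_inject[of s rV s' y])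
        show "y \<in> rV ! s" "y \<in> rV ! s'"
          using s v v' imageI[of v "Vs ! s" "rmap G"] imageI[of v' "Vs ! s'" "rmap G"]
          by (simp_all add: rV_def Q_def)
        show "count_at (take s rV) y = count_at (take s' rV) y"
          using v v' by (simp add: Q_def)
      qed (use s in \<open>auto simp: rV_def\<close>)
      have "v \<in> Vs ! s" "v' \<in> Vs ! s"
        using v(1) v'(1) by (simp_all add: Q_def ss)
      moreover have "rmap G v = rmap G v'"
        using v(2) v'(2) by simp
      ultimately have "v = v'"
        using inj_onD[OF Ga_inj_rmap[OF V[OF s(1)]]] by blast
      then have "i - 1 = i' - 1"
        using v(1) v'(1) unfolding Q_def ss by simp
      then have "i = i'"
        using 1 by auto
      moreover have "j - 1 = j' - 1"
        using ss m' unfolding s_def s'_def m_def by (metis div_mult_mod_eq)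
      then have "j = j'"
        using 1 by auto
      ultimately show False
        using 1 by simp
    qed
  qed auto
qed

end

section \<open>Linear functionals below a sublinear one\<close>

definition sublinear :: "('v::real_vector \<Rightarrow> real) \<Rightarrow> bool" where
  "sublinear p \<longleftrightarrow> (\<forall>x y. p (x + y) \<le> p x + p y) \<and> (\<forall>c>0. \<forall>x. p (c *\<^sub>R x) \<le> c * p x)"

lemma sublinear_add: "sublinear p \<Longrightarrow> p (x + y) \<le> p x + p y"
  and sublinear_scaleR_le: "sublinear p \<Longrightarrow> c > 0 \<Longrightarrow> p (c *\<^sub>R x) \<le> c * p x"
  by (auto simp: sublinear_def)

lemma sublinear_scaleR:
  assumes p: "sublinear p" and c: "c \<ge> 0" shows "p (c *\<^sub>R x) = c * p x"
proof (cases "c = 0")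
  case True
  have "p 0 \<ge> 0"
    using sublinear_add[OF p, of 0 0] by simp
  moreover have "p 0 \<le> 0"
    using sublinear_scaleR_le[OF p, of "1/2" 0] by simp
  ultimately show ?thesis
    using True by simp
next
  case False
  with c have "c > 0" by simp
  then have "p (inverse c *\<^sub>R (c *\<^sub>R x)) \<le> inverse c * p (c *\<^sub>R x)"
    by (intro sublinear_scaleR_le[OF p]) simp
  then have "c * p x \<le> p (c *\<^sub>R x)"
    using \<open>c > 0\<close> by (simp add: field_simps)
  then show ?thesis
    using sublinear_scaleR_le[OF p \<open>c > 0\<close>, of x] by simp
qed

lemma sublinear_lower:
  assumes p: "sublinear p" shows "- p (- x) \<le> p x"
  using sublinear_add[OF p, of x "-x"] sublinear_scaleR[OF p, of 0 0] by simp

text \<open>Zorn's lemma applies because the pointwise infimum of a chain is again sublinear; it is finite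
  as every sublinear functional \<open>q\<close> below \<open>p\<close> satisfies \<open>- p (- x) \<le> - q (- x) \<le> q x\<close>.\<close>

lemma minimal_sublinear_exists:
  fixes p :: "'v::real_vector \<Rightarrow> real"
  assumes p: "sublinear p"
  shows "\<exists>q. sublinear q \<and> q \<le> p \<and> (\<forall>q'. sublinear q' \<longrightarrow> q' \<le> q \<longrightarrow> q' = q)"
proof -
  define A where "A = {q. sublinear q \<and> q \<le> p}"
  have "\<exists>q\<in>A. \<forall>q'\<in>A. q \<ge> q' \<longrightarrow> q' = q"
  proof (rule predicate_Zorn)
    show "partial_order_on A (relation_of (\<ge>) A)"
      by (rule partial_order_on_relation_ofI) auto
    fix C assume C: "C \<in> Chains (relation_of (\<ge>) A)"
    then have CA: "C \<subseteq> A"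
      by (auto simp: Chains_def relation_of_def)
    have chain: "q \<le> q' \<or> q' \<le> q" if "q \<in> C" "q' \<in> C" for q q'
      using C that by (auto simp: Chains_def relation_of_def)
    show "\<exists>u\<in>A. \<forall>q\<in>C. q \<ge> u"
    proof (cases "C = {}")
      case True
      then show ?thesis using p by (auto simp: A_def)
    next
      case False
      have lower: "- p (- x) \<le> q x" if "q \<in> C" for q x
      proof -
        have "sublinear q" "q (- x) \<le> p (- x)"
          using that CA by (auto simp: A_def le_fun_def)
        then show ?thesis
          using sublinear_lower[of q x] by simp
      qed
      then have bdd: "bdd_below ((\<lambda>q. q x) ` C)" for x
        by (intro bdd_belowI2)
      define u where "u x = (INF q\<in>C. q x)" for x
      have u_le: "u x \<le> q x" if "q \<in> C" for q x
        unfolding u_def by (rule cINF_lower[OF bdd that])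
      have le_u: "a \<le> u x" if "\<And>q. q \<in> C \<Longrightarrow> a \<le> q x" for a x
        unfolding u_def by (rule cINF_greatest[OF False that])
      have "sublinear u"
        unfolding sublinear_def
      proof (intro conjI allI impI)
        fix x y
        have "u (x + y) \<le> q x + q' y" if q: "q \<in> C" "q' \<in> C" for q q'
        proof -
          from chain[OF q] obtain k where k: "k \<in> C" "k \<le> q" "k \<le> q'"
            using q by blast
          then have "sublinear k"
            using CA by (auto simp: A_def)
          have "u (x + y) \<le> k (x + y)"
            by (rule u_le[OF k(1)])
          also have "\<dots> \<le> k x + k y"
            by (rule sublinear_add[OF \<open>sublinear k\<close>])
          also have "\<dots> \<le> q x + q' y"
            using k by (simp add: le_fun_def add_mono)
          finally show ?thesis .
        qed
        then have "u (x + y) - q' y \<le> q x" if "q \<in> C" "q' \<in> C" for q q'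
          using that by (subst diff_le_eq) blast
        then have "u (x + y) - q' y \<le> u x" if "q' \<in> C" for q'
          using le_u that by blast
        then have "u (x + y) - u x \<le> q' y" if "q' \<in> C" for q'
          using that by (simp add: algebra_simps)
        then have "u (x + y) - u x \<le> u y"
          using le_u by blast
        then show "u (x + y) \<le> u x + u y"
          by simp
      next
        fix c :: real and x assume c: "c > 0"
        have "u (c *\<^sub>R x) / c \<le> q x" if q: "q \<in> C" for q
        proof -
          have "sublinear q"
            using CA q by (auto simp: A_def)
          then have "u (c *\<^sub>R x) \<le> c * q x"
            using u_le[OF q, of "c *\<^sub>R x"] sublinear_scaleR_le[OF _ c, of q x] by simp
          then show ?thesis
            using c by (simp add: field_simps)
        qed
        then have "u (c *\<^sub>R x) / c \<le> u x"
          by (rule le_u)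
        then show "u (c *\<^sub>R x) \<le> c * u x"
          using c by (simp add: field_simps)
      qed
      moreover obtain q0 where "q0 \<in> C"
        using False by blast
      then have "u \<le> p"
        using u_le[of q0] CA by (auto simp: A_def le_fun_def intro: order_trans)
      ultimately show ?thesis
        using u_le by (auto simp: A_def le_fun_def)
    qed
  qed
  then obtain q where "q \<in> A" "\<forall>q'\<in>A. q' \<le> q \<longrightarrow> q' = q"
    by blast
  then show ?thesis
    by (intro exI[of _ q]) (auto simp: A_def intro: order_trans)
qed

text \<open>For fixed \<open>y\<close>, the infimum of \<open>q (x + t y) - t q y\<close> over \<open>t \<ge> 0\<close> is again sublinear in \<open>x\<close> and
  below \<open>q\<close>. By minimality it equals \<open>q\<close>, and \<open>t = 1\<close> gives the inequality.\<close>

lemma minimal_sublinear_superadditive: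
  fixes q :: "'v::real_vector \<Rightarrow> real"
  assumes q: "sublinear q" and min: "\<And>q'. sublinear q' \<Longrightarrow> q' \<le> q \<Longrightarrow> q' = q"
  shows "q x + q y \<le> q (x + y)"
proof -
  define w where "w x t = q (x + t *\<^sub>R y) - t * q y" for x t
  define u where "u x = (INF t\<in>{0..}. w x t)" for x
  have "- q (- x) \<le> w x t" if "t \<ge> 0" for x t
    using sublinear_add[OF q, of "x + t *\<^sub>R y" "- x"] sublinear_scaleR[OF q that, of y]
    by (simp add: w_def)
  then have bdd: "bdd_below (w x ` {0..})" for x
    by (intro bdd_belowI2[where m = "- q (- x)"]) auto
  have u_le: "u x \<le> w x t" if "t \<ge> 0" for x t
    unfolding u_def by (rule cINF_lower[OF bdd]) (use that in simp)
  have le_u: "a \<le> u x" if "\<And>t. t \<ge> 0 \<Longrightarrow> a \<le> w x t" for a x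
    unfolding u_def by (rule cINF_greatest) (use that in auto)
  have "sublinear u"
    unfolding sublinear_def
  proof (intro conjI allI impI)
    fix x x'
    have *: "u (x + x') \<le> w x t + w x' t'" if t: "t \<ge> 0" "t' \<ge> 0" for t t'
    proof -
      have "u (x + x') \<le> w (x + x') (t + t')"
        using t by (intro u_le) simp
      also have "x + x' + (t + t') *\<^sub>R y = (x + t *\<^sub>R y) + (x' + t' *\<^sub>R y)"
        by (simp add: algebra_simps)
      then have "w (x + x') (t + t') \<le> w x t + w x' t'"
        using sublinear_add[OF q, of "x + t *\<^sub>R y" "x' + t' *\<^sub>R y"]
        by (simp add: w_def algebra_simps)
      finally show ?thesis .
    qed
    have "u (x + x') - w x' t' \<le> u x" if "t' \<ge> 0" for t'
      by (rule le_u) (use *[OF _ that] in \<open>simp add: algebra_simps\<close>)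
    then have "u (x + x') - u x \<le> u x'"
      by (intro le_u) (simp add: algebra_simps)
    then show "u (x + x') \<le> u x + u x'"
      by simp
  next
    fix c :: real and x assume c: "c > 0"
    have "u (c *\<^sub>R x) / c \<le> w x t" if t: "t \<ge> 0" for t
    proof -
      have "u (c *\<^sub>R x) \<le> w (c *\<^sub>R x) (c * t)"
        using t c by (intro u_le) simp
      also have "\<dots> = q (c *\<^sub>R (x + t *\<^sub>R y)) - c * t * q y"
        by (simp add: w_def algebra_simps)
      also have "\<dots> = c * w x t"
        using sublinear_scaleR[OF q, of c "x + t *\<^sub>R y"] c by (simp add: w_def algebra_simps)
      finally show ?thesis
        using c by (simp add: field_simps)
    qed
    then have "u (c *\<^sub>R x) / c \<le> u x"
      by (rule le_u)
    then show "u (c *\<^sub>R x) \<le> c * u x"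
      using c by (simp add: field_simps)
  qed
  moreover have "u \<le> q"
    using u_le[of 0] by (simp add: le_fun_def w_def)
  ultimately have "u = q"
    by (rule min)
  then show ?thesis
    using u_le[of 1 x] by (simp add: w_def)
qed

lemma linear_below_sublinear:
  fixes p :: "'v::real_vector \<Rightarrow> real"
  assumes "sublinear p"
  shows "\<exists>\<phi>. linear \<phi> \<and> (\<forall>x. \<phi> x \<le> p x)"
proof -
  obtain q where q: "sublinear q" "q \<le> p" and min: "\<And>q'. sublinear q' \<Longrightarrow> q' \<le> q \<Longrightarrow> q' = q"
    using minimal_sublinear_exists[OF assms] by blast
  have add: "q (x + y) = q x + q y" for x y
    using minimal_sublinear_superadditive[OF q(1) min, of x y] sublinear_add[OF q(1), of x y]
    by (intro antisym)
  have "q 0 = 0"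
    using sublinear_scaleR[OF q(1), of 0 0] by simp
  then have neg: "q (- x) = - q x" for x
    using add[of x "- x"] by simp
  have "q (c *\<^sub>R x) = c * q x" for c x
  proof (cases "c \<ge> 0")
    case False
    then have "q ((- c) *\<^sub>R x) = - c * q x"
      by (intro sublinear_scaleR[OF q(1)]) simp
    then show ?thesis
      by (simp add: neg)
  qed (rule sublinear_scaleR[OF q(1)])
  with add have "linear q"
    by (intro linearI) simp_all
  with q(2) show ?thesis
    by (auto simp: le_fun_def)
qed

section \<open>Diagonal coefficients\<close>

lemma bounded_linear_mcoeff: "bounded_linear (\<lambda>T. mcoeff T g h)"
  by (rule bounded_linear_intro[where K = 1])
    (simp_all add: mcoeff_add mcoeff_scaleR scaleR_conv_of_real cmod_mcoeff_le)

context ample_groupoid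
begin

lemma mcoeff_Lop_unit:
  "V \<in> Ga \<Longrightarrow> x \<in> units G \<Longrightarrow> mcoeff (Lop G V) x x = indicator V x"
  by (simp add: mcoeff_Lop rmap_unit indicator_def)

text \<open>Right translation by \<open>g\<close> commutes with left convolution, so every operator in the algebra is
  determined by its action on the basis vectors at units.\<close>

lemma mcoeff_translate:
  assumes T: "T \<in> closure steinberg"
  shows "mcoeff T h g =
    (if dmap G h = dmap G g then mcoeff T (mul G h (ginv G g)) (rmap G g) else 0)"
proof -
  have "closure steinberg \<subseteq> {T. mcoeff T h g =
      (if dmap G h = dmap G g then mcoeff T (mul G h (ginv G g)) (rmap G g) else 0)}"
  proof (rule closure_minimal)
    show "steinberg \<subseteq> {T. mcoeff T h g =
        (if dmap G h = dmap G g then mcoeff T (mul G h (ginv G g)) (rmap G g) else 0)}"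
    proof clarify
      fix T assume "T \<in> steinberg"
      then obtain f where f: "regular_rep G f T"
        using steinberg_finite_rep finite_rep_regular by blast
      have "mul G (mul G h (ginv G g)) (rmap G g) = mul G h (ginv G g)" if "dmap G h = dmap G g"
        using mul_dmap_self[of "mul G h (ginv G g)"] that by simp
      then show "mcoeff T h g =
          (if dmap G h = dmap G g then mcoeff T (mul G h (ginv G g)) (rmap G g) else 0)"
        by (simp add: mcoeff_regular_rep[OF f] ginv_unit)
    qed
    show "closed {T. mcoeff T h g =
        (if dmap G h = dmap G g then mcoeff T (mul G h (ginv G g)) (rmap G g) else 0)}"
      by (cases "dmap G h = dmap G g"; simp)
        (intro closed_Collect_eq bounded_linear.continuous_on[OF bounded_linear_mcoeff]
          continuous_intros)+
  qed
  with T show ?thesis by blast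
qed

lemma continuous_on_diagonal:
  assumes T: "T \<in> closure steinberg"
  shows "continuous_on (units G) (\<lambda>x. mcoeff T x x)"
proof -
  have steinberg: "continuous_on (units G) (\<lambda>x. mcoeff S x x)" if "S \<in> steinberg" for S
    using that
  proof (induction rule: steinberg.induct)
    case (add T V c)
    have "continuous_on (units G) (\<lambda>x. mcoeff T x x + c * indicator V x)"
      using add by (intro continuous_intros continuous_on_subset[OF continuous_indicator_clopen])
        (auto simp: Ga_open Ga_closed)
    then show ?case
      by (rule continuous_on_eq) (use add in \<open>simp add: mcoeff_add mcoeff_cscale mcoeff_Lop_unit\<close>)
  qed (simp add: mcoeff_zero)
  obtain S where S: "\<And>n. S n \<in> steinberg" "S \<longlonglongrightarrow> T"
    using T closure_sequential by blast
  have "uniform_limit (units G) (\<lambda>n x. mcoeff (S n) x x) (\<lambda>x. mcoeff T x x) sequentially"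
    unfolding uniform_limit_iff
  proof (intro allI impI)
    fix e :: real assume "e > 0"
    with S(2) have "\<forall>\<^sub>F n in sequentially. dist (S n) T < e"
      by (rule tendstoD)
    then show "\<forall>\<^sub>F n in sequentially. \<forall>x\<in>units G. dist (mcoeff (S n) x x) (mcoeff T x x) < e"
    proof eventually_elim
      case (elim n)
      then show ?case
        using cmod_mcoeff_le[of "S n - T"] by (auto simp: dist_norm mcoeff_diff intro: le_less_trans)
    qed
  qed
  then show ?thesis
    by (rule uniform_limit_theorem[rotated]) (use S steinberg in auto)
qed

text \<open>The ranges of the arrows that start in \<open>U\<close> form an invariant open set, which is everything by
  minimality; compactness makes finitely many bisections suffice.\<close>

lemma minimal_cover:
  assumes cu: "compact (units G)" and min: "minimal G"
    and U: "open U" "U \<subseteq> units G" "U \<noteq> {}"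
  shows "\<exists>F. finite F \<and> F \<subseteq> Ga \<and> (\<forall>W\<in>F. dmap G ` W \<subseteq> U) \<and> units G \<subseteq> (\<Union>W\<in>F. rmap G ` W)"
proof -
  define R where "R = rmap G ` (dmap G -` U)"
  have oU: "open (dmap G -` U)"
    by (intro open_vimage U continuous_on_dmap)
  then have "open R"
    unfolding R_def by (rule open_rmap_image)
  then have "closedin (top_of_set (units G)) (units G - R)"
    by (auto simp: closedin_closed intro!: exI[of _ "- R"])
  moreover have "invariant G (units G - R)"
    unfolding invariant_def
  proof (intro conjI allI impI)
    fix g assume g: "dmap G g \<in> units G - R"
    have "rmap G g \<notin> R"
    proof
      assume "rmap G g \<in> R"
      then obtain h where h: "dmap G h \<in> U" "rmap G g = rmap G h"
        by (auto simp: R_def)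
      then have "mul G (ginv G g) h \<in> dmap G -` U" "rmap G (mul G (ginv G g) h) = dmap G g"
        by simp_all
      then have "dmap G g \<in> R"
        unfolding R_def by (metis image_eqI)
      with g show False by simp
    qed
    then show "rmap G g \<in> units G - R" by simp
  qed simp
  ultimately have "units G - R = {} \<or> units G - R = units G"
    using min unfolding minimal_def by blast
  moreover have "U \<subseteq> R"
  proof
    fix x assume "x \<in> U"
    then have "x \<in> dmap G -` U" "x = rmap G x"
      using U(2) by (auto simp: rmap_unit dmap_unit)
    then show "x \<in> R"
      unfolding R_def by (rule rev_image_eqI)
  qed
  ultimately have "units G \<subseteq> R"
    using U by blast
  have "\<exists>W. W \<in> Ga \<and> x \<in> rmap G ` W \<and> dmap G ` W \<subseteq> U" if "x \<in> units G" for x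
  proof -
    have "x \<in> rmap G ` (dmap G -` U)"
      using that \<open>units G \<subseteq> R\<close> unfolding R_def by (rule rev_subsetD)
    then obtain g where g: "x = rmap G g" "g \<in> dmap G -` U" ..
    obtain W where "W \<in> Ga" "g \<in> W" "W \<subseteq> dmap G -` U"
      using oU g(2) by (rule exists_bisection)
    with g(1) show ?thesis by blast
  qed
  then obtain W where W: "\<And>x. x \<in> units G \<Longrightarrow> W x \<in> Ga \<and> x \<in> rmap G ` W x \<and> dmap G ` W x \<subseteq> U"
    by metis
  obtain I where "I \<subseteq> units G" "finite I" "units G \<subseteq> (\<Union>x\<in>I. rmap G ` W x)"
  proof (rule compactE_image[OF cu, of "units G" "\<lambda>x. rmap G ` W x"])
    show "open (rmap G ` W x)" if "x \<in> units G" for x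
      using W[OF that] Ga_open open_rmap_image by blast
    show "units G \<subseteq> (\<Union>x\<in>units G. rmap G ` W x)"
      using W by blast
  qed
  note I = this
  show ?thesis
  proof (intro exI[of _ "W ` I"] conjI ballI)
    show "W ` I \<subseteq> Ga" "\<And>V. V \<in> W ` I \<Longrightarrow> dmap G ` V \<subseteq> U"
      using W I(1) by (simp_all add: subset_iff image_iff) blast+
  qed (use I in simp_all)
qed

section \<open>An invariant state\<close>

text \<open>Non-negative combinations of the functions \<open>1\<^bsub>r(V)\<^esub> - 1\<^bsub>d(V)\<^esub>\<close>, on which an invariant functional
  has to vanish. They form a linear space because replacing \<open>V\<close> by its inverse changes the sign.\<close>

definition weighted :: "(real \<times> 'g set) list \<Rightarrow> bool" where
  "weighted ws \<longleftrightarrow> (\<forall>(c, V)\<in>set ws. c \<ge> 0 \<and> V \<in> Ga)"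

definition coboundary :: "(real \<times> 'g set) list \<Rightarrow> 'g \<Rightarrow> real" where
  "coboundary ws x = (\<Sum>(c, V)\<leftarrow>ws. c * (indicator (rmap G ` V) x - indicator (dmap G ` V) x))"

lemma weighted_append: "weighted ws \<Longrightarrow> weighted ws' \<Longrightarrow> weighted (ws @ ws')"
  by (auto simp: weighted_def)

lemma coboundary_append: "coboundary (ws @ ws') x = coboundary ws x + coboundary ws' x"
  by (simp add: coboundary_def)

lemma weighted_scale: "weighted ws \<Longrightarrow> c \<ge> 0 \<Longrightarrow> weighted (map (\<lambda>(a, V). (c * a, V)) ws)"
  by (auto simp: weighted_def)

lemma coboundary_scale: "coboundary (map (\<lambda>(a, V). (c * a, V)) ws) x = c * coboundary ws x"
  by (induction ws) (auto simp: coboundary_def algebra_simps)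

text \<open>Rounding the weights of a large multiple of a coboundary changes it by at most the number of
  terms, so a coboundary with positive lower bound would yield an integral one that is at least
  \<open>1\<close>.\<close>

lemma coboundary_not_bounded_below:
  assumes cu: "compact (units G)" and np: "\<And>N. N > 0 \<Longrightarrow> \<not> paradoxical G (Suc N) N (units G)"
    and ws: "weighted ws" and e: "e > 0"
  shows "\<exists>x\<in>units G. coboundary ws x < e"
proof (rule ccontr)
  assume "\<not> ?thesis"
  then have ge: "\<And>x. x \<in> units G \<Longrightarrow> e \<le> coboundary ws x" by force
  obtain M :: nat where M: "real (length ws) + 1 \<le> real M * e"
    using reals_Archimedean3[OF e] by (meson less_eq_real_def)
  define mult where "mult us = concat (map (\<lambda>(c, V). replicate (nat \<lfloor>real M * c\<rfloor>) V) us)"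
    for us :: "(real \<times> 'g set) list"
  have set_mult: "set (mult us) \<subseteq> Ga" if "weighted us" for us
    using that by (auto simp: mult_def weighted_def)
  have approx: "real M * coboundary us x - length us \<le> real (rcount G (mult us) x) - real (dcount G (mult us) x)"
    if "weighted us" for us x
    using that
  proof (induction us)
    case (Cons u us)
    obtain c V where u: "u = (c, V)" by (cases u)
    define \<delta> :: real where "\<delta> = indicator (rmap G ` V) x - indicator (dmap G ` V) x"
    define k where "k = nat \<lfloor>real M * c\<rfloor>"
    have "c \<ge> 0" using Cons.prems by (simp add: u weighted_def)
    then have "\<lfloor>real M * c\<rfloor> \<ge> 0" by simp
    then have "real k \<le> real M * c" "real M * c \<le> real k + 1"
      unfolding k_def by linarith+
    moreover have "\<delta> = -1 \<or> \<delta> = 0 \<or> \<delta> = 1"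
      by (auto simp: \<delta>_def indicator_def)
    ultimately have "real M * c * \<delta> - 1 \<le> real k * \<delta>"
      by auto
    moreover have "real (rcount G (mult (u # us)) x) - real (dcount G (mult (u # us)) x) =
        real k * \<delta> + (real (rcount G (mult us) x) - real (dcount G (mult us) x))"
      by (simp add: mult_def u k_def \<delta>_def map_replicate count_at_replicate indicator_def algebra_simps
          del: map_replicate_const)
    moreover have "coboundary (u # us) x = c * \<delta> + coboundary us x"
      by (simp add: coboundary_def u \<delta>_def)
    moreover have "weighted us"
      using Cons.prems by (simp add: weighted_def)
    then have "real M * coboundary us x - length us \<le>
        real (rcount G (mult us) x) - real (dcount G (mult us) x)"
      by (rule Cons.IH)
    ultimately show ?case
      by (simp add: algebra_simps)
  qed (simp add: mult_def coboundary_def)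
  have "1 + dcount G (mult ws) x \<le> rcount G (mult ws) x" if "x \<in> units G" for x
  proof -
    have "real M * e \<le> real M * coboundary ws x"
      by (intro mult_left_mono ge that) simp
    then have "1 \<le> real (rcount G (mult ws) x) - real (dcount G (mult ws) x)"
      using approx[OF ws, of x] M by linarith
    then show ?thesis by linarith
  qed
  from dominated_Suc_of_surplus[OF cu set_mult[OF ws] this]
  obtain N where "N > 0" "dominated G (\<lambda>_. Suc N) (\<lambda>_. N)"
    by blast
  then show False
    using paradoxical_if_dominated np by blast
qed

definition upper_bounds :: "'g operator \<Rightarrow> real set" where
  "upper_bounds T =
    {t. \<exists>ws. weighted ws \<and> (\<forall>x\<in>units G. Re (mcoeff T x x) \<le> t + coboundary ws x)}"

text \<open>The functional is constructed on the space of all bounded operators, where it depends only on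
  the diagonal coefficients at units: its sublinear majorant is the least upper bound of the
  diagonal modulo coboundaries. Absence of coboundaries with a positive lower bound makes the
  majorant finite.\<close>

lemma invariant_functional_exists:
  assumes cu: "compact (units G)" and np: "\<And>N. N > 0 \<Longrightarrow> \<not> paradoxical G (Suc N) N (units G)"
  shows "\<exists>\<phi> :: 'g operator \<Rightarrow> real. linear \<phi> \<and> (\<forall>T. \<bar>\<phi> T\<bar> \<le> norm T) \<and> \<phi> id_blinfun = 1 \<and>
    (\<forall>T. (\<forall>x\<in>units G. Re (mcoeff T x x) \<ge> 0) \<longrightarrow> \<phi> T \<ge> 0) \<and>
    (\<forall>V\<in>Ga. \<phi> (Lop G (rmap G ` V)) = \<phi> (Lop G (dmap G ` V)))"
proof -
  let ?S = upper_bounds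
  have lower: "- norm T \<le> t" if t: "t \<in> ?S T" for t T
  proof (rule field_le_epsilon)
    fix e :: real assume "e > 0"
    obtain ws where ws: "weighted ws" "\<And>x. x \<in> units G \<Longrightarrow> Re (mcoeff T x x) \<le> t + coboundary ws x"
      using t by (auto simp: upper_bounds_def)
    obtain x where x: "x \<in> units G" "coboundary ws x < e"
      using coboundary_not_bounded_below[OF cu np ws(1) \<open>e > 0\<close>] by blast
    have "- norm T \<le> Re (mcoeff T x x)"
      using cmod_mcoeff_le[of T x x] abs_Re_le_cmod[of "mcoeff T x x"] by linarith
    then show "- norm T \<le> t + e"
      using ws(2)[OF x(1)] x(2) by linarith
  qed
  then have bdd: "bdd_below (?S T)" for T
    by (rule bdd_belowI)
  have norm_in: "norm T \<in> ?S T" for T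
    unfolding upper_bounds_def
  proof (intro CollectI exI[of _ "[]"] conjI ballI)
    fix x
    show "Re (mcoeff T x x) \<le> norm T + coboundary [] x"
      using cmod_mcoeff_le[of T x x] abs_Re_le_cmod[of "mcoeff T x x"] by (simp add: coboundary_def)
  qed (simp add: weighted_def)
  define p where "p T = Inf (?S T)" for T
  have p_le: "p T \<le> t" if "t \<in> ?S T" for t T
    unfolding p_def by (rule cInf_lower[OF that bdd])
  have le_p: "a \<le> p T" if "\<And>t. t \<in> ?S T \<Longrightarrow> a \<le> t" for a T
    unfolding p_def by (rule cInf_greatest) (use norm_in that in auto)
  have "sublinear p"
    unfolding sublinear_def
  proof (intro conjI allI impI)
    fix T T'
    have *: "p (T + T') \<le> t + t'" if "t \<in> ?S T" "t' \<in> ?S T'" for t t'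
    proof (rule p_le)
      obtain ws ws' where ws: "weighted ws" "weighted ws'"
        "\<And>x. x \<in> units G \<Longrightarrow> Re (mcoeff T x x) \<le> t + coboundary ws x"
        "\<And>x. x \<in> units G \<Longrightarrow> Re (mcoeff T' x x) \<le> t' + coboundary ws' x"
        using \<open>t \<in> ?S T\<close> \<open>t' \<in> ?S T'\<close> unfolding upper_bounds_def by blast
      have "Re (mcoeff (T + T') x x) \<le> t + t' + coboundary (ws @ ws') x" if "x \<in> units G" for x
        using ws(3,4)[OF that] by (simp add: mcoeff_add coboundary_append)
      then show "t + t' \<in> ?S (T + T')"
        unfolding upper_bounds_def using weighted_append[OF ws(1,2)] by blast
    qed
    have "p (T + T') - t' \<le> p T" if "t' \<in> ?S T'" for t'
      by (rule le_p) (use *[OF _ that] in \<open>simp add: diff_le_eq\<close>)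
    then have "p (T + T') - p T \<le> p T'"
      by (intro le_p) (simp add: algebra_simps)
    then show "p (T + T') \<le> p T + p T'" by simp
  next
    fix c :: real and T assume c: "c > 0"
    have "p (c *\<^sub>R T) / c \<le> t" if t: "t \<in> ?S T" for t
    proof -
      obtain ws where ws: "weighted ws" "\<And>x. x \<in> units G \<Longrightarrow> Re (mcoeff T x x) \<le> t + coboundary ws x"
        using t unfolding upper_bounds_def by blast
      have "Re (mcoeff (c *\<^sub>R T) x x) \<le> c * t + coboundary (map (\<lambda>(a, V). (c * a, V)) ws) x"
        if "x \<in> units G" for x
        using mult_left_mono[OF ws(2)[OF that], of c] c
        by (simp add: mcoeff_scaleR coboundary_scale distrib_left)
      then have "c * t \<in> ?S (c *\<^sub>R T)"
        unfolding upper_bounds_def using weighted_scale[OF ws(1), of c] c by auto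
      from p_le[OF this] c show ?thesis
        by (simp add: field_simps)
    qed
    then have "p (c *\<^sub>R T) / c \<le> p T"
      by (rule le_p)
    with c show "p (c *\<^sub>R T) \<le> c * p T"
      by (simp add: field_simps)
  qed
  then obtain \<phi> where \<phi>: "linear \<phi>" "\<And>T. \<phi> T \<le> p T"
    using linear_below_sublinear by blast
  have \<phi>_le: "\<phi> T \<le> t" if "weighted ws" "\<And>x. x \<in> units G \<Longrightarrow> Re (mcoeff T x x) \<le> t + coboundary ws x" for T t ws
    using order_trans[OF \<phi>(2) p_le] that by (auto simp: upper_bounds_def)
  have \<phi>_le': "\<phi> T \<le> t" if "\<And>x. x \<in> units G \<Longrightarrow> Re (mcoeff T x x) \<le> t" for T t
    by (rule \<phi>_le[of "[]"]) (use that in \<open>auto simp: weighted_def coboundary_def\<close>)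
  have neg: "\<phi> (- T) = - \<phi> T" for T
    by (rule linear_neg[OF \<phi>(1)])
  have mneg: "mcoeff (- T) x x = - mcoeff T x x" for T x
    using mcoeff_diff[of 0 T x x] by (simp add: mcoeff_zero)
  have "\<phi> T \<le> norm T" for T
    by (rule order_trans[OF \<phi>(2) p_le[OF norm_in]])
  then have "\<bar>\<phi> T\<bar> \<le> norm T" for T
    using neg[of T] by (metis abs_le_iff norm_minus_cancel)
  moreover have "\<phi> T \<ge> 0" if "\<forall>x\<in>units G. Re (mcoeff T x x) \<ge> 0" for T
    using \<phi>_le'[of "- T" 0] that by (simp add: neg mneg)
  moreover have "\<phi> id_blinfun = 1"
    using \<phi>_le'[of id_blinfun 1] \<phi>_le'[of "- id_blinfun" "-1"] by (simp add: neg mneg mcoeff_id)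
  moreover have "\<phi> (Lop G (rmap G ` V)) = \<phi> (Lop G (dmap G ` V))" if V: "V \<in> Ga" for V
  proof -
    have le: "\<phi> (Lop G (rmap G ` W)) \<le> \<phi> (Lop G (dmap G ` W))" if W: "W \<in> Ga" for W
    proof -
      have "\<phi> (Lop G (rmap G ` W) - Lop G (dmap G ` W)) \<le> 0"
        by (rule \<phi>_le[of "[(1, W)]"])
          (use W in \<open>auto simp: weighted_def coboundary_def mcoeff_diff mcoeff_Lop_unit rmap_image_Ga
            dmap_image_Ga indicator_def\<close>)
      then show ?thesis
        by (simp add: linear_diff[OF \<phi>(1)])
    qed
    show ?thesis
      using le[OF V] le[OF ginv_image_Ga[OF V]] unfolding rmap_ginv_image dmap_ginv_image by simp
  qed
  ultimately show ?thesis
    using \<phi>(1) by blast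
qed

lemma linear_cscale_split:
  assumes "linear \<phi>"
  shows "\<phi> (cscale c T) = Re c * \<phi> T + Im c * \<phi> (cscale \<i> T)"
proof -
  have "cscale c T = cscale (of_real (Re c)) T + cscale (of_real (Im c) * \<i>) T"
    by (simp add: cscale_add_left[symmetric] mult.commute complex_eq[symmetric])
  also have "\<dots> = Re c *\<^sub>R T + Im c *\<^sub>R cscale \<i> T"
    by (simp add: cscale_of_real cscale_cscale[symmetric])
  finally show ?thesis
    using assms by (simp add: linear_add linear_scale)
qed

text \<open>The complexification \<open>\<tau>\<close> of the invariant functional is a trace: both \<open>L\<^sub>V L\<^sub>W\<close> and \<open>L\<^sub>W L\<^sub>V\<close> have a
  diagonal that is an indicator function, of \<open>r(B)\<close> and \<open>d(B)\<close> for the bisection \<open>B = V \<inter> W\<inverse>\<close>.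

  It is faithful because \<open>x \<mapsto> \<parallel>T e\<^sub>x\<parallel>\<^sup>2\<close>, the diagonal of \<open>T\<^sup>*T\<close>, is continuous. If it were
  non-zero at some unit, it would be bounded below on a compact open set \<open>U\<close>, and then \<open>U\<close> would
  have measure zero. Translates of \<open>U\<close> cover the unit space by minimality, so the whole unit space
  would have measure zero.\<close>

lemma faithful_trace_exists:
  assumes cu: "compact (units G)" and min: "minimal G"
    and np: "\<And>N. N > 0 \<Longrightarrow> \<not> paradoxical G (Suc N) N (units G)"
  shows "\<exists>\<tau>. tracial_state (closure steinberg) \<tau> \<and> faithful (closure steinberg) \<tau>"
proof -
  obtain \<phi> :: "'g operator \<Rightarrow> real" where \<phi>: "linear \<phi>" "\<And>T. \<bar>\<phi> T\<bar> \<le> norm T" "\<phi> id_blinfun = 1"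
    and pos: "\<And>T. (\<And>x. x \<in> units G \<Longrightarrow> Re (mcoeff T x x) \<ge> 0) \<Longrightarrow> \<phi> T \<ge> 0"
    and inv: "\<And>V. V \<in> Ga \<Longrightarrow> \<phi> (Lop G (rmap G ` V)) = \<phi> (Lop G (dmap G ` V))"
    using invariant_functional_exists[OF cu np] by blast
  have mono: "\<phi> S \<le> \<phi> T" if "\<And>x. x \<in> units G \<Longrightarrow> Re (mcoeff S x x) \<le> Re (mcoeff T x x)" for S T
    using pos[of "T - S"] that by (simp add: mcoeff_diff linear_diff[OF \<phi>(1)])
  have cong: "\<phi> S = \<phi> T" if "\<And>x. x \<in> units G \<Longrightarrow> Re (mcoeff S x x) = Re (mcoeff T x x)" for S T
    by (intro antisym mono) (simp_all add: that)
  define \<tau> where "\<tau> T = Complex (\<phi> T) (- \<phi> (cscale \<i> T))" for T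
  have \<tau>_cong: "\<tau> S = \<tau> T" if "\<And>x. x \<in> units G \<Longrightarrow> mcoeff S x x = mcoeff T x x" for S T
    unfolding \<tau>_def using that by (auto simp: mcoeff_cscale intro!: arg_cong2[where f = Complex] cong)
  have \<tau>_real: "\<tau> T = of_real (\<phi> T)" if "\<And>x. x \<in> units G \<Longrightarrow> mcoeff T x x \<in> \<real>" for T
  proof -
    have "\<phi> (cscale \<i> T) = \<phi> 0"
      by (rule cong) (use that in \<open>auto simp: mcoeff_cscale mcoeff_zero complex_is_Real_iff\<close>)
    then show ?thesis
      by (simp add: \<tau>_def linear_0[OF \<phi>(1)] complex_eq_iff)
  qed
  have \<tau>_add: "\<tau> (S + T) = \<tau> S + \<tau> T" for S T
    by (simp add: \<tau>_def cscale_add linear_add[OF \<phi>(1)] complex_eq_iff)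
  have \<tau>_cscale: "\<tau> (cscale c T) = c * \<tau> T" for c T
    using linear_cscale_split[OF \<phi>(1), of c T] linear_cscale_split[OF \<phi>(1), of "\<i> * c" T]
    by (simp add: \<tau>_def cscale_cscale complex_eq_iff)
  have bl: "bounded_linear \<phi>"
    by (rule bounded_linear_intro[where K = 1])
      (use \<phi>(1,2) in \<open>simp_all add: linear_add linear_scale\<close>)
  have \<tau>_cont: "continuous_on A (\<lambda>x. \<tau> (f x))" if "continuous_on A f" for A :: "'g operator set" and f
  proof -
    have "continuous_on A (\<lambda>x. complex_of_real (\<phi> (f x)) - \<i> * complex_of_real (\<phi> (cscale \<i> (f x))))"
      by (intro continuous_intros bounded_linear.continuous_on[OF bl]
          bounded_linear.continuous_on[OF bounded_linear_cscale] that)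
    then show ?thesis
      by (rule continuous_on_eq) (simp add: \<tau>_def complex_eq_iff)
  qed
  have trace_Lop: "\<tau> (Lop G V o\<^sub>L Lop G W) = \<tau> (Lop G W o\<^sub>L Lop G V)" if V: "V \<in> Ga" and W: "W \<in> Ga" for V W
  proof -
    define B where "B = V \<inter> ginv G ` W"
    have B: "B \<in> Ga"
      unfolding B_def using ginv_image_Ga[OF W] by (intro Ga_Int_clopen V) (auto simp: Ga_open Ga_closed)
    have VW: "x \<in> setprod G V W \<longleftrightarrow> x \<in> rmap G ` B" if "x \<in> units G" for x
    proof
      assume "x \<in> setprod G V W"
      then obtain v w where vw: "x = mul G v w" "v \<in> V" "w \<in> W" "dmap G v = rmap G w"
        by (auto simp: setprod_def)
      with that have "w = ginv G v"
        using mul_in_units_iff by blast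
      with vw have "v \<in> B" "x = rmap G v"
        by (auto simp: B_def ginv_image_eq_vimage)
      then show "x \<in> rmap G ` B" by blast
    next
      assume "x \<in> rmap G ` B"
      then obtain v where "v \<in> V" "ginv G v \<in> W" "x = mul G v (ginv G v)"
        by (auto simp: B_def ginv_image_eq_vimage)
      then show "x \<in> setprod G V W"
        unfolding setprod_def by force
    qed
    have WV: "x \<in> setprod G W V \<longleftrightarrow> x \<in> dmap G ` B" if "x \<in> units G" for x
    proof
      assume "x \<in> setprod G W V"
      then obtain v w where vw: "x = mul G w v" "v \<in> V" "w \<in> W" "dmap G w = rmap G v"
        by (auto simp: setprod_def)
      with that have "v = ginv G w"
        using mul_in_units_iff by blast
      then have w: "w = ginv G v" by (simp add: ginv_ginv)
      with vw have "v \<in> B" "x = dmap G v"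
        by (auto simp: B_def ginv_image_eq_vimage)
      then show "x \<in> dmap G ` B" by blast
    next
      assume "x \<in> dmap G ` B"
      then obtain v where "v \<in> V" "ginv G v \<in> W" "x = mul G (ginv G v) v"
        by (auto simp: B_def ginv_image_eq_vimage)
      then show "x \<in> setprod G W V"
        unfolding setprod_def by force
    qed
    have "\<tau> (Lop G V o\<^sub>L Lop G W) = \<tau> (Lop G (rmap G ` B))"
      by (rule \<tau>_cong) (simp add: Lop_compose V W mcoeff_Lop_unit setprod_Ga rmap_image_Ga B VW indicator_def)
    also have "\<dots> = of_real (\<phi> (Lop G (rmap G ` B)))"
      by (rule \<tau>_real) (simp add: mcoeff_Lop_unit rmap_image_Ga B indicator_def)
    also have "\<dots> = of_real (\<phi> (Lop G (dmap G ` B)))"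
      by (simp add: inv B)
    also have "\<dots> = \<tau> (Lop G (dmap G ` B))"
      by (rule \<tau>_real[symmetric]) (simp add: mcoeff_Lop_unit dmap_image_Ga B indicator_def)
    also have "\<dots> = \<tau> (Lop G W o\<^sub>L Lop G V)"
      by (rule \<tau>_cong) (simp add: Lop_compose V W mcoeff_Lop_unit setprod_Ga dmap_image_Ga B WV indicator_def)
    finally show ?thesis .
  qed
  have \<tau>_0: "\<tau> 0 = 0"
    using \<tau>_add[of 0 0] by simp
  have trace_steinberg_Lop: "\<tau> (S o\<^sub>L Lop G W) = \<tau> (Lop G W o\<^sub>L S)" if "S \<in> steinberg" "W \<in> Ga" for S W
    using that
    by (induction rule: steinberg.induct)
      (simp_all add: \<tau>_0 compose_add_left
        compose_add_right \<tau>_add cscale_compose_left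
        cscale_compose_right complex_linear_Lop \<tau>_cscale trace_Lop)
  have trace_steinberg: "\<tau> (S o\<^sub>L T) = \<tau> (T o\<^sub>L S)" if "T \<in> steinberg" "S \<in> steinberg" for S T
    using that
    by (induction rule: steinberg.induct)
      (simp_all add: \<tau>_0 compose_add_left
        compose_add_right \<tau>_add cscale_compose_left
        cscale_compose_right steinberg_complex_linear \<tau>_cscale trace_steinberg_Lop)
  have closed_trace: "closed {T. \<tau> (S o\<^sub>L T) = \<tau> (T o\<^sub>L S)}" for S
    by (intro closed_Collect_eq \<tau>_cont continuous_intros)
  have trace1: "\<tau> (S o\<^sub>L T) = \<tau> (T o\<^sub>L S)" if "S \<in> steinberg" "T \<in> closure steinberg" for S T
    using closure_minimal[OF _ closed_trace[of S], of steinberg] trace_steinberg that by blast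
  have trace: "\<tau> (S o\<^sub>L T) = \<tau> (T o\<^sub>L S)" if "S \<in> closure steinberg" "T \<in> closure steinberg" for S T
  proof -
    have "steinberg \<subseteq> {S. \<tau> (T o\<^sub>L S) = \<tau> (S o\<^sub>L T)}"
      using trace1 that(2) by fastforce
    from closure_minimal[OF this closed_trace] that(1) show ?thesis by auto
  qed
  have diag: "mcoeff (adj T o\<^sub>L T) x x = of_real ((norm (blinfun_apply T (ket x)))\<^sup>2)" if "T \<in> closure steinberg" for T x
    by (rule mcoeff_adj_compose_self[OF closure_steinberg_complex_linear[OF that]])
  have \<tau>_sq: "\<tau> (adj T o\<^sub>L T) = of_real (\<phi> (adj T o\<^sub>L T))" if "T \<in> closure steinberg" for T
    by (rule \<tau>_real) (unfold diag[OF that], rule Reals_of_real)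
  have "tracial_state (closure steinberg) \<tau>"
    unfolding tracial_state_def
  proof (intro conjI ballI allI)
    show "\<tau> (adj T o\<^sub>L T) \<in> \<real>\<^sub>\<ge>\<^sub>0" if "T \<in> closure steinberg" for T
      unfolding \<tau>_sq[OF that] nonneg_Reals_of_real_iff by (rule pos) (simp add: diag[OF that])
    show "\<tau> id_blinfun = 1"
      by (subst \<tau>_real) (simp_all add: mcoeff_id \<phi>(3))
  qed (simp_all add: \<tau>_add \<tau>_cscale trace)
  moreover have "faithful (closure steinberg) \<tau>"
    unfolding faithful_def
  proof (intro ballI impI)
    fix T assume T: "T \<in> closure steinberg" and "\<tau> (adj T o\<^sub>L T) = 0"
    then have \<phi>0: "\<phi> (adj T o\<^sub>L T) = 0"
      by (simp add: \<tau>_sq)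
    have vanish: "blinfun_apply T (ket x) = 0" if x: "x \<in> units G" for x
    proof (rule ccontr)
      assume "blinfun_apply T (ket x) \<noteq> 0"
      define D where "D y = (norm (blinfun_apply T (ket y)))\<^sup>2" for y
      define \<delta> where "\<delta> = D x / 2"
      have \<delta>: "\<delta> > 0"
        using \<open>blinfun_apply T (ket x) \<noteq> 0\<close> by (simp add: \<delta>_def D_def)
      have "adj T o\<^sub>L T \<in> closure steinberg"
        by (intro closure_steinberg_compose closure_steinberg_adj T)
      from continuous_on_Re[OF continuous_on_diagonal[OF this]]
      have "continuous_on (units G) D"
        by (simp add: diag[OF T] D_def[abs_def])
      then have "open (D -` {\<delta><..} \<inter> units G)"
        by (rule continuous_on_open_vimage[OF open_units, THEN iffD1, rule_format,
              OF _ open_greaterThan])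
      moreover have "x \<in> D -` {\<delta><..} \<inter> units G"
        using \<delta> x by (simp add: \<delta>_def)
      ultimately obtain U where U: "U \<in> Ga" "x \<in> U" "U \<subseteq> D -` {\<delta><..} \<inter> units G"
        by (rule exists_bisection)
      have "\<phi> (\<delta> *\<^sub>R Lop G U) \<le> \<phi> (adj T o\<^sub>L T)"
        using U \<delta>
        by (intro mono)
          (auto simp: mcoeff_scaleR mcoeff_Lop_unit diag[OF T] indicator_def D_def subset_iff less_imp_le)
      then have \<phi>U: "\<phi> (Lop G U) \<le> 0"
        using \<delta> by (simp add: linear_scale[OF \<phi>(1)] \<phi>0 mult_le_0_iff)
      obtain F where F: "finite F" "F \<subseteq> Ga" "\<And>W. W \<in> F \<Longrightarrow> dmap G ` W \<subseteq> U"
        "units G \<subseteq> (\<Union>W\<in>F. rmap G ` W)"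
      proof -
        have "open U" "U \<subseteq> units G" "U \<noteq> {}"
          using U(1) by (simp add: Ga_open, use U(2,3) in blast, use U(2) in blast)
        from minimal_cover[OF cu min this] show thesis
          using that by metis
      qed
      have msum: "mcoeff (\<Sum>W\<in>F. f W) y y = (\<Sum>W\<in>F. mcoeff (f W) y y)" for f :: "'g set \<Rightarrow> 'g operator" and y
        by (induction F rule: infinite_finite_induct) (simp_all add: mcoeff_zero mcoeff_add)
      have "\<phi> id_blinfun \<le> \<phi> (\<Sum>W\<in>F. Lop G (rmap G ` W))"
      proof (rule mono)
        fix y assume y: "y \<in> units G"
        then obtain W where W: "W \<in> F" "y \<in> rmap G ` W"
          using F(4) by blast
        have "mcoeff (\<Sum>W\<in>F. Lop G (rmap G ` W)) y y = (\<Sum>W\<in>F. indicator (rmap G ` W) y)"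
          unfolding msum by (rule sum.cong[OF refl]) (use F(2) y in \<open>auto simp: mcoeff_Lop_unit rmap_image_Ga\<close>)
        also have "\<dots> = of_real (\<Sum>W\<in>F. indicator (rmap G ` W) y)"
          unfolding of_real_sum by (rule sum.cong[OF refl]) (simp add: indicator_def)
        finally have "Re (mcoeff (\<Sum>W\<in>F. Lop G (rmap G ` W)) y y) = (\<Sum>W\<in>F. indicator (rmap G ` W) y)"
          by simp
        moreover have "(indicator (rmap G ` W) y :: real) \<le> (\<Sum>W\<in>F. indicator (rmap G ` W) y)"
          by (rule member_le_sum) (use W F in auto)
        ultimately show "Re (mcoeff id_blinfun y y) \<le> Re (mcoeff (\<Sum>W\<in>F. Lop G (rmap G ` W)) y y)"
          using W(2) by (simp add: mcoeff_id)
      qed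
      also have "\<dots> = (\<Sum>W\<in>F. \<phi> (Lop G (rmap G ` W)))"
        by (rule linear_sum[OF \<phi>(1)])
      also have "\<dots> = (\<Sum>W\<in>F. \<phi> (Lop G (dmap G ` W)))"
        using F(2) by (intro sum.cong inv) auto
      also have "\<dots> \<le> (\<Sum>W\<in>F. \<phi> (Lop G U))"
      proof (intro sum_mono mono)
        fix W y assume W: "W \<in> F" and y: "y \<in> units G"
        have "dmap G ` W \<in> Ga"
          using W F(2) dmap_image_Ga by blast
        then show "Re (mcoeff (Lop G (dmap G ` W)) y y) \<le> Re (mcoeff (Lop G U) y y)"
          using F(3)[OF W] U(1) y by (auto simp: mcoeff_Lop_unit indicator_def)
      qed
      also have "\<dots> \<le> 0"
        using \<phi>U by (intro sum_nonpos) simp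
      finally show False
        by (simp add: \<phi>(3))
    qed
    show "T = 0"
    proof (rule complex_linear_eqI)
      show "mcoeff T h g = mcoeff 0 h g" for h g
        using mcoeff_translate[OF T, of h g] vanish[of "rmap G g"]
        by (simp add: mcoeff_def coord_zero)
    qed (simp_all add: closure_steinberg_complex_linear T complex_linear_zero)
  qed
  ultimately show ?thesis by blast
qed

end

section \<open>Matrices over an operator algebra\<close>

definition unital_star_algebra :: "'a operator set \<Rightarrow> bool" where
  "unital_star_algebra A \<longleftrightarrow> id_blinfun \<in> A \<and> (\<forall>S\<in>A. \<forall>T\<in>A. S + T \<in> A \<and> S o\<^sub>L T \<in> A) \<and>
    (\<forall>c. \<forall>T\<in>A. cscale c T \<in> A) \<and> (\<forall>T\<in>A. adj T \<in> A \<and> complex_linear T)"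

lemma adj_compose: "complex_linear S \<Longrightarrow> complex_linear T \<Longrightarrow> adj (S o\<^sub>L T) = adj T o\<^sub>L adj S"
  by (rule adj_eqI) (simp add: cinner_adj)

lemma compose_assoc: "(S o\<^sub>L T) o\<^sub>L R = S o\<^sub>L (T o\<^sub>L R)"
  by (rule blinfun_eqI) simp

lemma id_blinfun_neq_0: "(id_blinfun :: 'a operator) \<noteq> 0"
  using mcoeff_id[of "undefined :: 'a" undefined] mcoeff_zero[of undefined "undefined :: 'a"] by force

lemma mat_mul_assoc: "mat_mul n (mat_mul n a b) c = mat_mul n a (mat_mul n b c)"
  unfolding mat_mul_def compose_sum_left compose_sum_right compose_assoc
  by (intro ext) (rule sum.swap)

lemma mat_mul_one_left: "a \<in> matrices n A \<Longrightarrow> mat_mul n (mat_one n) a = a"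
proof (intro ext)
  fix i j assume a: "a \<in> matrices n A"
  have "mat_mul n (mat_one n) a i j = (\<Sum>k<n. if k = i then (if i < n then a i j else 0) else 0)"
    unfolding mat_mul_def mat_one_def by (intro sum.cong refl) auto
  then show "mat_mul n (mat_one n) a i j = a i j"
    using a by (auto simp: matrices_def)
qed

context
  fixes A :: "'a operator set"
  assumes A: "unital_star_algebra A"
begin

lemma star_algebra_closed:
  "id_blinfun \<in> A" "S \<in> A \<Longrightarrow> T \<in> A \<Longrightarrow> S + T \<in> A" "S \<in> A \<Longrightarrow> T \<in> A \<Longrightarrow> S o\<^sub>L T \<in> A"
  "T \<in> A \<Longrightarrow> cscale c T \<in> A" "T \<in> A \<Longrightarrow> adj T \<in> A" "T \<in> A \<Longrightarrow> complex_linear T"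
  using A by (auto simp: unital_star_algebra_def)

lemma star_algebra_zero: "0 \<in> A"
proof -
  have "cscale 0 id_blinfun = (0 :: 'a operator)"
    using cscale_of_real[of 0 "id_blinfun :: 'a operator"] by simp
  then show ?thesis
    using star_algebra_closed(4)[OF star_algebra_closed(1), of 0] by simp
qed

lemma star_algebra_diff: "S \<in> A \<Longrightarrow> T \<in> A \<Longrightarrow> S - T \<in> A"
proof -
  assume "S \<in> A" "T \<in> A"
  moreover have "cscale (-1) T = - T"
    using cscale_of_real[of "-1" T] by simp
  ultimately show "S - T \<in> A"
    using star_algebra_closed(2)[of S "cscale (-1) T"] star_algebra_closed(4)[of T "-1"] by simp
qed

lemma star_algebra_sum: "(\<And>i. i \<in> I \<Longrightarrow> f i \<in> A) \<Longrightarrow> (\<Sum>i\<in>I. f i) \<in> A"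
  by (induction I rule: infinite_finite_induct) (auto simp: star_algebra_zero star_algebra_closed)

lemma matrices_in: "a \<in> matrices n A \<Longrightarrow> a i j \<in> A"
  using star_algebra_zero by (cases "i < n \<and> j < n") (auto simp: matrices_def)

lemma matrices_outside: "a \<in> matrices n A \<Longrightarrow> \<not> (i < n \<and> j < n) \<Longrightarrow> a i j = 0"
  by (auto simp: matrices_def)

lemma mat_mul_in: "a \<in> matrices n A \<Longrightarrow> b \<in> matrices n A \<Longrightarrow> mat_mul n a b \<in> matrices n A"
proof -
  assume ab: "a \<in> matrices n A" "b \<in> matrices n A"
  have "mat_mul n a b i j \<in> A" for i j
    unfolding mat_mul_def
    by (intro star_algebra_sum star_algebra_closed matrices_in[OF ab(1)] matrices_in[OF ab(2)])
  moreover have "mat_mul n a b i j = 0" if "\<not> (i < n \<and> j < n)" for i j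
    unfolding mat_mul_def
    by (rule sum.neutral) (use that matrices_outside[OF ab(1), of i] matrices_outside[OF ab(2), of _ j] in auto)
  ultimately show ?thesis
    by (auto simp: matrices_def)
qed

lemma mat_adj_in: "a \<in> matrices n A \<Longrightarrow> mat_adj a \<in> matrices n A"
  by (auto simp: matrices_def mat_adj_def star_algebra_closed adj_zero)

lemma mat_one_in: "mat_one n \<in> matrices n A"
  by (auto simp: matrices_def mat_one_def star_algebra_closed star_algebra_zero)

lemma mat_adj_mul:
  assumes a: "a \<in> matrices n A" and b: "b \<in> matrices n A"
  shows "mat_adj (mat_mul n a b) = mat_mul n (mat_adj b) (mat_adj a)"
proof (intro ext)
  fix i j
  have cl: "complex_linear (a i j)" "complex_linear (b i j)" for i j
    by (intro star_algebra_closed matrices_in[OF a] matrices_in[OF b])+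
  have "adj (\<Sum>k<n. a j k o\<^sub>L b k i) = (\<Sum>k<n. adj (a j k o\<^sub>L b k i))"
    by (intro adj_sum[THEN conjunct1] complex_linear_compose cl)
  then show "mat_adj (mat_mul n a b) i j = mat_mul n (mat_adj b) (mat_adj a) i j"
    by (simp add: mat_adj_def mat_mul_def adj_compose cl)
qed

lemma mat_adj_adj: "a \<in> matrices n A \<Longrightarrow> mat_adj (mat_adj a) = a"
  unfolding mat_adj_def by (intro ext) (simp add: adj_adj star_algebra_closed matrices_in)

lemma not_stably_finite_if_isometry:
  assumes n: "n \<ge> 1" and v: "v \<in> matrices n A" and vv: "mat_mul n (mat_adj v) v = mat_one n"
    and neq: "mat_mul n v (mat_adj v) \<noteq> mat_one n"
  shows "\<not> stably_finite A"
proof -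
  let ?q = "mat_mul n v (mat_adj v)"
  have q: "?q \<in> matrices n A"
    by (intro mat_mul_in mat_adj_in v)
  have "mat_mul n ?q ?q = mat_mul n v (mat_mul n (mat_mul n (mat_adj v) v) (mat_adj v))"
    by (simp add: mat_mul_assoc)
  then have qq: "mat_mul n ?q ?q = ?q"
    by (simp add: vv mat_mul_one_left[OF mat_adj_in[OF v]])
  have "mat_adj ?q = ?q"
    by (simp add: mat_adj_mul[OF v mat_adj_in[OF v]] mat_adj_adj[OF v])
  moreover have "mat_adj (mat_one n) = (mat_one n :: 'a op_matrix)"
    by (auto simp: mat_adj_def mat_one_def adj_id adj_zero fun_eq_iff)
  ultimately have "proper_subprojection n A ?q (mat_one n)"
    unfolding proper_subprojection_def mat_projection_def
    using q qq neq mat_one_in mat_mul_one_left[OF q] mat_mul_one_left[OF mat_one_in] by simp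
  moreover have "murray_von_neumann_equiv n A (mat_one n) ?q"
    unfolding murray_von_neumann_equiv_def using v vv by blast
  ultimately show ?thesis
    using n unfolding stably_finite_def by blast
qed

text \<open>The trace extends to matrices by summing over the diagonal. It takes the same value \<open>n\<close> on
  \<open>v\<^sup>*v = 1\<close> and \<open>vv\<^sup>* = q\<close>, so it vanishes on the projection \<open>1 - q\<close>, and faithfulness kills all
  entries of \<open>1 - q\<close>.\<close>

lemma stably_finite_if_faithful_trace:
  assumes \<tau>: "tracial_state A \<tau>" and faith: "faithful A \<tau>"
  shows "stably_finite A"
  unfolding stably_finite_def
proof (intro allI impI notI, elim exE conjE)
  fix n :: nat and q assume "n \<ge> 1" and sub: "proper_subprojection n A q (mat_one n)"
    and "murray_von_neumann_equiv n A (mat_one n) q"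
  then obtain v where v: "v \<in> matrices n A" "mat_mul n (mat_adj v) v = mat_one n"
    "mat_mul n v (mat_adj v) = q"
    unfolding murray_von_neumann_equiv_def by blast
  have q: "q \<in> matrices n A" "mat_mul n q q = q" "mat_adj q = q" "q \<noteq> mat_one n"
    using sub by (auto simp: proper_subprojection_def mat_projection_def)
  note mem = star_algebra_closed star_algebra_diff star_algebra_zero
  have \<tau>_add: "\<tau> (S + T) = \<tau> S + \<tau> T" and \<tau>_trace: "\<tau> (S o\<^sub>L T) = \<tau> (T o\<^sub>L S)"
    if "S \<in> A" "T \<in> A" for S T
    using \<tau> that unfolding tracial_state_def by blast+
  have \<tau>_pos: "\<tau> (adj T o\<^sub>L T) \<in> \<real>\<^sub>\<ge>\<^sub>0" if "T \<in> A" for T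
    using \<tau> that unfolding tracial_state_def by blast
  have \<tau>_id: "\<tau> id_blinfun = 1"
    using \<tau> unfolding tracial_state_def by blast
  have \<tau>_0: "\<tau> 0 = 0"
    using \<tau>_add[of 0 0] mem by simp
  have \<tau>_sum: "\<tau> (\<Sum>i\<in>I. f i) = (\<Sum>i\<in>I. \<tau> (f i))" if "\<And>i. i \<in> I \<Longrightarrow> f i \<in> A" for f and I :: "nat set"
    using that
    by (induction I rule: infinite_finite_induct) (simp_all add: \<tau>_0 \<tau>_add star_algebra_sum)
  have \<tau>_diff: "\<tau> (S - T) = \<tau> S - \<tau> T" if "S \<in> A" "T \<in> A" for S T
    using \<tau>_add[of "S - T" T] that mem by simp
  have vA: "v i j \<in> A" for i j by (rule matrices_in[OF v(1)])
  have qA: "q i j \<in> A" for i j by (rule matrices_in[OF q(1)])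
  have tr_q: "(\<Sum>i<n. \<tau> (q i i)) = of_nat n"
  proof -
    have "(\<Sum>i<n. \<tau> (q i i)) = (\<Sum>i<n. \<Sum>k<n. \<tau> (v i k o\<^sub>L adj (v i k)))"
      unfolding v(3)[symmetric] mat_mul_def mat_adj_def
      by (intro sum.cong refl \<tau>_sum) (auto intro: mem vA)
    also have "\<dots> = (\<Sum>i<n. \<Sum>k<n. \<tau> (adj (v i k) o\<^sub>L v i k))"
      by (intro sum.cong refl \<tau>_trace) (auto intro: mem vA)
    also have "\<dots> = (\<Sum>k<n. \<Sum>i<n. \<tau> (adj (v i k) o\<^sub>L v i k))"
      by (rule sum.swap)
    also have "\<dots> = (\<Sum>k<n. \<tau> (mat_mul n (mat_adj v) v k k))"
      unfolding mat_mul_def mat_adj_def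
      by (intro sum.cong refl \<tau>_sum[symmetric]) (auto intro: mem vA)
    also have "\<dots> = of_nat n"
      by (simp add: v(2) mat_one_def \<tau>_id)
    finally show ?thesis .
  qed
  define p where "p k i = mat_one n k i - q k i" for k i
  have pA: "p k i \<in> A" for k i
    unfolding p_def by (intro mem qA matrices_in[OF mat_one_in])
  have adj_q: "adj (q k i) = q i k" for k i
    using fun_cong[OF fun_cong[OF q(3), of i], of k] by (simp add: mat_adj_def)
  (* A diagonal entry of the idempotent law for the self-adjoint matrix p = 1 - q. *)
  have col: "(\<Sum>k<n. adj (p k i) o\<^sub>L p k i) = id_blinfun - q i i" if i: "i < n" for i
  proof -
    have "adj (p k i) o\<^sub>L p k i =
        (if k = i then id_blinfun - q i i - q i i else 0) + (q i k o\<^sub>L q k i)" if "k < n" for k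
      using i that
      by (simp add: p_def mat_one_def adj_diff adj_id adj_zero adj_q mem qA complex_linear_id
          complex_linear_zero compose_diff_left compose_diff_right)
    then have "(\<Sum>k<n. adj (p k i) o\<^sub>L p k i) =
        (\<Sum>k<n. (if k = i then id_blinfun - q i i - q i i else 0) + (q i k o\<^sub>L q k i))"
      by (intro sum.cong) auto
    also have "\<dots> = id_blinfun - q i i - q i i + mat_mul n q q i i"
      using i by (simp add: sum.distrib mat_mul_def)
    finally show ?thesis
      by (simp add: q(2))
  qed
  define r where "r k i = Re (\<tau> (adj (p k i) o\<^sub>L p k i))" for k i
  have r: "r k i \<ge> 0" "\<tau> (adj (p k i) o\<^sub>L p k i) = of_real (r k i)" for k i
    using \<tau>_pos[OF pA[of k i]] by (auto simp: r_def nonneg_Reals_def)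
  have "complex_of_real (\<Sum>i<n. \<Sum>k<n. r k i) = (\<Sum>i<n. \<tau> (\<Sum>k<n. adj (p k i) o\<^sub>L p k i))"
    by (simp add: r(2)[symmetric] \<tau>_sum mem pA)
  also have "\<dots> = (\<Sum>i<n. 1 - \<tau> (q i i))"
    by (intro sum.cong) (auto simp: col \<tau>_diff mem qA \<tau>_id)
  also have "\<dots> = 0"
    by (simp add: sum_subtractf tr_q)
  finally have "(\<Sum>i<n. \<Sum>k<n. r k i) = 0"
    by (simp only: of_real_eq_0_iff)
  then have "r k i = 0" if "k < n" "i < n" for k i
    using that r(1) by (simp add: sum_nonneg_eq_0_iff sum_nonneg)
  then have "p k i = 0" if "k < n" "i < n" for k i
    using faith pA[of k i] r(2)[of k i] that by (simp add: faithful_def)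
  then have "q k i = mat_one n k i" for k i
    using matrices_outside[OF q(1), of k i] matrices_outside[OF mat_one_in, of k n i]
    by (cases "k < n \<and> i < n") (auto simp: p_def)
  with q(4) show False
    by (auto simp: fun_eq_iff)
qed

end

section \<open>Traces, isometries and paradoxical decompositions\<close>

context ample_groupoid
begin

lemma unital_star_algebra_closure_steinberg:
  assumes "compact (units G)" shows "unital_star_algebra (closure steinberg)"
proof -
  have "units G \<in> Ga"
    by (rule units_subset_in_Ga[OF assms open_units]) simp
  then have "id_blinfun \<in> closure steinberg"
    using steinberg_Lop Lop_units[OF assms] closure_subset by fastforce
  then show ?thesis
    by (simp add: unital_star_algebra_def closure_steinberg_add closure_steinberg_compose closure_steinberg_cscale
        closure_steinberg_adj closure_steinberg_complex_linear)
qed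

lemma paradoxicalE:
  assumes "paradoxical G k l A"
  obtains n :: "nat \<Rightarrow> nat" and V m where
    "\<forall>i\<in>{1..k}. \<forall>j\<in>{1..n i}. V i j \<in> Ga \<and> m i j \<in> {1..l} \<and>
        (rmap G ` V i j) \<times> {m i j} \<subseteq> A \<times> {1..l}"
    "\<forall>i\<in>{1..k}. (\<Union>j\<in>{1..n i}. dmap G ` V i j) = A"
    "disjoint_family_on (\<lambda>(i, j). (rmap G ` V i j) \<times> {m i j}) (SIGMA i:{1..k}. {1..n i})"
proof -
  show thesis
    using assms unfolding paradoxical_def
  proof (elim conjE exE)
    fix n :: "nat \<Rightarrow> nat" and V m
    assume "\<forall>i\<in>{1..k}. \<forall>j\<in>{1..n i}. V i j \<in> Ga \<and> m i j \<in> {1..l} \<and>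
        (rmap G ` V i j) \<times> {m i j} \<subseteq> A \<times> {1..l}"
      "\<forall>i\<in>{1..k}. (\<Union>j\<in>{1..n i}. dmap G ` V i j) = A"
      "disjoint_family_on (\<lambda>(i, j). (rmap G ` V i j) \<times> {m i j}) (SIGMA i:{1..k}. {1..n i})"
    then show thesis
      by (rule that[of n V m])
  qed
qed

lemma setprod_ginv_left:
  assumes "V \<in> Ga" shows "setprod G (ginv G ` V) V = dmap G ` V"
proof (intro set_eqI iffI)
  fix x assume "x \<in> setprod G (ginv G ` V) V"
  then obtain v w where vw: "v \<in> V" "w \<in> V" "rmap G v = rmap G w" "x = mul G (ginv G v) w"
    by (auto simp: setprod_def)
  then have "v = w"
    using inj_onD[OF Ga_inj_rmap[OF assms]] by blast
  with vw show "x \<in> dmap G ` V" by simp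
next
  fix x assume "x \<in> dmap G ` V"
  then obtain v where "v \<in> V" "x = mul G (ginv G v) v" by auto
  then show "x \<in> setprod G (ginv G ` V) V"
    unfolding setprod_def by force
qed

lemma setprod_ginv_right:
  assumes "V \<in> Ga" shows "setprod G V (ginv G ` V) = rmap G ` V"
proof -
  have "ginv G ` ginv G ` V = V"
    by (simp add: image_image ginv_ginv)
  with setprod_ginv_left[OF ginv_image_Ga[OF assms]] show ?thesis
    by (simp add: dmap_ginv_image)
qed

lemma setprod_ginv_disjoint:
  "rmap G ` V \<inter> rmap G ` W = {} \<Longrightarrow> setprod G (ginv G ` V) W = {}"
  by (auto simp: setprod_def)

lemma adj_Lop_compose_Lop: "V \<in> Ga \<Longrightarrow> adj (Lop G V) o\<^sub>L Lop G V = Lop G (dmap G ` V)"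
  and Lop_compose_adj_Lop: "V \<in> Ga \<Longrightarrow> Lop G V o\<^sub>L adj (Lop G V) = Lop G (rmap G ` V)"
  by (simp_all add: adj_Lop Lop_compose ginv_image_Ga setprod_ginv_left setprod_ginv_right)

lemma adj_Lop_compose_Lop_disjoint:
  "V \<in> Ga \<Longrightarrow> W \<in> Ga \<Longrightarrow> rmap G ` V \<inter> rmap G ` W = {} \<Longrightarrow> adj (Lop G V) o\<^sub>L Lop G W = 0"
  by (simp add: adj_Lop Lop_compose ginv_image_Ga setprod_ginv_disjoint Lop_empty)

lemma finite_Union_Ga:
  assumes "finite I" "\<And>i. i \<in> I \<Longrightarrow> B i \<in> Ga \<and> B i \<subseteq> units G"
  shows "(\<Union>i\<in>I. B i) \<in> Ga"
  by (rule units_subset_in_Ga) (use assms in \<open>auto intro!: compact_UN simp: Ga_compact Ga_open\<close>)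

lemma Lop_disjoint_Union:
  assumes "finite I" "\<And>i. i \<in> I \<Longrightarrow> B i \<in> Ga \<and> B i \<subseteq> units G" "disjoint_family_on B I"
  shows "Lop G (\<Union>i\<in>I. B i) = (\<Sum>i\<in>I. Lop G (B i))"
  using assms
proof (induction I rule: finite_induct)
  case (insert i I)
  have U: "(\<Union>i\<in>I. B i) \<in> Ga" "(\<Union>i\<in>insert i I. B i) \<in> Ga"
    by (intro finite_Union_Ga; use insert in auto)+
  have "B i \<inter> (\<Union>i\<in>I. B i) = {}"
    using insert.prems(2) insert.hyps(2) by (auto simp: disjoint_family_on_def)
  with U have "Lop G (\<Union>i\<in>insert i I. B i) = Lop G (B i) + Lop G (\<Union>i\<in>I. B i)"
    using insert.prems(1) by (simp add: Lop_Un)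
  moreover have "disjoint_family_on B I"
    using insert.prems(2) by (auto simp: disjoint_family_on_def)
  ultimately show ?case
    using insert by simp
qed (simp add: Lop_empty)

text \<open>A trace gives the clopen subsets of the unit space an additive measure, and the trace property
  makes it invariant: \<open>L\<^sub>V\<^sup>* L\<^sub>V\<close> and \<open>L\<^sub>V L\<^sub>V\<^sup>*\<close> are the operators of \<open>d(V)\<close> and \<open>r(V)\<close>. Fitting \<open>k\<close> copies
  of \<open>A\<close> into \<open>l < k\<close> copies would give \<open>A\<close> measure zero, against faithfulness.\<close>

lemma nonparadoxical_if_faithful_trace:
  assumes cu: "compact (units G)"
    and \<tau>: "tracial_state (closure steinberg) \<tau>" and faith: "faithful (closure steinberg) \<tau>"
    and A: "A \<in> Ga"
  shows "completely_nonparadoxical G A"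
  unfolding completely_nonparadoxical_def
proof (intro allI impI notI, elim conjE)
  fix k l :: nat assume lk: "l < k" and par: "paradoxical G k l A"
  have Au: "A \<subseteq> units G" "A \<noteq> {}"
    using par by (auto simp: paradoxical_def)
  obtain n :: "nat \<Rightarrow> nat" and V m where par':
      "\<forall>i\<in>{1..k}. \<forall>j\<in>{1..n i}. V i j \<in> Ga \<and> m i j \<in> {1..l} \<and>
        (rmap G ` V i j) \<times> {m i j} \<subseteq> A \<times> {1..l}"
      "\<forall>i\<in>{1..k}. (\<Union>j\<in>{1..n i}. dmap G ` V i j) = A"
    and disj: "disjoint_family_on (\<lambda>(i, j). (rmap G ` V i j) \<times> {m i j}) (SIGMA i:{1..k}. {1..n i})"
    by (rule paradoxicalE[OF par])
  note V = bspec[OF bspec[OF par'(1)]] and cover = bspec[OF par'(2)]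
  have L: "Lop G B \<in> closure steinberg" if "B \<in> Ga" for B
    using steinberg_Lop[OF that] closure_subset by blast
  define \<mu> where "\<mu> B = Re (\<tau> (Lop G B))" for B
  have unit_sq: "Lop G B = adj (Lop G B) o\<^sub>L Lop G B" if "B \<in> Ga" "B \<subseteq> units G" for B
  proof -
    have "dmap G ` B = B"
      using that(2) by (force simp: dmap_unit)
    then show ?thesis
      by (simp add: adj_Lop_compose_Lop that)
  qed
  have \<mu>_real: "\<tau> (Lop G B) = of_real (\<mu> B)" "\<mu> B \<ge> 0" if B: "B \<in> Ga" "B \<subseteq> units G" for B
  proof -
    have "\<tau> (adj (Lop G B) o\<^sub>L Lop G B) \<in> \<real>\<^sub>\<ge>\<^sub>0"
      using \<tau> L[OF B(1)] unfolding tracial_state_def by blast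
    then have "\<tau> (Lop G B) \<in> \<real>\<^sub>\<ge>\<^sub>0"
      unfolding unit_sq[OF B, symmetric] .
    then show "\<tau> (Lop G B) = of_real (\<mu> B)" "\<mu> B \<ge> 0"
      by (auto simp: \<mu>_def nonneg_Reals_def)
  qed
  have \<mu>_Un: "\<mu> (B \<union> C) = \<mu> B + \<mu> C"
    if "B \<in> Ga" "C \<in> Ga" "B \<subseteq> units G" "C \<subseteq> units G" "B \<inter> C = {}" for B C
  proof -
    have "B \<union> C \<in> Ga"
      by (rule units_subset_in_Ga) (use that in \<open>auto simp: Ga_compact Ga_open compact_Un\<close>)
    then have "Lop G (B \<union> C) = Lop G B + Lop G C"
      by (rule Lop_Un[OF that(1,2) _ that(5)])
    moreover have "\<tau> (Lop G B + Lop G C) = \<tau> (Lop G B) + \<tau> (Lop G C)"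
      using \<tau> L that(1,2) unfolding tracial_state_def by blast
    ultimately show ?thesis
      by (simp add: \<mu>_def)
  qed
  have diff_Ga: "B - C \<in> Ga" if "B \<in> Ga" "C \<in> Ga" for B C
    using Ga_Int_clopen[OF that(1), of "- C"] Ga_open[OF that(2)] Ga_closed[OF that(2)]
    by (simp add: Diff_eq open_Compl closed_Compl)
  have \<mu>_mono: "\<mu> B \<le> \<mu> C" if "B \<in> Ga" "C \<in> Ga" "B \<subseteq> C" "C \<subseteq> units G" for B C
  proof -
    have "B \<union> (C - B) = C" using that by blast
    then have "\<mu> C = \<mu> B + \<mu> (C - B)"
      using \<mu>_Un[of B "C - B"] that diff_Ga[of C B] by auto
    moreover have "\<mu> (C - B) \<ge> 0"
      by (rule \<mu>_real(2)) (use that diff_Ga in auto)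
    ultimately show ?thesis by simp
  qed
  have \<mu>_subadd: "\<mu> (\<Union>i\<in>I. B i) \<le> (\<Sum>i\<in>I. \<mu> (B i))"
    if "finite I" "\<And>i. i \<in> I \<Longrightarrow> B i \<in> Ga \<and> B i \<subseteq> units G" for I :: "nat set" and B
    using that
  proof (induction I rule: finite_induct)
    case empty
    have "Lop G {} = cscale 0 (Lop G {})"
      by (simp add: Lop_empty cscale_zero)
    then have "\<tau> (Lop G {}) = 0 * \<tau> (Lop G {})"
      using \<tau> L[OF empty_in_Ga] unfolding tracial_state_def by metis
    then show ?case by (simp add: \<mu>_def)
  next
    case (insert i I)
    let ?U = "\<Union>i\<in>I. B i"
    have U: "?U \<in> Ga" by (rule finite_Union_Ga) (use insert in auto)
    have "(\<Union>i\<in>insert i I. B i) = ?U \<union> (B i - ?U)" by auto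
    then have "\<mu> (\<Union>i\<in>insert i I. B i) = \<mu> ?U + \<mu> (B i - ?U)"
      using \<mu>_Un[OF U diff_Ga[of "B i" ?U]] U insert.prems by auto
    also have "\<mu> (B i - ?U) \<le> \<mu> (B i)"
      by (rule \<mu>_mono) (use insert.prems U diff_Ga in auto)
    also have "\<mu> ?U \<le> (\<Sum>i\<in>I. \<mu> (B i))"
      using insert by simp
    finally show ?case
      using insert.hyps by simp
  qed
  have \<mu>_sum: "(\<Sum>i\<in>I. \<mu> (B i)) = \<mu> (\<Union>i\<in>I. B i)"
    if "finite I" "\<And>i. i \<in> I \<Longrightarrow> B i \<in> Ga \<and> B i \<subseteq> units G" "disjoint_family_on B I"
    for I :: "(nat \<times> nat) set" and B
    using that
  proof (induction I rule: finite_induct)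
    case empty
    have "\<mu> {} = 0"
      using \<mu>_Un[of "{}" "{}"] empty_in_Ga by simp
    then show ?case by simp
  next
    case (insert i I)
    let ?U = "\<Union>i\<in>I. B i"
    have U: "?U \<in> Ga" by (rule finite_Union_Ga) (use insert in auto)
    have "B i \<inter> ?U = {}"
      using insert.prems(2) insert.hyps(2) by (auto simp: disjoint_family_on_def)
    then have "\<mu> (B i \<union> ?U) = \<mu> (B i) + \<mu> ?U"
      using insert.prems(1) U by (intro \<mu>_Un) auto
    moreover have "disjoint_family_on B I"
      using insert.prems(2) by (auto simp: disjoint_family_on_def)
    ultimately show ?case
      using insert by simp
  qed
  have \<mu>_inv: "\<mu> (dmap G ` W) = \<mu> (rmap G ` W)" if W: "W \<in> Ga" for W
  proof -
    have "adj (Lop G W) \<in> closure steinberg"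
      by (rule closure_steinberg_adj[OF L[OF W]])
    then have "\<tau> (adj (Lop G W) o\<^sub>L Lop G W) = \<tau> (Lop G W o\<^sub>L adj (Lop G W))"
      using \<tau> L[OF W] unfolding tracial_state_def by blast
    then show ?thesis
      by (simp add: \<mu>_def adj_Lop_compose_Lop Lop_compose_adj_Lop W)
  qed
  have "\<mu> A > 0"
  proof (rule ccontr)
    assume "\<not> \<mu> A > 0"
    then have "\<tau> (adj (Lop G A) o\<^sub>L Lop G A) = 0"
      using \<mu>_real[OF A Au(1)] unit_sq[OF A Au(1)] by simp
    then have "Lop G A = 0"
      using faith L[OF A] by (simp add: faithful_def)
    moreover obtain x where "x \<in> A" using Au(2) by blast
    ultimately show False
      using mcoeff_Lop_unit[OF A, of x] Au(1) by (auto simp: mcoeff_zero)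
  qed
  let ?S = "SIGMA i:{1..k}. {1..n i}"
  have "real k * \<mu> A = (\<Sum>i\<in>{1..k}. \<mu> A)"
    by simp
  also have "\<dots> \<le> (\<Sum>i\<in>{1..k}. \<Sum>j\<in>{1..n i}. \<mu> (dmap G ` V i j))"
  proof (rule sum_mono)
    fix i assume i: "i \<in> {1..k}"
    have "\<mu> (\<Union>j\<in>{1..n i}. dmap G ` V i j) \<le> (\<Sum>j\<in>{1..n i}. \<mu> (dmap G ` V i j))"
      by (rule \<mu>_subadd) (use V[OF i] dmap_image_Ga in auto)
    then show "\<mu> A \<le> (\<Sum>j\<in>{1..n i}. \<mu> (dmap G ` V i j))"
      by (simp only: cover[OF i])
  qed
  also have "\<dots> = (\<Sum>i\<in>{1..k}. \<Sum>j\<in>{1..n i}. \<mu> (rmap G ` V i j))"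
    by (intro sum.cong refl \<mu>_inv) (use V in blast)
  also have "\<dots> = (\<Sum>(i, j)\<in>?S. \<mu> (rmap G ` V i j))"
    by (rule sum.Sigma) auto
  also have "\<dots> = (\<Sum>c\<in>{1..l}. \<Sum>z\<in>{z\<in>?S. (\<lambda>(i, j). m i j) z = c}. (\<lambda>(i, j). \<mu> (rmap G ` V i j)) z)"
    by (rule sum.group[symmetric]) (use V in auto)
  also have "\<dots> \<le> (\<Sum>c\<in>{1..l}. \<mu> A)"
  proof (rule sum_mono)
    fix c assume "c \<in> {1..l}"
    let ?I = "{z\<in>?S. (\<lambda>(i, j). m i j) z = c}"
    let ?B = "\<lambda>(i, j). rmap G ` V i j"
    have B: "?B z \<in> Ga \<and> ?B z \<subseteq> A" if z: "z \<in> ?I" for z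
    proof -
      obtain i j where "z = (i, j)" "i \<in> {1..k}" "j \<in> {1..n i}" using z by auto
      then show ?thesis
        using V[of i j] rmap_image_Ga by auto
    qed
    have fin: "finite ?I" by (rule finite_subset[of _ ?S]) auto
    have "disjoint_family_on ?B ?I"
      unfolding disjoint_family_on_def
    proof (intro ballI impI)
      fix z w assume zw: "z \<in> ?I" "w \<in> ?I" "z \<noteq> w"
      then have "(\<lambda>(i, j). (rmap G ` V i j) \<times> {m i j}) z \<inter> (\<lambda>(i, j). (rmap G ` V i j) \<times> {m i j}) w = {}"
        using disj unfolding disjoint_family_on_def by blast
      then show "?B z \<inter> ?B w = {}"
        using zw by auto
    qed
    then have "(\<Sum>z\<in>?I. \<mu> (?B z)) = \<mu> (\<Union>z\<in>?I. ?B z)"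
      using B Au(1) by (intro \<mu>_sum fin) blast
    also have "\<dots> \<le> \<mu> A"
    proof (rule \<mu>_mono[OF _ A _ Au(1)])
      show "(\<Union>z\<in>?I. ?B z) \<in> Ga"
        by (rule finite_Union_Ga[OF fin]) (use B Au(1) in blast)
      show "(\<Union>z\<in>?I. ?B z) \<subseteq> A"
        using B by blast
    qed
    also have "(\<Sum>z\<in>?I. \<mu> (?B z)) = (\<Sum>z\<in>?I. (\<lambda>(i, j). \<mu> (rmap G ` V i j)) z)"
      by (intro sum.cong refl) auto
    finally show "(\<Sum>z\<in>?I. (\<lambda>(i, j). \<mu> (rmap G ` V i j)) z) \<le> \<mu> A" .
  qed
  also have "\<dots> = real l * \<mu> A"
    by simp
  finally have "real k \<le> real l"
    using \<open>\<mu> A > 0\<close> by simp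
  with lk show False by simp
qed

text \<open>A decomposition of \<open>k\<close> copies of the unit space inside \<open>l < k\<close> copies, made disjoint on the
  source side, is the graph of a proper isometry of size \<open>k\<close>: the entry in row \<open>a\<close> and column \<open>b\<close>
  collects the bisections leading from copy \<open>b\<close> to copy \<open>a\<close>, and the last row is zero.\<close>

lemma not_stably_finite_if_paradoxical_units:
  assumes cu: "compact (units G)" and l: "l < k" and par: "paradoxical G k l (units G)"
  shows "\<not> stably_finite (closure steinberg)"
proof -
  note star = unital_star_algebra_closure_steinberg[OF cu]
  obtain n :: "nat \<Rightarrow> nat" and V m where par':
      "\<forall>i\<in>{1..k}. \<forall>j\<in>{1..n i}. V i j \<in> Ga \<and> m i j \<in> {1..l} \<and>
        (rmap G ` V i j) \<times> {m i j} \<subseteq> units G \<times> {1..l}"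
      "\<forall>i\<in>{1..k}. (\<Union>j\<in>{1..n i}. dmap G ` V i j) = units G"
    and disj: "disjoint_family_on (\<lambda>(i, j). (rmap G ` V i j) \<times> {m i j}) (SIGMA i:{1..k}. {1..n i})"
    by (rule paradoxicalE[OF par])
  note V = bspec[OF bspec[OF par'(1)]] and cover = bspec[OF par'(2)]
  (* Each source is taken only from the first bisection that has it. *)
  define W where "W i j = {v \<in> V i j. dmap G v \<in> - (\<Union>j'\<in>{1..<j}. dmap G ` V i j')}" for i j
  have W: "W i j \<in> Ga" if i: "i \<in> {1..k}" and j: "j \<in> {1..n i}" for i j
  proof -
    have "(\<Union>j'\<in>{1..<j}. dmap G ` V i j') \<in> Ga"
    proof (rule finite_Union_Ga)
      fix j' assume "j' \<in> {1..<j}"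
      then have "j' \<in> {1..n i}" using j by auto
      then show "dmap G ` V i j' \<in> Ga \<and> dmap G ` V i j' \<subseteq> units G"
        using V[OF i] dmap_image_Ga by auto
    qed simp
    then show ?thesis
      unfolding W_def using V[OF i j]
      by (intro restrict_dmap_Ga open_Compl closed_Compl Ga_open Ga_closed) simp_all
  qed
  have W_cover: "(\<Union>j\<in>{1..n i}. dmap G ` W i j) = units G" if i: "i \<in> {1..k}" for i
  proof
    show "units G \<subseteq> (\<Union>j\<in>{1..n i}. dmap G ` W i j)"
    proof
      fix x assume x: "x \<in> units G"
      define j where "j = (LEAST j. j \<in> {1..n i} \<and> x \<in> dmap G ` V i j)"
      have ex: "\<exists>j. j \<in> {1..n i} \<and> x \<in> dmap G ` V i j"
        using x cover[OF i] by blast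
      have j: "j \<in> {1..n i}" "x \<in> dmap G ` V i j"
        using LeastI_ex[OF ex] by (simp_all add: j_def)
      have "x \<notin> dmap G ` V i j'" if "j' \<in> {1..<j}" for j'
      proof -
        have "j' < j" "j' \<in> {1..n i}"
          using that j(1) by auto
        then show ?thesis
          using not_less_Least[of j' "\<lambda>j. j \<in> {1..n i} \<and> x \<in> dmap G ` V i j"]
          unfolding j_def by blast
      qed
      then have "x \<in> dmap G ` W i j"
        using j(2) by (auto simp: W_def)
      then show "x \<in> (\<Union>j\<in>{1..n i}. dmap G ` W i j)"
        using j(1) by blast
    qed
  qed auto
  have W_disj: "disjoint_family_on (\<lambda>j. dmap G ` W i j) {1..n i}" for i
  proof -
    have "dmap G ` W i j \<inter> dmap G ` W i j' = {}" if "1 \<le> j" "j < j'" for j j'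
    proof -
      have "dmap G ` W i j \<subseteq> (\<Union>j''\<in>{1..<j'}. dmap G ` V i j'')"
        using that by (auto simp: W_def)
      moreover have "dmap G ` W i j' \<inter> (\<Union>j''\<in>{1..<j'}. dmap G ` V i j'') = {}"
        by (auto simp: W_def)
      ultimately show ?thesis by blast
    qed
    then show ?thesis
      unfolding disjoint_family_on_def by (metis Int_commute atLeastAtMost_iff nat_neq_iff)
  qed
  (* Copies and levels are numbered from 1, rows and columns from 0. *)
  define J where "J a b = {j \<in> {1..n (Suc b)}. m (Suc b) j = Suc a}" for a b
  define v where "v a b = (if a < k \<and> b < k then \<Sum>j\<in>J a b. Lop G (W (Suc b) j) else 0)" for a b
  have WJ: "W (Suc b) j \<in> Ga" if "b < k" "j \<in> J a b" for a b j
    using that by (intro W) (auto simp: J_def)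
  have L: "Lop G B \<in> closure steinberg" if "B \<in> Ga" for B
    using steinberg_Lop[OF that] closure_subset by blast
  have vm: "v \<in> matrices k (closure steinberg)"
    unfolding matrices_def v_def by (auto intro!: star_algebra_sum[OF star] L WJ)
  have cross: "adj (Lop G (W (Suc a) j)) o\<^sub>L Lop G (W (Suc b) j') =
      (if a = b \<and> j = j' then Lop G (dmap G ` W (Suc a) j) else 0)"
    if "a < k" "b < k" "j \<in> J c a" "j' \<in> J c b" for a b c j j'
  proof (cases "a = b \<and> j = j'")
    case True
    then show ?thesis
      using that by (simp add: adj_Lop_compose_Lop WJ)
  next
    case False
    have mem: "(Suc a, j) \<in> (SIGMA i:{1..k}. {1..n i})" "(Suc b, j') \<in> (SIGMA i:{1..k}. {1..n i})"
      and m: "m (Suc a) j = m (Suc b) j'"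
      using that by (auto simp: J_def)
    have "(rmap G ` V (Suc a) j) \<times> {m (Suc a) j} \<inter> (rmap G ` V (Suc b) j') \<times> {m (Suc b) j'} = {}"
      using disjoint_family_onD[OF disj mem] False by auto
    then have "rmap G ` V (Suc a) j \<inter> rmap G ` V (Suc b) j' = {}"
      by (auto simp: m)
    then have "rmap G ` W (Suc a) j \<inter> rmap G ` W (Suc b) j' = {}"
      by (auto simp: W_def)
    then have "adj (Lop G (W (Suc a) j)) o\<^sub>L Lop G (W (Suc b) j') = 0"
      by (intro adj_Lop_compose_Lop_disjoint WJ[OF that(1,3)] WJ[OF that(2,4)])
    then show ?thesis
      using False by auto
  qed
  have entry: "adj (v c a) o\<^sub>L v c b =
      (if a = b then \<Sum>j\<in>J c a. Lop G (dmap G ` W (Suc a) j) else 0)"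
    if abc: "a < k" "b < k" "c < k" for a b c
  proof -
    have "adj (v c a) = (\<Sum>j\<in>J c a. adj (Lop G (W (Suc a) j)))"
      unfolding v_def using abc
      by (simp add: adj_sum[THEN conjunct1] complex_linear_Lop WJ)
    then have "adj (v c a) o\<^sub>L v c b =
        (\<Sum>j'\<in>J c b. \<Sum>j\<in>J c a. adj (Lop G (W (Suc a) j)) o\<^sub>L Lop G (W (Suc b) j'))"
      using abc by (simp add: v_def compose_sum_left compose_sum_right)
    also have "\<dots> = (\<Sum>j'\<in>J c b. \<Sum>j\<in>J c a. if a = b \<and> j = j' then Lop G (dmap G ` W (Suc a) j) else 0)"
      using abc by (intro sum.cong refl cross)
    also have "\<dots> = (if a = b then \<Sum>j\<in>J c a. Lop G (dmap G ` W (Suc a) j) else 0)"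
      by (auto simp: J_def)
    finally show ?thesis .
  qed
  have vv: "mat_mul k (mat_adj v) v = mat_one k"
  proof (intro ext)
    fix a b
    show "mat_mul k (mat_adj v) v a b = mat_one k a b"
    proof (cases "a < k \<and> b < k")
      case False
      then have "mat_mul k (mat_adj v) v a b = 0"
        using mat_mul_in[OF star mat_adj_in[OF star vm] vm] matrices_outside[OF star] by blast
      then show ?thesis
        using False by (auto simp: mat_one_def)
    next
      case True
      have "mat_mul k (mat_adj v) v a b =
          (\<Sum>c<k. if a = b then \<Sum>j\<in>J c a. Lop G (dmap G ` W (Suc a) j) else 0)"
        unfolding mat_mul_def mat_adj_def using True by (intro sum.cong) (simp_all add: entry)
      also have "\<dots> = (if a = b then id_blinfun else 0)"
      proof (cases "a = b")
        case [simp]: True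
        have i: "Suc b \<in> {1..k}" using \<open>a < k \<and> b < k\<close> by simp
        have m: "m (Suc b) j - 1 < k \<and> m (Suc b) j \<ge> 1" if "j \<in> {1..n (Suc b)}" for j
          using V[OF i that] l by auto
        have "(\<Sum>c<k. \<Sum>j\<in>J c b. Lop G (dmap G ` W (Suc b) j)) =
            (\<Sum>c<k. \<Sum>j\<in>{j\<in>{1..n (Suc b)}. m (Suc b) j - 1 = c}. Lop G (dmap G ` W (Suc b) j))"
          unfolding J_def by (intro sum.cong refl Collect_cong) (use m in force)
        also have "\<dots> = (\<Sum>j\<in>{1..n (Suc b)}. Lop G (dmap G ` W (Suc b) j))"
          by (rule sum.group) (use m in auto)
        also have "\<dots> = Lop G (\<Union>j\<in>{1..n (Suc b)}. dmap G ` W (Suc b) j)"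
          by (rule Lop_disjoint_Union[symmetric]) (use W[OF i] W_disj dmap_image_Ga in auto)
        also have "\<dots> = id_blinfun"
          by (simp only: W_cover[OF i] Lop_units[OF cu])
        finally show ?thesis by simp
      qed simp
      finally show ?thesis
        using True by (simp add: mat_one_def)
    qed
  qed
  have "v (k - 1) b = 0" for b
  proof (cases "b < k")
    case True
    have "J (k - 1) b = {}"
      using V[of "Suc b"] True l by (force simp: J_def)
    then show ?thesis by (simp add: v_def)
  qed (simp add: v_def)
  then have "mat_mul k v (mat_adj v) (k - 1) (k - 1) = 0"
    by (simp add: mat_mul_def)
  moreover have "mat_one k (k - 1) (k - 1) = (id_blinfun :: 'g operator)"
    using l by (simp add: mat_one_def)
  ultimately have "mat_mul k v (mat_adj v) \<noteq> mat_one k"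
    using id_blinfun_neq_0 by metis
  then show ?thesis
    using l by (intro not_stably_finite_if_isometry[OF star _ vm vv]) auto
qed

end

section \<open>The equivalence\<close>

theorem theorem5:
  fixes G :: "'g::t2_space groupoid"
  assumes "ample_groupoid G"
    and "minimal G"
    and "compact (units G)"
  shows "((\<exists>\<tau>. tracial_state (reduced_cstar G) \<tau> \<and> faithful (reduced_cstar G) \<tau>)
            \<longleftrightarrow> stably_finite (reduced_cstar G))
       \<and> (stably_finite (reduced_cstar G)
            \<longleftrightarrow> (\<forall>A. openin (top_of_set (units G)) A \<and> closedin (top_of_set (units G)) A
                    \<longrightarrow> completely_nonparadoxical G A))"
proof -
  interpret ample_groupoid G by fact
  note star = unital_star_algebra_closure_steinberg[OF assms(3)]
  let ?trace = "\<exists>\<tau>. tracial_state (closure steinberg) \<tau> \<and> faithful (closure steinberg) \<tau>"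
  let ?np = "\<forall>A. openin (top_of_set (units G)) A \<and> closedin (top_of_set (units G)) A
      \<longrightarrow> completely_nonparadoxical G A"
  (* Either condition is applied at the unit space and yields a trace, and the trace returns both
     conditions in full. *)
  have 1: ?trace if "\<And>N. N > 0 \<Longrightarrow> \<not> paradoxical G (Suc N) N (units G)"
    using that by (rule faithful_trace_exists[OF assms(3,2)])
  have "?trace \<Longrightarrow> stably_finite (closure steinberg)"
    using stably_finite_if_faithful_trace[OF star] by blast
  moreover have "stably_finite (closure steinberg) \<Longrightarrow> ?trace"
    using 1 not_stably_finite_if_paradoxical_units[OF assms(3) lessI] by blast
  moreover have "?trace \<Longrightarrow> ?np"
  proof (elim exE conjE, intro allI impI, elim conjE)
    fix \<tau> A assume \<tau>: "tracial_state (closure steinberg) \<tau>" "faithful (closure steinberg) \<tau>"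
      and A: "openin (top_of_set (units G)) A" "closedin (top_of_set (units G)) A"
    have "A \<in> Ga"
    proof (rule units_subset_in_Ga)
      show "compact A"
        by (rule closedin_compact[OF assms(3) A(2)])
      show "open A"
        using A(1) open_units openin_open_eq by blast
      show "A \<subseteq> units G"
        using A(1) openin_imp_subset by blast
    qed
    then show "completely_nonparadoxical G A"
      by (rule nonparadoxical_if_faithful_trace[OF assms(3) \<tau>])
  qed
  moreover have "?np \<Longrightarrow> ?trace"
  proof (rule 1)
    fix N :: nat assume ?np and N: "N > 0"
    then have "completely_nonparadoxical G (units G)"
      by simp
    with N show "\<not> paradoxical G (Suc N) N (units G)"
      by (auto simp: completely_nonparadoxical_def)
  qed
  ultimately show ?thesis
    unfolding reduced_cstar_eq_closure_steinberg by blast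
qed

end
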